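(* Let $N_1,M_1,M_2\to+\infty$ with $M_1/N_1\to\alpha_{11}\in(0,+\infty)$ and $M_2/N_1\to\alpha_{12}\in(0,+\infty)$. Let $\mathbf{H}_{11}$ ($N_1\times M_1$) and $\mathbf{H}_{12}$ ($N_1\times M_2$) be independent random matrices with i.i.d. circularly symmetric complex Gaussian entries of mean $0$ and variances $1/M_1$ and $1/M_2$ respectively. Let $\sigma_1^2>0$, $p_{1,\max}>0$, and let $L_2=\dim\ker\tilde{\mathbf{H}}_1$, where $\tilde{\mathbf{H}}_1$ is the $m_1\times M_2$ matrix defined in the context. Put $$a=\left(1-\frac{1}{\sqrt{\alpha_{11}}}\right)^2,\qquad b=\left(1+\frac{1}{\sqrt{\alpha_{11}}}\right)^2,$$ and let $\beta_\infty$ be the unique solution $\beta>\sigma_1^2/b$ of $$\int_{\max(\sigma_1^2/\beta,\,a)}^{b}\left(\beta-\frac{\sigma_1^2}{\lambda}\right)\frac{\sqrt{(\lambda-a)(b-\lambda)}}{2\pi\lambda}\,\mathrm{d}\lambda-p_{1,\max}=0.$$ Then, almost surely, $L_2/M_2$ converges to $$L_{2,\infty}=\left(1-\frac{\alpha_{11}}{\alpha_{12}}\int_{\max(a,\,\sigma_1^2/\beta_\infty)}^{b}\frac{\sqrt{(\lambda-a)(b-\lambda)}}{2\pi\lambda}\,\mathrm{d}\lambda\right)^+.$$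
   Context: $(x)^+=\max(0,x)$. Let $\mathbf{H}_{11}=\mathbf{U}_{H_{11}}\boldsymbol{\Lambda}_{H_{11}}\mathbf{V}_{H_{11}}^H$ be a singular value decomposition with singular values in decreasing order, with $\mathbf{U}_{H_{11}}$ ($N_1\times N_1$) and $\mathbf{V}_{H_{11}}$ ($M_1\times M_1$) unitary, and let $\lambda_1\ge\cdots\ge\lambda_{M_1}$ be the eigenvalues of $\mathbf{H}_{11}^H\mathbf{H}_{11}$. The primary water-filling power allocation is $p_{1,n}=\left(\beta-\sigma_1^2/\lambda_n\right)^+$, $n=1,\ldots,M_1$ (with $p_{1,n}=0$ if $\lambda_n=0$), where $\beta$ is set so that $\sum_{n=1}^{M_1}p_{1,n}=M_1p_{1,\max}$; $m_1$ is the number of $n$ with $p_{1,n}>0$. $\tilde{\mathbf{H}}_1$ is the matrix formed by the first $m_1$ rows of $\mathbf{U}_{H_{11}}^H\mathbf{H}_{12}$. $L_2$ is the number of independent symbols the secondary transmitter can send simultaneously without affecting the primary link. *)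

theory Defs
  imports
    "HOL-Probability.Probability"
    "Jordan_Normal_Form.Matrix_Kernel"
    "Jordan_Normal_Form.Char_Poly"
    "Jordan_Normal_Form.Schur_Decomposition"
begin

text \<open>
  Matrices are those of \<open>Jordan_Normal_Form\<close>, whose dimensions are natural numbers and whose
  rows and columns are counted from 0. So row, column and eigenvalue number \<open>n\<close> of the usual
  1-based mathematical notation has index \<open>n - 1\<close> here.
\<close>

subsection \<open>Gaussian random matrices\<close>

text \<open>
  A circularly symmetric complex Gaussian variable of mean 0 and variance \<open>v = E |Z|^2\<close> has
  independent real and imaginary parts, each normal with mean 0 and variance \<open>v/2\<close>.
  The second parameter of \<open>normal_density\<close> is the standard deviation.
\<close>

definition circ_sym_gaussian :: "'w measure \<Rightarrow> real \<Rightarrow> ('w \<Rightarrow> complex) \<Rightarrow> bool" where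
  "circ_sym_gaussian P v Z \<longleftrightarrow>
     prob_space.indep_var P borel (\<lambda>w. Re (Z w)) borel (\<lambda>w. Im (Z w)) \<and>
     distributed P lborel (\<lambda>w. Re (Z w)) (normal_density 0 (sqrt (v / 2))) \<and>
     distributed P lborel (\<lambda>w. Im (Z w)) (normal_density 0 (sqrt (v / 2)))"

definition iid_gaussian_matrix ::
    "'w measure \<Rightarrow> nat \<Rightarrow> nat \<Rightarrow> real \<Rightarrow> ('w \<Rightarrow> complex mat) \<Rightarrow> bool" where
  "iid_gaussian_matrix P nr nc v H \<longleftrightarrow>
     (\<forall>w\<in>space P. H w \<in> carrier_mat nr nc) \<and>
     prob_space.indep_vars P (\<lambda>_. borel) (\<lambda>ij w. H w $$ ij) ({..<nr} \<times> {..<nc}) \<and>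
     (\<forall>ij \<in> {..<nr} \<times> {..<nc}. circ_sym_gaussian P v (\<lambda>w. H w $$ ij))"

text \<open>
  The type of matrices carries no sigma-algebra, so independence of two random matrices is
  independence of their families of entries, as random elements of the product spaces.
\<close>

definition indep_matrices ::
    "'w measure \<Rightarrow> nat \<Rightarrow> nat \<Rightarrow> ('w \<Rightarrow> complex mat) \<Rightarrow>
     nat \<Rightarrow> nat \<Rightarrow> ('w \<Rightarrow> complex mat) \<Rightarrow> bool" where
  "indep_matrices P nr nc A nr' nc' B \<longleftrightarrow>
     prob_space.indep_var P
       (PiM ({..<nr} \<times> {..<nc}) (\<lambda>_. borel)) (\<lambda>w. \<lambda>ij\<in>{..<nr} \<times> {..<nc}. A w $$ ij)
       (PiM ({..<nr'} \<times> {..<nc'}) (\<lambda>_. borel)) (\<lambda>w. \<lambda>ij\<in>{..<nr'} \<times> {..<nc'}. B w $$ ij)"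

subsection \<open>Singular value decomposition and eigenvalues\<close>

definition unitary_matrix :: "nat \<Rightarrow> complex mat \<Rightarrow> bool" where
  "unitary_matrix n U \<longleftrightarrow>
     U \<in> carrier_mat n n \<and> mat_adjoint U * U = 1\<^sub>m n \<and> U * mat_adjoint U = 1\<^sub>m n"

definition is_svd :: "complex mat \<Rightarrow> complex mat \<Rightarrow> complex mat \<Rightarrow> complex mat \<Rightarrow> bool" where
  "is_svd H U S V \<longleftrightarrow>
     unitary_matrix (dim_row H) U \<and> unitary_matrix (dim_col H) V \<and>
     (\<exists>s :: nat \<Rightarrow> real.
        (\<forall>i < min (dim_row H) (dim_col H). 0 \<le> s i) \<and>
        (\<forall>j < min (dim_row H) (dim_col H). \<forall>i \<le> j. s j \<le> s i) \<and>
        S = mat (dim_row H) (dim_col H) (\<lambda>(i, j). if i = j then complex_of_real (s i) else 0)) \<and>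
     H = U * S * mat_adjoint V"

text \<open>
  The eigenvalues, in decreasing order and repeated according to multiplicity, of a square
  matrix all of whose eigenvalues are real (in particular of a Hermitian matrix).
\<close>

definition eigenvalues_desc :: "complex mat \<Rightarrow> real list" where
  "eigenvalues_desc A = (THE ls. sorted_wrt (\<ge>) ls \<and>
     char_poly A = (\<Prod>l\<leftarrow>ls. [:- complex_of_real l, 1:]))"

subsection \<open>Water-filling and transmit opportunities\<close>

definition wf_power :: "real \<Rightarrow> real \<Rightarrow> real \<Rightarrow> real" where
  "wf_power sigma_sq \<beta> l = (if l = 0 then 0 else max 0 (\<beta> - sigma_sq / l))"

text \<open>
  The water level is unique as soon as \<open>sigma_sq\<close> and \<open>p_max\<close> are positive and the (nonnegative)
  eigenvalues are not all zero, i.e. as soon as the channel matrix is nonzero.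
\<close>

definition water_level :: "real \<Rightarrow> real \<Rightarrow> real list \<Rightarrow> real" where
  "water_level sigma_sq p_max ls =
     (THE \<beta>. (\<Sum>n<length ls. wf_power sigma_sq \<beta> (ls ! n)) = real (length ls) * p_max)"

definition num_used :: "real \<Rightarrow> real \<Rightarrow> complex mat \<Rightarrow> nat" where
  "num_used sigma_sq p_max H =
     (let ls = eigenvalues_desc (mat_adjoint H * H); \<beta> = water_level sigma_sq p_max ls
      in card {n. n < length ls \<and> 0 < wf_power sigma_sq \<beta> (ls ! n)})"

definition first_rows :: "nat \<Rightarrow> complex mat \<Rightarrow> complex mat" where
  "first_rows m A = mat m (dim_col A) (\<lambda>(i, j). A $$ (i, j))"

text \<open>\<open>U\<close> is the left unitary factor of a singular value decomposition of \<open>H11\<close>.\<close>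

definition transmit_opportunities ::
    "real \<Rightarrow> real \<Rightarrow> complex mat \<Rightarrow> complex mat \<Rightarrow> complex mat \<Rightarrow> nat" where
  "transmit_opportunities sigma_sq p_max H11 U H12 =
     kernel_dim (first_rows (num_used sigma_sq p_max H11) (mat_adjoint U * H12))"

subsection \<open>The limiting quantities\<close>

definition mp_density :: "real \<Rightarrow> real \<Rightarrow> real \<Rightarrow> real" where
  "mp_density a b l = sqrt ((l - a) * (b - l)) / (2 * pi * l)"

definition is_limit_water_level :: "real \<Rightarrow> real \<Rightarrow> real \<Rightarrow> real \<Rightarrow> real \<Rightarrow> bool" where
  "is_limit_water_level sigma_sq p_max a b \<beta> \<longleftrightarrow>
     sigma_sq / b < \<beta> \<and>
     integral {max (sigma_sq / \<beta>) a..b} (\<lambda>l. (\<beta> - sigma_sq / l) * mp_density a b l) - p_max = 0"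

end

theory Submission
  imports Defs
begin

text \<open>
  Gaussian integration by parts gives a closed recursion (the loop equation) for expectations of products of
  the centred traces \<open>tr (H H\<^sup>*)\<^sup>k / N\<close>. It shows that a product of \<open>s\<close> of them has expectation
  \<open>O(N\<^sup>-\<^sup>s)\<close>; fourth moments and Borel--Cantelli over the \<open>O(N\<^sup>2)\<close> relevant size triples then make the
  empirical moments converge almost surely to the solution of the limit recursion, whatever the speed at which
  \<open>N\<^sub>1\<close> grows. The moments of the Marchenko--Pastur density satisfy the same recursion, which is the
  first-passage decomposition for Chebyshev polynomials.

  Moment convergence and compact support give the limit of \<open>(1 / M\<^sub>1) \<Sum> (\<beta> - \<sigma>\<^sup>2 / \<lambda>\<^sub>n)\<^sup>+\<close> for each
  \<open>\<beta>\<close>. These functions of \<open>\<beta>\<close> are convex with slope \<open>m\<^sub>1 / M\<^sub>1\<close>, so the water level and the fraction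
  of used modes converge as well.

  Finally, the first \<open>m\<^sub>1\<close> columns of \<open>U\<close> span the spectral subspace of \<open>H\<^sub>1\<^sub>1 H\<^sub>1\<^sub>1\<^sup>*\<close> above a rational threshold,
  so the dimension of the kernel depends only on \<open>H\<^sub>1\<^sub>1\<close> and \<open>H\<^sub>1\<^sub>2\<close> and not on the choice of the decomposition.
  The spectral projection is a pointwise limit of polynomials in \<open>H\<^sub>1\<^sub>1 H\<^sub>1\<^sub>1\<^sup>*\<close>, hence measurable, and Fubini shows that
  \<open>H\<^sub>1\<^sub>2\<close> is almost surely in general position with respect to it. The kernel has
  dimension \<open>max 0 (M\<^sub>2 - m\<^sub>1)\<close>.
\<close>

subsection \<open>Gaussian integration by parts\<close>

text \<open>The factor \<open>U k w\<close> may depend on \<open>w\<close> in a non-measurable way,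
  so it cannot be conditioned on. General position is therefore proved for projections cut off at a
  deterministic threshold; taking the thresholds rational leaves countably many null sets. Matrices
  of different sizes have no prescribed joint law, so error bounds are summed over sizes and not
  along the index \<open>k\<close>. For fixed N there are of order N^2 pairs of other sizes. Second
  moments, of order N^-2, would not give a summable bound; fourth moments leave N^-2. If M_1 exceeds
  N_1, then H^* H has a forced kernel and its spectrum an atom at 0 in the limit. Allocated power
  vanishes near 0, so every test function carries a factor x; this hides the atom and turns the
  density into a bounded weight. The largest eigenvalue is never estimated: high moments control the
  tail. The indicator of an active mode is discontinuous, so moment convergence does not reach it
  directly; convexity of the power in the level replaces it by difference quotients.\<close>

lemma normal_moment_IBP:
  fixes s :: real
  assumes s: "0 < s"
  shows "(\<integral>x. normal_density 0 s x * x ^ Suc n \<partial>lborel)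
    = s\<^sup>2 * real n * (\<integral>x. normal_density 0 s x * x ^ (n - 1) \<partial>lborel)"
\<comment> \<open>The identity is read off from the closed forms of the normal moments. For even
  \<open>n\<close> both sides vanish; at \<open>n = 0\<close> the truncated exponent
  \<open>n - 1\<close> is harmless because of the factor \<open>n\<close>.\<close>
proof (cases "even n")
  case True
  then obtain k where n: "n = 2 * k" by (elim evenE)
  have o: "(\<integral>x. normal_density 0 s x * x ^ (2 * k + 1) \<partial>lborel) = 0" for k
    using integral_normal_moment_odd[OF s, of 0 k] by simp
  show ?thesis
  proof (cases k)
    case 0
    then show ?thesis using o[of 0] n by simp
  next
    case (Suc j)
    have "n - 1 = 2 * j + 1" "Suc n = 2 * (j + 1) + 1" using n Suc by auto
    then show ?thesis using o[of j] o[of "j + 1"] by (simp only: mult_zero_right)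
  qed
next
  case False
  then obtain k where n: "n = 2 * k + 1" by (elim oddE)
  have e: "(\<integral>x. normal_density 0 s x * x ^ (2 * k) \<partial>lborel) = fact (2 * k) / ((2 / s\<^sup>2)^k * fact k)" for k
    using integral_normal_moment_even[OF s, of 0 k] by simp
  have "Suc n = 2 * Suc k" "n - 1 = 2 * k" using n by auto
  moreover have "F * ((2 * r + 2) * (2 * r + 1)) / (D * (2 / s\<^sup>2) * (G * (r + 1))) = s\<^sup>2 * (2 * r + 1) * (F / (D * G))"
    if "0 \<le> r" "D \<noteq> 0" "G \<noteq> 0" for F D G r :: real
  proof -
    have "r + 1 \<noteq> 0" using that by simp
    then show ?thesis using that s by (simp add: divide_simps) algebra
  qed
  from this[of "real k" "(2 / s\<^sup>2) ^ k" "fact k" "fact (2 * k)"]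
  have "fact (2 * Suc k) / ((2 / s\<^sup>2) ^ Suc k * fact (Suc k)) = s\<^sup>2 * real n * (fact (2 * k) / ((2 / s\<^sup>2) ^ k * fact k))"
    using s by (simp add: n algebra_simps)
  ultimately show ?thesis by (simp only: e)
qed

text \<open>A polynomial travels together with its two partial derivatives. One induction over
  monomials and sums then yields integrability and integration by parts at once, without any
  calculus of derivatives.\<close>

inductive bipoly :: "(real \<Rightarrow> real \<Rightarrow> complex) \<Rightarrow> (real \<Rightarrow> real \<Rightarrow> complex) \<Rightarrow>
    (real \<Rightarrow> real \<Rightarrow> complex) \<Rightarrow> bool" where
  mono: "bipoly (\<lambda>x y. c * of_real (x ^ a * y ^ b))
    (\<lambda>x y. c * of_real (real a * x ^ (a - 1) * y ^ b))
    (\<lambda>x y. c * of_real (real b * x ^ a * y ^ (b - 1)))"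
| add: "bipoly f f1 f2 \<Longrightarrow> bipoly g g1 g2 \<Longrightarrow>
    bipoly (\<lambda>x y. f x y + g x y) (\<lambda>x y. f1 x y + g1 x y) (\<lambda>x y. f2 x y + g2 x y)"

lemma bipoly_cmult:
  "bipoly f f1 f2 \<Longrightarrow> bipoly (\<lambda>x y. d * f x y) (\<lambda>x y. d * f1 x y) (\<lambda>x y. d * f2 x y)"
proof (induction rule: bipoly.induct)
  case (mono c a b)
  show ?case using bipoly.mono[of "d * c" a b] by (simp add: mult.assoc)
next
  case (add f f1 f2 g g1 g2)
  from bipoly.add[OF add.IH] show ?case by (simp add: distrib_left)
qed

lemma bipoly_times_x:
  "bipoly f f1 f2 \<Longrightarrow> bipoly (\<lambda>x y. of_real x * f x y) (\<lambda>x y. f x y + of_real x * f1 x y)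
     (\<lambda>x y. of_real x * f2 x y)"
proof (induction rule: bipoly.induct)
  case (mono c a b)
  have *: "c * of_real (x ^ a * y ^ b) + of_real x * (c * of_real (real a * x ^ (a - 1) * y ^ b))
      = c * of_real (real (Suc a) * x ^ a * y ^ b)" for x y :: real
    by (cases a) (simp_all add: algebra_simps)
  show ?case unfolding * using bipoly.mono[of c "Suc a" b] by (simp add: ac_simps)
next
  case (add f f1 f2 g g1 g2)
  from bipoly.add[OF add.IH] show ?case by (simp add: algebra_simps)
qed

lemma bipoly_times_y:
  "bipoly f f1 f2 \<Longrightarrow> bipoly (\<lambda>x y. of_real y * f x y) (\<lambda>x y. of_real y * f1 x y)
     (\<lambda>x y. f x y + of_real y * f2 x y)"
proof (induction rule: bipoly.induct)
  case (mono c a b)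
  have *: "c * of_real (x ^ a * y ^ b) + of_real y * (c * of_real (real b * x ^ a * y ^ (b - 1)))
      = c * of_real (real (Suc b) * x ^ a * y ^ b)" for x y :: real
    by (cases b) (simp_all add: algebra_simps)
  show ?case unfolding * using bipoly.mono[of c a "Suc b"] by (simp add: ac_simps)
next
  case (add f f1 f2 g g1 g2)
  from bipoly.add[OF add.IH] show ?case by (simp add: algebra_simps)
qed

text \<open>The combination d/dx + i d/dy is twice the derivative in cnj z. It annihilates z = x + i
  y and sends cnj z to 2; the product rule gives this lemma and the term \<open>2 * f x y\<close> in
  the next one.\<close>

lemma bipoly_Complex_mult:
  assumes "bipoly f f1 f2"
  shows "\<exists>g1 g2. bipoly (\<lambda>x y. Complex x y * f x y) g1 g2 \<and>
    (\<forall>x y. g1 x y + \<i> * g2 x y = Complex x y * (f1 x y + \<i> * f2 x y))"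
proof -
  have c: "Complex x y = of_real x + \<i> * of_real y" for x y
    by (simp add: complex_eq_iff)
  have "bipoly (\<lambda>x y. Complex x y * f x y) (\<lambda>x y. (f x y + of_real x * f1 x y) + \<i> * (of_real y * f1 x y))
    (\<lambda>x y. of_real x * f2 x y + \<i> * (f x y + of_real y * f2 x y))"
    using bipoly.add[OF bipoly_times_x[OF assms] bipoly_cmult[OF bipoly_times_y[OF assms], of \<i>]]
    unfolding c by (simp add: distrib_right mult.assoc)
  then show ?thesis
    by (intro exI conjI) (assumption, simp add: c algebra_simps)
qed

lemma bipoly_cnj_Complex_mult:
  assumes "bipoly f f1 f2"
  shows "\<exists>g1 g2. bipoly (\<lambda>x y. cnj (Complex x y) * f x y) g1 g2 \<and>
    (\<forall>x y. g1 x y + \<i> * g2 x y = 2 * f x y + cnj (Complex x y) * (f1 x y + \<i> * f2 x y))"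
proof -
  have c: "cnj (Complex x y) = of_real x + (- \<i>) * of_real y" for x y
    by (simp add: complex_eq_iff)
  have "bipoly (\<lambda>x y. cnj (Complex x y) * f x y) (\<lambda>x y. (f x y + of_real x * f1 x y) + (- \<i>) * (of_real y * f1 x y))
    (\<lambda>x y. of_real x * f2 x y + (- \<i>) * (f x y + of_real y * f2 x y))"
    using bipoly.add[OF bipoly_times_x[OF assms] bipoly_cmult[OF bipoly_times_y[OF assms], of "- \<i>"]]
    unfolding c distrib_right mult.assoc .
  then show ?thesis
    by (intro exI conjI) (assumption, simp add: c algebra_simps)
qed

lemma bipoly_Complex_power:
  "\<exists>f1 f2. bipoly (\<lambda>x y. Complex x y ^ p * cnj (Complex x y) ^ q) f1 f2 \<and>
    (\<forall>x y. f1 x y + \<i> * f2 x y = 2 * (of_nat q * (Complex x y ^ p * cnj (Complex x y) ^ (q - 1))))"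
proof (induction p)
  case 0
  show ?case
  proof (induction q)
    case 0
    show ?case using bipoly.mono[of 1 0 0] by (intro exI conjI) auto
  next
    case (Suc q)
    have *: "of_nat q * (z * z ^ (q - 1)) = of_nat q * z ^ q" for z :: complex by (cases q) auto
    from Suc obtain f1 f2 where f: "bipoly (\<lambda>x y. Complex x y ^ 0 * cnj (Complex x y) ^ q) f1 f2"
      "\<And>x y. f1 x y + \<i> * f2 x y = 2 * (of_nat q * (Complex x y ^ 0 * cnj (Complex x y) ^ (q - 1)))"
      by auto
    from bipoly_cnj_Complex_mult[OF f(1)] obtain g1 g2 where
      "bipoly (\<lambda>x y. cnj (Complex x y) * (Complex x y ^ 0 * cnj (Complex x y) ^ q)) g1 g2"
      "\<And>x y. g1 x y + \<i> * g2 x y = 2 * (Complex x y ^ 0 * cnj (Complex x y) ^ q) + cnj (Complex x y) * (f1 x y + \<i> * f2 x y)"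
      by auto
    then show ?case
      unfolding f(2) using *
      by (intro exI[of _ g1] exI[of _ g2]) (auto simp: distrib_right distrib_left mult.left_commute)
  qed
next
  case (Suc p)
  from Suc obtain f1 f2 where f: "bipoly (\<lambda>x y. Complex x y ^ p * cnj (Complex x y) ^ q) f1 f2"
    "\<And>x y. f1 x y + \<i> * f2 x y = 2 * (of_nat q * (Complex x y ^ p * cnj (Complex x y) ^ (q - 1)))"
    by auto
  from bipoly_Complex_mult[OF f(1)] show ?case
    unfolding f(2) by (simp add: mult.assoc mult.left_commute)
qed

lemma (in prob_space) bipoly_gaussian_IBP:
  assumes xy: "indep_var borel X borel Y" and s: "0 < s"
    and X: "distributed M lborel X (normal_density 0 s)"
    and Y: "distributed M lborel Y (normal_density 0 s)"
    and f: "bipoly f f1 f2"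
  shows "integrable M (\<lambda>w. f (X w) (Y w)) \<and>
    (\<integral>w. (of_real (X w) + \<i> * of_real (Y w)) * f (X w) (Y w) \<partial>M)
      = of_real (s\<^sup>2) * (\<integral>w. f1 (X w) (Y w) + \<i> * f2 (X w) (Y w) \<partial>M)"
proof -
  have intX: "integrable M (\<lambda>w. X w ^ a)" for a
    using integrable_normal_moment[OF s, of 0 a]
    by (subst distributed_integrable[OF X, symmetric]) (auto simp: normal_density_nonneg)
  have intY: "integrable M (\<lambda>w. Y w ^ a)" for a
    using integrable_normal_moment[OF s, of 0 a]
    by (subst distributed_integrable[OF Y, symmetric]) (auto simp: normal_density_nonneg)
  have EX: "expectation (\<lambda>w. X w ^ Suc a) = s\<^sup>2 * real a * expectation (\<lambda>w. X w ^ (a - 1))" for a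
    using normal_moment_IBP[OF s, of a]
    by (subst (asm) (1 2) distributed_integral[OF X]) (simp_all add: normal_density_nonneg)
  have EY: "expectation (\<lambda>w. Y w ^ Suc a) = s\<^sup>2 * real a * expectation (\<lambda>w. Y w ^ (a - 1))" for a
    using normal_moment_IBP[OF s, of a]
    by (subst (asm) (1 2) distributed_integral[OF Y]) (simp_all add: normal_density_nonneg)
  have ind: "indep_var borel (\<lambda>w. X w ^ a) borel (\<lambda>w. Y w ^ b)" for a b
    using indep_var_compose[OF xy, of "\<lambda>x. x ^ a" borel "\<lambda>x. x ^ b" borel] by (simp add: comp_def)
  have int: "integrable M (\<lambda>w. X w ^ a * Y w ^ b)" for a b
    by (rule indep_var_integrable[OF ind intX intY])
  have E: "expectation (\<lambda>w. X w ^ a * Y w ^ b) = expectation (\<lambda>w. X w ^ a) * expectation (\<lambda>w. Y w ^ b)" for a b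
    by (rule indep_var_lebesgue_integral[OF ind intX intY])
  have intc: "integrable M (\<lambda>w. c * of_real (X w ^ a * Y w ^ b) :: complex)" for a b c
    by (intro integrable_mult_right integrable_of_real int)
  have intc2: "integrable M (\<lambda>w. c * of_real (r * X w ^ a * Y w ^ b) :: complex)" for a b c r
    using intc[of "c * of_real r" a b] by (simp add: mult.assoc)
  have intxc: "integrable M (\<lambda>w. of_real (X w) * (c * of_real (X w ^ a * Y w ^ b)) :: complex)" for a b c
    using intc[of c "Suc a" b] by (simp add: ac_simps)
  have intyc: "integrable M (\<lambda>w. of_real (Y w) * (c * of_real (X w ^ a * Y w ^ b)) :: complex)" for a b c
    using intc[of c a "Suc b"] by (simp add: ac_simps)
  have Ec: "(\<integral>w. c * of_real (g w) \<partial>M) = c * of_real (expectation (\<lambda>w. g w))" for c :: complex and g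
    by simp
  from f have "integrable M (\<lambda>w. f (X w) (Y w)) \<and> integrable M (\<lambda>w. f1 (X w) (Y w))
    \<and> integrable M (\<lambda>w. f2 (X w) (Y w)) \<and> integrable M (\<lambda>w. of_real (X w) * f (X w) (Y w))
    \<and> integrable M (\<lambda>w. of_real (Y w) * f (X w) (Y w))
    \<and> (\<integral>w. of_real (X w) * f (X w) (Y w) \<partial>M) = of_real (s\<^sup>2) * (\<integral>w. f1 (X w) (Y w) \<partial>M)
    \<and> (\<integral>w. of_real (Y w) * f (X w) (Y w) \<partial>M) = of_real (s\<^sup>2) * (\<integral>w. f2 (X w) (Y w) \<partial>M)"
  proof (induction rule: bipoly.induct)
    case (mono c a b)
    have "(\<integral>w. of_real (X w) * (c * of_real (X w ^ a * Y w ^ b)) \<partial>M)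
        = c * of_real (expectation (\<lambda>w. X w ^ Suc a * Y w ^ b))"
      by (subst Ec[symmetric]) (simp add: ac_simps)
    also have "\<dots> = of_real (s\<^sup>2) * (c * of_real (expectation (\<lambda>w. real a * (X w ^ (a - 1) * Y w ^ b))))"
      by (simp only: E EX integral_mult_right_zero of_real_mult) (simp only: mult_ac)
    also have "\<dots> = of_real (s\<^sup>2) * (\<integral>w. c * of_real (real a * X w ^ (a - 1) * Y w ^ b) \<partial>M)"
      by (simp only: mult.assoc Ec)
    finally have 1: "(\<integral>w. of_real (X w) * (c * of_real (X w ^ a * Y w ^ b)) \<partial>M) = \<dots>" .
    have "(\<integral>w. of_real (Y w) * (c * of_real (X w ^ a * Y w ^ b)) \<partial>M)
        = c * of_real (expectation (\<lambda>w. X w ^ a * Y w ^ Suc b))"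
      by (subst Ec[symmetric]) (simp add: ac_simps)
    also have "\<dots> = of_real (s\<^sup>2) * (c * of_real (expectation (\<lambda>w. real b * (X w ^ a * Y w ^ (b - 1)))))"
      by (simp only: E EY integral_mult_right_zero of_real_mult) (simp only: mult_ac)
    also have "\<dots> = of_real (s\<^sup>2) * (\<integral>w. c * of_real (real b * X w ^ a * Y w ^ (b - 1)) \<partial>M)"
      by (simp only: mult.assoc Ec)
    finally have 2: "(\<integral>w. of_real (Y w) * (c * of_real (X w ^ a * Y w ^ b)) \<partial>M) = \<dots>" .
    show ?case
      by (intro conjI 1 2 intc intc2 intxc intyc)
  next
    case (add f f1 f2 g g1 g2)
    then show ?case by (simp add: distrib_left integral_add)
  qed
  then show ?thesis
    by (simp add: distrib_right mult.assoc integral_add distrib_left)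
qed

text \<open>Real and imaginary part each have variance \<open>v / 2\<close>, which meets the factor
  2 of \<open>bipoly_Complex_power\<close>, so the constant is \<open>v\<close>. For
  \<open>q = 0\<close> the truncated exponent is multiplied by 0.\<close>

lemma circ_sym_gaussian_power_IBP:
  assumes P: "prob_space P" and Z: "circ_sym_gaussian P v Z" and v: "0 < v"
  shows integrable_circ_sym_gaussian_power: "integrable P (\<lambda>w. Z w ^ p * cnj (Z w) ^ q)"
    and "(\<integral>w. Z w ^ Suc p * cnj (Z w) ^ q \<partial>P)
      = of_real v * of_nat q * (\<integral>w. Z w ^ p * cnj (Z w) ^ (q - 1) \<partial>P)"
proof -
  interpret prob_space P by fact
  from bipoly_Complex_power[of p q] obtain f1 f2 where
    f: "bipoly (\<lambda>x y. Complex x y ^ p * cnj (Complex x y) ^ q) f1 f2"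
    "\<And>x y. f1 x y + \<i> * f2 x y = 2 * (of_nat q * (Complex x y ^ p * cnj (Complex x y) ^ (q - 1)))"
    by auto
  have s: "0 < sqrt (v / 2)" using v by simp
  from Z have Z': "indep_var borel (\<lambda>w. Re (Z w)) borel (\<lambda>w. Im (Z w))"
     "distributed P lborel (\<lambda>w. Re (Z w)) (normal_density 0 (sqrt (v / 2)))"
     "distributed P lborel (\<lambda>w. Im (Z w)) (normal_density 0 (sqrt (v / 2)))"
    by (auto simp: circ_sym_gaussian_def)
  have c: "of_real (Re z) + \<i> * of_real (Im z) = z" for z by (simp add: complex_eq_iff)
  from bipoly_gaussian_IBP[OF Z'(1) s Z'(2,3) f(1)]
  have *: "integrable P (\<lambda>w. Z w ^ p * cnj (Z w) ^ q)"
    "(\<integral>w. Z w * (Z w ^ p * cnj (Z w) ^ q) \<partial>P)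
      = of_real ((sqrt (v / 2))\<^sup>2) * (\<integral>w. 2 * (of_nat q * (Z w ^ p * cnj (Z w) ^ (q - 1))) \<partial>P)"
    unfolding f(2) c by simp_all
  then show "integrable P (\<lambda>w. Z w ^ p * cnj (Z w) ^ q)" by simp
  show "(\<integral>w. Z w ^ Suc p * cnj (Z w) ^ q \<partial>P)
      = of_real v * of_nat q * (\<integral>w. Z w ^ p * cnj (Z w) ^ (q - 1) \<partial>P)"
    using *(2) v by (simp add: mult.assoc)
qed

section \<open>Wirtinger calculus for polynomials in several complex Gaussian variables\<close>

definition cmonom :: "'e set \<Rightarrow> ('e \<Rightarrow> nat) \<Rightarrow> ('e \<Rightarrow> nat) \<Rightarrow> ('e \<Rightarrow> complex) \<Rightarrow> complex" where
  "cmonom I p q z = (\<Prod>i\<in>I. z i ^ p i * cnj (z i) ^ q i)"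

text \<open>\<open>wirtinger I e F F'\<close>: \<open>F\<close> is a polynomial in the variables \<open>z i\<close>, \<open>i \<in> I\<close>, and their
  conjugates, and \<open>F'\<close> is its Wirtinger derivative with respect to \<open>cnj (z e)\<close>.\<close>

inductive wirtinger :: "'e set \<Rightarrow> 'e \<Rightarrow> (('e \<Rightarrow> complex) \<Rightarrow> complex) \<Rightarrow>
    (('e \<Rightarrow> complex) \<Rightarrow> complex) \<Rightarrow> bool" for I e where
  mono: "wirtinger I e (\<lambda>z. c * cmonom I p q z)
    (\<lambda>z. c * (of_nat (q e) * (z e ^ p e * cnj (z e) ^ (q e - 1) * cmonom (I - {e}) p q z)))"
| add: "wirtinger I e F F' \<Longrightarrow> wirtinger I e G G' \<Longrightarrow>
    wirtinger I e (\<lambda>z. F z + G z) (\<lambda>z. F' z + G' z)"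

lemma cmonom_mult: "cmonom I p q z * cmonom I p' q' z = cmonom I (\<lambda>i. p i + p' i) (\<lambda>i. q i + q' i) z"
  unfolding cmonom_def prod.distrib[symmetric] by (rule prod.cong) (auto simp: power_add)

lemma cmonom_split:
  assumes "finite I" "e \<in> I"
  shows "cmonom I p q z = z e ^ p e * cnj (z e) ^ q e * cmonom (I - {e}) p q z"
  unfolding cmonom_def by (rule prod.remove[OF assms])

lemma wirtinger_const: "wirtinger I e (\<lambda>_. c) (\<lambda>_. 0)"
  using wirtinger.mono[of I e c "\<lambda>_. 0" "\<lambda>_. 0"] by (simp add: cmonom_def)

lemma cmonom_delta:
  assumes "finite I" "i \<in> I"
  shows "cmonom I (\<lambda>j. if j = i then 1 else 0) (\<lambda>_. 0) z = z i"
    and "cmonom I (\<lambda>_. 0) (\<lambda>j. if j = i then 1 else 0) z = cnj (z i)"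
  using assms by (auto simp: cmonom_def if_distrib[of "\<lambda>n. _ ^ n"] prod.delta cong: if_cong)

lemma wirtinger_var:
  assumes "finite I" "i \<in> I"
  shows "wirtinger I e (\<lambda>z. z i) (\<lambda>_. 0)"
  using wirtinger.mono[of I e 1 "\<lambda>j. if j = i then 1 else 0" "\<lambda>_. 0"]
  by (simp only: cmonom_delta[OF assms]) simp

lemma wirtinger_cnj:
  assumes "finite I" "i \<in> I"
  shows "wirtinger I e (\<lambda>z. cnj (z i)) (\<lambda>_. if i = e then 1 else 0)"
proof -
  have *: "cmonom (I - {i}) (\<lambda>_. 0) (\<lambda>j. if j = i then 1 else 0) z = 1" for z
    by (simp add: cmonom_def)
  show ?thesis
    using wirtinger.mono[of I e 1 "\<lambda>_. 0" "\<lambda>j. if j = i then 1 else 0"] *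
    by (simp only: cmonom_delta[OF assms]) (auto split: if_splits)
qed

lemma wirtinger_cong:
  "wirtinger I e F F' \<Longrightarrow> (\<And>z. F z = G z) \<Longrightarrow> (\<And>z. F' z = G' z) \<Longrightarrow> wirtinger I e G G'"
  by (metis ext)

lemma wirtinger_mult:
  assumes I: "finite I" "e \<in> I" and F: "wirtinger I e F F'" and G: "wirtinger I e G G'"
  shows "wirtinger I e (\<lambda>z. F z * G z) (\<lambda>z. F' z * G z + F z * G' z)"
  using F
proof (induction rule: wirtinger.induct)
  case (mono c p q)
  show ?case
    using G
  proof (induction rule: wirtinger.induct)
    case (mono c' p' q')
    have d: "of_nat (a + b) * w ^ (a + b - 1) = of_nat a * w ^ (a - 1) * w ^ b + w ^ a * (of_nat b * w ^ (b - 1))"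
      for a b and w :: complex
      by (cases a; cases b) (auto simp: algebra_simps power_add)
    show ?case
    proof (rule wirtinger_cong[OF wirtinger.mono[of I e "c * c'" "\<lambda>i. p i + p' i" "\<lambda>i. q i + q' i"]], goal_cases)
      case (1 z)
      show ?case by (simp add: cmonom_mult[symmetric])
    next
      case (2 z)
      have "c * c' * (of_nat (q e + q' e) * (z e ^ (p e + p' e) * cnj (z e) ^ (q e + q' e - 1) * M))
          = c * c' * z e ^ (p e + p' e) * M * (of_nat (q e + q' e) * cnj (z e) ^ (q e + q' e - 1))" for M
        by (simp add: mult_ac)
      note 1 = this[unfolded d, of "cmonom (I - {e}) p q z * cmonom (I - {e}) p' q' z"]
      show ?case
        unfolding cmonom_mult[symmetric] cmonom_split[OF I] 1
        by (simp add: power_add distrib_left mult_ac)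
    qed
  next
    case (add F F' G G')
    show ?case
      by (rule wirtinger_cong[OF wirtinger.add[OF add.IH]]) (simp_all add: algebra_simps)
  qed
next
  case (add F F' G G')
  show ?case
    by (rule wirtinger_cong[OF wirtinger.add[OF add.IH]]) (simp_all add: algebra_simps)
qed

lemma wirtinger_sum:
  assumes "\<And>x. x \<in> A \<Longrightarrow> wirtinger I e (F x) (F' x)"
  shows "wirtinger I e (\<lambda>z. \<Sum>x\<in>A. F x z) (\<lambda>z. \<Sum>x\<in>A. F' x z)"
  using assms
  by (induction A rule: infinite_finite_induct)
     (auto intro: wirtinger_const wirtinger.add)

lemma indep_circ_sym_gaussian_IBP:
  assumes P: "prob_space P" and I: "finite I" "e \<in> I" and v: "0 < v"
    and ind: "prob_space.indep_vars P (\<lambda>_. borel) Z I"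
    and Z: "\<And>i. i \<in> I \<Longrightarrow> circ_sym_gaussian P v (Z i)"
    and F: "wirtinger I e F F'"
  shows integrable_wirtinger: "integrable P (\<lambda>w. F (\<lambda>i. Z i w))"
    and "integrable P (\<lambda>w. F' (\<lambda>i. Z i w))"
    and gaussian_IBP: "(\<integral>w. Z e w * F (\<lambda>i. Z i w) \<partial>P) = of_real v * (\<integral>w. F' (\<lambda>i. Z i w) \<partial>P)"
proof -
  interpret prob_space P by fact
  have ind': "indep_vars (\<lambda>_. borel) (\<lambda>i w. Z i w ^ p i * cnj (Z i w) ^ q i) I" for p q :: "_ \<Rightarrow> nat"
    using indep_vars_compose2[OF ind, of "\<lambda>i z. z ^ p i * cnj z ^ q i" "\<lambda>_. borel"]
    by (simp add: borel_measurable_continuous_onI continuous_intros)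
  have ip: "integrable P (\<lambda>w. Z i w ^ p * cnj (Z i w) ^ q)" if "i \<in> I" for i p q
    by (rule integrable_circ_sym_gaussian_power[OF P Z[OF that] v])
  have int: "integrable P (\<lambda>w. cmonom I p q (\<lambda>i. Z i w))"
    and E: "(\<integral>w. cmonom I p q (\<lambda>i. Z i w) \<partial>P) = (\<Prod>i\<in>I. \<integral>w. Z i w ^ p i * cnj (Z i w) ^ q i \<partial>P)" for p q
    unfolding cmonom_def
    using indep_vars_integrable[OF I(1) ind' ip, of p q] indep_vars_lebesgue_integral[OF I(1) ind' ip, of p q]
    by auto
  \<comment> \<open>Multiplying by \<open>Z e\<close> raises one exponent, differentiating lowers
    one. By independence expectations of monomials factor, so the identity reduces to the single
    variable \<open>Z e\<close>.\<close>
  have up: "Z e w * cmonom I p q (\<lambda>i. Z i w) = cmonom I (p(e := Suc (p e))) q (\<lambda>i. Z i w)" for p q w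
    unfolding cmonom_split[OF I] by (simp add: cmonom_def)
  have down: "Z e w ^ p e * cnj (Z e w) ^ (q e - 1) * cmonom (I - {e}) p q (\<lambda>i. Z i w)
     = cmonom I p (q(e := q e - 1)) (\<lambda>i. Z i w)" for p q w
    unfolding cmonom_split[OF I] by (simp add: cmonom_def)
  have "integrable P (\<lambda>w. F (\<lambda>i. Z i w)) \<and> integrable P (\<lambda>w. F' (\<lambda>i. Z i w))
    \<and> integrable P (\<lambda>w. Z e w * F (\<lambda>i. Z i w))
    \<and> (\<integral>w. Z e w * F (\<lambda>i. Z i w) \<partial>P) = of_real v * (\<integral>w. F' (\<lambda>i. Z i w) \<partial>P)"
    using F
  proof (induction rule: wirtinger.induct)
    case (mono c p q)
    have "(\<integral>w. cmonom I (p(e := Suc (p e))) q (\<lambda>i. Z i w) \<partial>P)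
        = of_real v * (of_nat (q e) * (\<integral>w. cmonom I p (q(e := q e - 1)) (\<lambda>i. Z i w) \<partial>P))"
      unfolding E prod.remove[OF I] fun_upd_same
        circ_sym_gaussian_power_IBP(2)[OF P Z[OF I(2)] v]
      by (simp add: mult_ac)
    moreover have "Z e w * (c * cmonom I p q (\<lambda>i. Z i w)) = c * cmonom I (p(e := Suc (p e))) q (\<lambda>i. Z i w)" for w
      using up[of w p q] by (simp add: mult.left_commute)
    ultimately show ?case
      using int by (simp only: down) simp
  next
    case (add F F' G G')
    then show ?case by (simp add: distrib_left integral_add)
  qed
  then show "integrable P (\<lambda>w. F (\<lambda>i. Z i w))" "integrable P (\<lambda>w. F' (\<lambda>i. Z i w))"
    "(\<integral>w. Z e w * F (\<lambda>i. Z i w) \<partial>P) = of_real v * (\<integral>w. F' (\<lambda>i. Z i w) \<partial>P)"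
    by auto
qed

subsection \<open>Loop equations for the Wishart moments\<close>

text \<open>Entries of G = H H^* as functions of the entry family \<open>z\<close>, not of a matrix:
  this keeps everything derived from it visibly polynomial in the \<open>z (i, a)\<close> and their
  conjugates, and measurable on the product space.\<close>

definition gram :: "nat \<Rightarrow> (nat \<times> nat \<Rightarrow> complex) \<Rightarrow> nat \<Rightarrow> nat \<Rightarrow> complex" where
  "gram m z x y = (\<Sum>a<m. z (x, a) * cnj (z (y, a)))"

primrec gpow :: "nat \<Rightarrow> nat \<Rightarrow> (nat \<times> nat \<Rightarrow> complex) \<Rightarrow> nat \<Rightarrow> nat \<Rightarrow> nat \<Rightarrow> complex" where
  "gpow n m z 0 = (\<lambda>x y. if x = y then 1 else 0)"
| "gpow n m z (Suc k) = (\<lambda>x y. \<Sum>u<n. gpow n m z k x u * gram m z u y)"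

definition gtr :: "nat \<Rightarrow> nat \<Rightarrow> (nat \<times> nat \<Rightarrow> complex) \<Rightarrow> nat \<Rightarrow> complex" where
  "gtr n m z k = (\<Sum>x<n. gpow n m z k x x)"

text \<open>The entries of G^k H. They arise because differentiating an entry of G removes its
  conjugated factor and leaves a bare entry of H.\<close>

definition gcol :: "nat \<Rightarrow> nat \<Rightarrow> (nat \<times> nat \<Rightarrow> complex) \<Rightarrow> nat \<Rightarrow> nat \<Rightarrow> nat \<Rightarrow> complex" where
  "gcol n m z k x a = (\<Sum>u<n. gpow n m z k x u * z (u, a))"

lemma gpow_add:
  assumes "y < n"
  shows "(\<Sum>u<n. gpow n m z j x u * gpow n m z k u y) = gpow n m z (j + k) x y"
  using assms
proof (induction k arbitrary: y)
  case 0
  then show ?case by (simp add: if_distrib[of "\<lambda>t. _ * t"] sum.delta' cong: if_cong)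
next
  case (Suc k)
  have "(\<Sum>u<n. gpow n m z j x u * gpow n m z (Suc k) u y)
      = (\<Sum>v<n. (\<Sum>u<n. gpow n m z j x u * gpow n m z k u v) * gram m z v y)"
    unfolding gpow.simps sum_distrib_left sum_distrib_right
    by (subst sum.swap) (simp add: mult.assoc)
  also have "\<dots> = gpow n m z (j + Suc k) x y"
    using Suc.IH by simp
  finally show ?case .
qed

lemma gpow_1: "x < n \<Longrightarrow> gpow n m z (Suc 0) x y = gram m z x y"
  by (simp add: if_distrib[of "\<lambda>t. t * _"] sum.delta cong: if_cong)

text \<open>One factor \<open>z (i, a)\<close> is isolated. It is the Gaussian variable of the
  integration by parts, and the bracket is the polynomial to be differentiated.\<close>

lemma gtr_Suc:
  "gtr n m z (Suc k) = (\<Sum>i<n. \<Sum>a<m. z (i, a) * (\<Sum>u<n. cnj (z (u, a)) * gpow n m z k u i))"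
proof -
  have "gtr n m z (Suc k) = (\<Sum>i<n. \<Sum>u<n. gram m z i u * gpow n m z k u i)"
    unfolding gtr_def using gpow_add[of _ n m z "Suc 0" _ k] gpow_1[of _ n m z]
    by (intro sum.cong refl) (metis (no_types, lifting) One_nat_def lessThan_iff plus_1_eq_Suc sum.cong)
  also have "\<dots> = (\<Sum>i<n. \<Sum>a<m. z (i, a) * (\<Sum>u<n. cnj (z (u, a)) * gpow n m z k u i))"
    unfolding gram_def sum_distrib_left sum_distrib_right
    by (rule sum.cong[OF refl], subst sum.swap, simp add: mult.assoc)
  finally show ?thesis .
qed

lemma gtr_Suc_gcol:
  "(\<Sum>a<m. \<Sum>u<n. cnj (z (u, a)) * gcol n m z j u a) = gtr n m z (Suc j)"
proof -
  have "(\<Sum>a<m. \<Sum>u<n. cnj (z (u, a)) * gcol n m z j u a)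
     = (\<Sum>u<n. \<Sum>a<m. \<Sum>v<n. gpow n m z j u v * (z (v, a) * cnj (z (u, a))))"
    unfolding gcol_def sum_distrib_left by (subst sum.swap) (simp add: mult_ac)
  also have "\<dots> = gtr n m z (Suc j)"
    unfolding gtr_def gpow.simps gram_def sum_distrib_left
    by (rule sum.cong[OF refl], rule sum.swap)
  finally show ?thesis .
qed

lemma gpow_gcol:
  "(\<Sum>i<n. gpow n m z k u i * gcol n m z l i a) = gcol n m z (k + l) u a"
proof -
  have "(\<Sum>i<n. gpow n m z k u i * gcol n m z l i a)
      = (\<Sum>v<n. (\<Sum>i<n. gpow n m z k u i * gpow n m z l i v) * z (v, a))"
    unfolding gcol_def sum_distrib_left sum_distrib_right
    by (subst sum.swap) (simp add: mult.assoc)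
  then show ?thesis by (simp add: gpow_add gcol_def)
qed

context
  fixes n m i a :: nat
  assumes ia: "i < n" "a < m"
begin

abbreviation "grid \<equiv> {..<n} \<times> {..<m}"

lemma grid: "finite grid" "(i, a) \<in> grid"
  using ia by auto

lemma wirtinger_gram:
  assumes "x < n" "y < n"
  shows "wirtinger grid (i, a) (\<lambda>z. gram m z x y) (\<lambda>z. if y = i then z (x, a) else 0)"
proof -
  have "wirtinger grid (i, a) (\<lambda>z. \<Sum>b<m. z (x, b) * cnj (z (y, b)))
    (\<lambda>z. \<Sum>b<m. 0 * cnj (z (y, b)) + z (x, b) * (if (y, b) = (i, a) then 1 else 0))"
    using assms grid
    by (intro wirtinger_sum wirtinger_mult wirtinger_var wirtinger_cnj) auto
  then show ?thesis
    by (rule wirtinger_cong)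
       (use ia in \<open>auto simp: gram_def if_distrib[of "\<lambda>t. _ * t"] sum.delta cong: if_cong\<close>)
qed

text \<open>The product rule differentiates one of the \<open>k\<close> factors G at a time. The
  derivative of G has a single nonzero column, number \<open>i\<close>, which is column
  \<open>a\<close> of H; so each term splits into an entry of G^j H and an entry of
  G^(k-1-j).\<close>

lemma wirtinger_gpow:
  assumes "x < n" "y < n"
  shows "wirtinger grid (i, a) (\<lambda>z. gpow n m z k x y)
    (\<lambda>z. \<Sum>j<k. gcol n m z j x a * gpow n m z (k - 1 - j) i y)"
  using assms
proof (induction k arbitrary: y)
  case 0
  then show ?case by (simp add: wirtinger_const)
next
  case (Suc k)
  have "wirtinger grid (i, a) (\<lambda>z. \<Sum>u<n. gpow n m z k x u * gram m z u y)
    (\<lambda>z. \<Sum>u<n. (\<Sum>j<k. gcol n m z j x a * gpow n m z (k - 1 - j) i u) * gram m z u y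
       + gpow n m z k x u * (if y = i then z (u, a) else 0))"
    using Suc grid by (intro wirtinger_sum wirtinger_mult wirtinger_gram) auto
  then show ?case
  proof (rule wirtinger_cong)
    fix z
    have "(\<Sum>u<n. (\<Sum>j<k. gcol n m z j x a * gpow n m z (k - 1 - j) i u) * gram m z u y)
       = (\<Sum>j<k. gcol n m z j x a * gpow n m z (Suc (k - 1 - j)) i y)"
      unfolding sum_distrib_right gpow.simps sum_distrib_left by (subst sum.swap) (simp add: mult.assoc)
    also have "\<dots> = (\<Sum>j<k. gcol n m z j x a * gpow n m z (Suc k - 1 - j) i y)"
      by (intro sum.cong refl) (simp add: Suc_diff_Suc)
    finally show "(\<Sum>u<n. (\<Sum>j<k. gcol n m z j x a * gpow n m z (k - 1 - j) i u) * gram m z u y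
       + gpow n m z k x u * (if y = i then z (u, a) else 0))
       = (\<Sum>j<Suc k. gcol n m z j x a * gpow n m z (Suc k - 1 - j) i y)"
      by (simp add: sum.distrib gcol_def)
  qed simp
qed

lemma wirtinger_gtr:
  "wirtinger grid (i, a) (\<lambda>z. gtr n m z l) (\<lambda>z. of_nat l * gcol n m z (l - 1) i a)"
proof -
  have "wirtinger grid (i, a) (\<lambda>z. \<Sum>x<n. gpow n m z l x x)
     (\<lambda>z. \<Sum>x<n. \<Sum>j<l. gcol n m z j x a * gpow n m z (l - 1 - j) i x)"
    by (intro wirtinger_sum wirtinger_gpow) auto
  then show ?thesis
  proof (rule wirtinger_cong)
    fix z
    have "(\<Sum>x<n. \<Sum>j<l. gcol n m z j x a * gpow n m z (l - 1 - j) i x)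
       = (\<Sum>j<l. \<Sum>x<n. gpow n m z (l - 1 - j) i x * gcol n m z j x a)"
      by (subst sum.swap) (simp add: mult.commute)
    also have "\<dots> = of_nat l * gcol n m z (l - 1) i a"
      by (simp add: gpow_gcol)
    finally show "(\<Sum>x<n. \<Sum>j<l. gcol n m z j x a * gpow n m z (l - 1 - j) i x) = \<dots>" .
  qed (simp add: gtr_def)
qed

lemma wirtinger_cnj_gpow:
  "wirtinger grid (i, a) (\<lambda>z. \<Sum>u<n. cnj (z (u, a)) * gpow n m z k u i)
    (\<lambda>z. gpow n m z k i i + (\<Sum>j<k. (\<Sum>u<n. cnj (z (u, a)) * gcol n m z j u a) * gpow n m z (k - 1 - j) i i))"
proof -
  have "wirtinger grid (i, a) (\<lambda>z. \<Sum>u<n. cnj (z (u, a)) * gpow n m z k u i)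
     (\<lambda>z. \<Sum>u<n. (if (u, a) = (i, a) then 1 else 0) * gpow n m z k u i +
        cnj (z (u, a)) * (\<Sum>j<k. gcol n m z j u a * gpow n m z (k - 1 - j) i i))"
    using grid by (intro wirtinger_sum wirtinger_mult wirtinger_cnj wirtinger_gpow) auto
  then show ?thesis
  proof (rule wirtinger_cong)
    fix z
    have "(\<Sum>u<n. cnj (z (u, a)) * (\<Sum>j<k. gcol n m z j u a * gpow n m z (k - 1 - j) i i))
       = (\<Sum>j<k. (\<Sum>u<n. cnj (z (u, a)) * gcol n m z j u a) * gpow n m z (k - 1 - j) i i)"
      unfolding sum_distrib_left sum_distrib_right by (subst sum.swap) (simp add: mult.assoc)
    then show "(\<Sum>u<n. (if (u, a) = (i, a) then 1 else 0) * gpow n m z k u i +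
        cnj (z (u, a)) * (\<Sum>j<k. gcol n m z j u a * gpow n m z (k - 1 - j) i i)) =
        gpow n m z k i i + (\<Sum>j<k. (\<Sum>u<n. cnj (z (u, a)) * gcol n m z j u a) * gpow n m z (k - 1 - j) i i)"
      using ia by (simp add: sum.distrib if_distrib[of "\<lambda>t. t * _"] sum.delta cong: if_cong)
  qed simp
qed

end

section \<open>The limit recursion and products of centred traces\<close>

fun mp_moment :: "real \<Rightarrow> nat \<Rightarrow> real" where
  "mp_moment c 0 = 1"
| "mp_moment c (Suc k) = mp_moment c k + c * (\<Sum>j<k. mp_moment c (Suc j) * mp_moment c (k - 1 - j))"

declare mp_moment.simps(2) [simp del]

text \<open>The centring uses the exact ratio \<open>n / m\<close>, not its limit, so the constant
  terms of the loop equation cancel identically at every size. Continuity of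
  \<open>mp_moment\<close> in the ratio is invoked only at the end.\<close>

definition tdev :: "nat \<Rightarrow> nat \<Rightarrow> nat \<Rightarrow> (nat \<times> nat \<Rightarrow> complex) \<Rightarrow> complex" where
  "tdev n m k z = gtr n m z k / of_nat n - of_real (mp_moment (real n / real m) k)"

definition tdevs :: "nat \<Rightarrow> nat \<Rightarrow> nat list \<Rightarrow> (nat \<times> nat \<Rightarrow> complex) \<Rightarrow> complex" where
  "tdevs n m ls z = (\<Prod>l\<leftarrow>ls. tdev n m l z)"

definition drop_nth :: "nat \<Rightarrow> 'a list \<Rightarrow> 'a list" where
  "drop_nth r ls = take r ls @ drop (Suc r) ls"

lemma tdevs_simps [simp]: "tdevs n m [] z = 1" "tdevs n m (l # ls) z = tdev n m l z * tdevs n m ls z"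
  by (simp_all add: tdevs_def)

lemma wirtinger_tdev:
  assumes "i < n" "a < m"
  shows "wirtinger ({..<n} \<times> {..<m}) (i, a) (tdev n m l) (\<lambda>z. of_nat l / of_nat n * gcol n m z (l - 1) i a)"
proof -
  have "wirtinger ({..<n} \<times> {..<m}) (i, a) (\<lambda>z. gtr n m z l * (1 / of_nat n) + - of_real (mp_moment (real n / real m) l))
    (\<lambda>z. (of_nat l * gcol n m z (l - 1) i a * (1 / of_nat n) + gtr n m z l * 0) + 0)"
    using assms by (intro wirtinger.add wirtinger_mult wirtinger_const wirtinger_gtr) auto
  then show ?thesis
    by (rule wirtinger_cong) (auto simp: tdev_def)
qed

lemma wirtinger_tdevs:
  assumes "i < n" "a < m"
  shows "wirtinger ({..<n} \<times> {..<m}) (i, a) (tdevs n m ls)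
    (\<lambda>z. \<Sum>r<length ls. of_nat (ls ! r) / of_nat n * gcol n m z (ls ! r - 1) i a * tdevs n m (drop_nth r ls) z)"
proof (induction ls)
  case Nil
  show ?case by (rule wirtinger_cong[OF wirtinger_const[of _ _ 1]]) auto
next
  case (Cons l ls)
  have "finite ({..<n} \<times> {..<m})" "(i, a) \<in> {..<n} \<times> {..<m}"
    using assms by auto
  from wirtinger_mult[OF this wirtinger_tdev[OF assms] Cons.IH, of l]
  show ?case
    by (rule wirtinger_cong)
       (simp_all add: sum.lessThan_Suc_shift drop_nth_def sum_distrib_left mult_ac del: sum.lessThan_Suc)
qed

text \<open>Summing over all positions closes the open indices into traces: differentiating the
  explicit conjugate entry gives \<open>m\<close> copies of one trace, differentiating inside G^k
  splits a trace in two, and differentiating an external deviation merges two traces into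
  one.\<close>

lemma sum_wirtinger_trace:
  fixes T :: complex and D :: "nat \<Rightarrow> complex"
  shows "(\<Sum>i<n. \<Sum>a<m.
      (gpow n m z k i i + (\<Sum>j<k. (\<Sum>u<n. cnj (z (u, a)) * gcol n m z j u a) * gpow n m z (k - 1 - j) i i)) * T
      + (\<Sum>u<n. cnj (z (u, a)) * gpow n m z k u i) *
        (\<Sum>r<R. of_nat (l r) / of_nat n * gcol n m z (l r - 1) i a * D r))
    = (of_nat m * gtr n m z k + (\<Sum>j<k. gtr n m z (Suc j) * gtr n m z (k - 1 - j))) * T
      + (\<Sum>r<R. of_nat (l r) / of_nat n * gtr n m z (k + l r) * D r)"
proof -
  have 1: "(\<Sum>i<n. \<Sum>a<m. gpow n m z k i i) = of_nat m * gtr n m z k"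
    by (simp add: gtr_def sum_distrib_left)
  have 2: "(\<Sum>i<n. \<Sum>a<m. \<Sum>j<k. (\<Sum>u<n. cnj (z (u, a)) * gcol n m z j u a) * gpow n m z (k - 1 - j) i i)
      = (\<Sum>j<k. gtr n m z (Suc j) * gtr n m z (k - 1 - j))"
  proof -
    have "(\<Sum>i<n. \<Sum>a<m. \<Sum>j<k. (\<Sum>u<n. cnj (z (u, a)) * gcol n m z j u a) * gpow n m z (k - 1 - j) i i)
        = (\<Sum>i<n. \<Sum>j<k. gtr n m z (Suc j) * gpow n m z (k - 1 - j) i i)"
      by (rule sum.cong[OF refl], subst sum.swap)
         (simp only: sum_distrib_right[symmetric] gtr_Suc_gcol)
    also have "\<dots> = (\<Sum>j<k. gtr n m z (Suc j) * gtr n m z (k - 1 - j))"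
      by (subst sum.swap) (simp only: gtr_def sum_distrib_left)
    finally show ?thesis .
  qed
  have 3: "(\<Sum>i<n. \<Sum>a<m. (\<Sum>u<n. cnj (z (u, a)) * gpow n m z k u i) * gcol n m z q i a)
      = gtr n m z (Suc (k + q))" for q
  proof -
    have "(\<Sum>i<n. \<Sum>a<m. (\<Sum>u<n. cnj (z (u, a)) * gpow n m z k u i) * gcol n m z q i a)
        = (\<Sum>a<m. \<Sum>i<n. \<Sum>u<n. cnj (z (u, a)) * (gpow n m z k u i * gcol n m z q i a))"
      by (subst sum.swap) (simp add: sum_distrib_right mult.assoc)
    also have "\<dots> = (\<Sum>a<m. \<Sum>u<n. cnj (z (u, a)) * gcol n m z (k + q) u a)"
      by (rule sum.cong[OF refl], subst sum.swap)
         (simp only: sum_distrib_left[symmetric] gpow_gcol)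
    finally show ?thesis by (simp only: gtr_Suc_gcol)
  qed
  have 4: "(\<Sum>i<n. \<Sum>a<m. (\<Sum>u<n. cnj (z (u, a)) * gpow n m z k u i) *
        (\<Sum>r<R. of_nat (l r) / of_nat n * gcol n m z (l r - 1) i a * D r))
      = (\<Sum>r<R. of_nat (l r) / of_nat n * gtr n m z (k + l r) * D r)"
  proof -
    have "(\<Sum>i<n. \<Sum>a<m. (\<Sum>u<n. cnj (z (u, a)) * gpow n m z k u i) *
        (\<Sum>r<R. of_nat (l r) / of_nat n * gcol n m z (l r - 1) i a * D r))
      = (\<Sum>i<n. \<Sum>r<R. \<Sum>a<m. of_nat (l r) / of_nat n * D r *
          ((\<Sum>u<n. cnj (z (u, a)) * gpow n m z k u i) * gcol n m z (l r - 1) i a))"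
      by (rule sum.cong[OF refl], subst sum.swap, simp only: sum_distrib_left)
         (intro sum.cong refl, simp add: mult_ac)
    also have "\<dots> = (\<Sum>r<R. of_nat (l r) / of_nat n * D r * gtr n m z (Suc (k + (l r - 1))))"
      by (subst sum.swap) (simp only: sum_distrib_left[symmetric] 3)
    also have "\<dots> = (\<Sum>r<R. of_nat (l r) / of_nat n * gtr n m z (k + l r) * D r)"
    proof (rule sum.cong[OF refl])
      fix r
      \<comment> \<open>For \<open>l r = 0\<close> the truncated index is off by one, but both sides
        carry the factor \<open>l r\<close>.\<close>
      show "of_nat (l r) / of_nat n * D r * gtr n m z (Suc (k + (l r - 1)))
          = of_nat (l r) / of_nat n * gtr n m z (k + l r) * D r"
        by (cases "l r") simp_all
    qed
    finally show ?thesis .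
  qed
  show ?thesis
    unfolding sum.distrib distrib_right 4 1[symmetric] 2[symmetric]
    by (simp only: sum_distrib_right)
qed

section \<open>Expectations of products of centred traces\<close>

locale wishart =
  fixes P :: "'w measure" and n m :: nat and Z :: "nat \<times> nat \<Rightarrow> 'w \<Rightarrow> complex"
  assumes prob: "prob_space P" and n: "0 < n" and m: "0 < m"
    and ind: "prob_space.indep_vars P (\<lambda>_. borel) Z ({..<n} \<times> {..<m})"
    and gauss: "\<And>i. i \<in> {..<n} \<times> {..<m} \<Longrightarrow> circ_sym_gaussian P (1 / real m) (Z i)"
begin

abbreviation X :: "'w \<Rightarrow> nat \<times> nat \<Rightarrow> complex" where
  "X w \<equiv> \<lambda>i. Z i w"

definition edev :: "nat list \<Rightarrow> complex" where
  "edev ls = (\<integral>w. tdevs n m ls (X w) \<partial>P)"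

lemma integrable_tdevs: "integrable P (\<lambda>w. tdevs n m ls (X w))"
proof -
  have *: "finite ({..<n} \<times> {..<m})" "(0, 0) \<in> {..<n} \<times> {..<m}" "0 < 1 / real m"
    using n m by auto
  show ?thesis
    by (rule integrable_wirtinger[OF prob *(1,2,3) ind gauss wirtinger_tdevs]) (use n m in auto)
qed

lemma edev_Suc_gtr:
  "(\<integral>w. gtr n m (X w) (Suc k) * tdevs n m ls (X w) \<partial>P)
   = of_real (1 / real m) * (\<integral>w.
      (of_nat m * gtr n m (X w) k
        + (\<Sum>j<k. gtr n m (X w) (Suc j) * gtr n m (X w) (k - 1 - j))) * tdevs n m ls (X w)
      + (\<Sum>r<length ls. of_nat (ls ! r) / of_nat n * gtr n m (X w) (k + ls ! r)
           * tdevs n m (drop_nth r ls) (X w)) \<partial>P)"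
proof -
  let ?I = "{..<n} \<times> {..<m}"
  define F where "F = (\<lambda>i a z. (\<Sum>u<n. cnj (z (u, a)) * gpow n m z k u i) * tdevs n m ls z)"
  define F' where "F' = (\<lambda>i a z.
      (gpow n m z k i i + (\<Sum>j<k. (\<Sum>u<n. cnj (z (u, a)) * gcol n m z j u a) * gpow n m z (k - 1 - j) i i)) * tdevs n m ls z
      + (\<Sum>u<n. cnj (z (u, a)) * gpow n m z k u i) *
        (\<Sum>r<length ls. of_nat (ls ! r) / of_nat n * gcol n m z (ls ! r - 1) i a * tdevs n m (drop_nth r ls) z))"
  have v: "0 < 1 / real m" using m by simp
  have F: "wirtinger ?I (i, a) (F i a) (F' i a)" if "i < n" "a < m" for i a
    unfolding F_def F'_def using that
    by (intro wirtinger_mult wirtinger_cnj_gpow wirtinger_tdevs) auto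
  have IBP: "(\<integral>w. Z (i, a) w * F i a (X w) \<partial>P) = of_real (1 / real m) * (\<integral>w. F' i a (X w) \<partial>P)"
    and int': "integrable P (\<lambda>w. F' i a (X w))" if "i < n" "a < m" for i a
    using indep_circ_sym_gaussian_IBP[OF prob _ _ v ind gauss F[OF that]] that by auto
  have int: "integrable P (\<lambda>w. Z (i, a) w * F i a (X w))" if "i < n" "a < m" for i a
  proof -
    have "wirtinger ?I (i, a) (\<lambda>z. z (i, a) * F i a z) (\<lambda>z. 0 * F i a z + z (i, a) * F' i a z)"
      using that by (intro wirtinger_mult wirtinger_var F) auto
    from integrable_wirtinger[OF prob _ _ v ind gauss this] that show ?thesis by auto
  qed
  have ds: "(\<integral>w. (\<Sum>i<n. \<Sum>a<m. f i a w) \<partial>P) = (\<Sum>i<n. \<Sum>a<m. (\<integral>w. f i a w \<partial>P))"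
    if "\<And>i a. i < n \<Longrightarrow> a < m \<Longrightarrow> integrable P (f i a)" for f :: "nat \<Rightarrow> nat \<Rightarrow> 'w \<Rightarrow> complex"
  proof -
    have "(\<integral>w. (\<Sum>i<n. \<Sum>a<m. f i a w) \<partial>P) = (\<Sum>i<n. (\<integral>w. (\<Sum>a<m. f i a w) \<partial>P))"
      by (rule Bochner_Integration.integral_sum, rule Bochner_Integration.integrable_sum) (simp add: that)
    also have "\<dots> = (\<Sum>i<n. \<Sum>a<m. (\<integral>w. f i a w \<partial>P))"
      by (rule sum.cong[OF refl], rule Bochner_Integration.integral_sum) (simp add: that)
    finally show ?thesis .
  qed
  have "(\<integral>w. gtr n m (X w) (Suc k) * tdevs n m ls (X w) \<partial>P)
      = (\<integral>w. (\<Sum>i<n. \<Sum>a<m. Z (i, a) w * F i a (X w)) \<partial>P)"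
    unfolding gtr_Suc F_def sum_distrib_right mult.assoc ..
  also have "\<dots> = (\<Sum>i<n. \<Sum>a<m. of_real (1 / real m) * (\<integral>w. F' i a (X w) \<partial>P))"
    by (subst ds[of "\<lambda>i a w. Z (i, a) w * F i a (X w)", OF int], assumption, assumption)
       (rule sum.cong[OF refl], rule sum.cong[OF refl], rule IBP, auto)
  also have "\<dots> = of_real (1 / real m) * (\<integral>w. (\<Sum>i<n. \<Sum>a<m. F' i a (X w)) \<partial>P)"
    by (subst ds[of "\<lambda>i a w. F' i a (X w)", OF int'], assumption, assumption)
       (simp only: sum_distrib_left)
  finally have "(\<integral>w. gtr n m (X w) (Suc k) * tdevs n m ls (X w) \<partial>P)
      = of_real (1 / real m) * (\<integral>w. (\<Sum>i<n. \<Sum>a<m. F' i a (X w)) \<partial>P)" .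
  moreover have "(\<Sum>i<n. \<Sum>a<m. F' i a z) = (of_nat m * gtr n m z k
        + (\<Sum>j<k. gtr n m z (Suc j) * gtr n m z (k - 1 - j))) * tdevs n m ls z
      + (\<Sum>r<length ls. of_nat (ls ! r) / of_nat n * gtr n m z (k + ls ! r) * tdevs n m (drop_nth r ls) z)" for z
    unfolding F'_def by (rule sum_wirtinger_trace)
  ultimately show ?thesis by simp
qed

text \<open>Each trace is written as \<open>n\<close> times deviation plus constant. The terms in
  which all differentiated traces contribute only their constants are exactly the recursion of
  \<open>mp_moment\<close> and cancel, except in the merger terms, which carry the small factor
  \<open>1 / (n m)\<close>.\<close>

lemma edev_Suc:
  defines "\<mu> \<equiv> mp_moment (real n / real m)"
  shows "edev (Suc k # ls) = edev (k # ls)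
    + of_real (real n / real m) * (\<Sum>j<k. of_real (\<mu> (Suc j)) * edev ((k - 1 - j) # ls)
        + of_real (\<mu> (k - 1 - j)) * edev (Suc j # ls) + edev (Suc j # (k - 1 - j) # ls))
    + of_real (1 / (real n * real m)) * (\<Sum>r<length ls. of_nat (ls ! r) *
        (of_real (\<mu> (k + ls ! r)) * edev (drop_nth r ls) + edev ((k + ls ! r) # drop_nth r ls)))"
proof -
  let ?c = "complex_of_real (real n / real m)"
  let ?N = "complex_of_nat n" and ?M = "complex_of_nat m"
  have g: "gtr n m z k = ?N * (tdev n m k z + of_real (\<mu> k))" for z k
    using n by (simp add: tdev_def \<mu>_def)
  have L: "(\<integral>w. gtr n m (X w) k * tdevs n m ls (X w) \<partial>P)
      = ?N * (edev (k # ls) + of_real (\<mu> k) * edev ls)"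
    and Li: "integrable P (\<lambda>w. gtr n m (X w) k * tdevs n m ls (X w))" for k ls
  proof -
    have *: "gtr n m z k * tdevs n m ls z = ?N * (tdevs n m (k # ls) z + of_real (\<mu> k) * tdevs n m ls z)" for z
      unfolding g by (simp add: algebra_simps)
    show "(\<integral>w. gtr n m (X w) k * tdevs n m ls (X w) \<partial>P)
      = ?N * (edev (k # ls) + of_real (\<mu> k) * edev ls)"
      unfolding * edev_def using integrable_tdevs by (simp only: integral_mult_right_zero Bochner_Integration.integral_add Bochner_Integration.integrable_add integrable_mult_right)
    show "integrable P (\<lambda>w. gtr n m (X w) k * tdevs n m ls (X w))"
      unfolding * by (intro integrable_mult_right Bochner_Integration.integrable_add integrable_tdevs)
  qed
  have Q: "(\<integral>w. gtr n m (X w) j * gtr n m (X w) k * tdevs n m ls (X w) \<partial>P)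
      = ?N\<^sup>2 * (edev (j # k # ls) + of_real (\<mu> j) * edev (k # ls) + of_real (\<mu> k) * edev (j # ls) + of_real (\<mu> j * \<mu> k) * edev ls)"
    and Qi: "integrable P (\<lambda>w. gtr n m (X w) j * gtr n m (X w) k * tdevs n m ls (X w))" for j k ls
  proof -
    have *: "gtr n m z j * gtr n m z k * tdevs n m ls z =
      ?N\<^sup>2 * (tdevs n m (j # k # ls) z + of_real (\<mu> j) * tdevs n m (k # ls) z + of_real (\<mu> k) * tdevs n m (j # ls) z
        + of_real (\<mu> j * \<mu> k) * tdevs n m ls z)" for z
      unfolding g by (simp add: algebra_simps power2_eq_square)
    show "(\<integral>w. gtr n m (X w) j * gtr n m (X w) k * tdevs n m ls (X w) \<partial>P)
      = ?N\<^sup>2 * (edev (j # k # ls) + of_real (\<mu> j) * edev (k # ls) + of_real (\<mu> k) * edev (j # ls) + of_real (\<mu> j * \<mu> k) * edev ls)"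
      unfolding * edev_def using integrable_tdevs by (simp only: integral_mult_right_zero Bochner_Integration.integral_add Bochner_Integration.integrable_add integrable_mult_right)
    show "integrable P (\<lambda>w. gtr n m (X w) j * gtr n m (X w) k * tdevs n m ls (X w))"
      unfolding * by (intro integrable_mult_right Bochner_Integration.integrable_add integrable_tdevs)
  qed
  have "?N * (edev (Suc k # ls) + of_real (\<mu> (Suc k)) * edev ls) =
    of_real (1 / real m) * (?M * (?N * (edev (k # ls) + of_real (\<mu> k) * edev ls))
    + (\<Sum>j<k. ?N\<^sup>2 * (edev (Suc j # (k - 1 - j) # ls) + of_real (\<mu> (Suc j)) * edev ((k - 1 - j) # ls)
         + of_real (\<mu> (k - 1 - j)) * edev (Suc j # ls) + of_real (\<mu> (Suc j) * \<mu> (k - 1 - j)) * edev ls))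
    + (\<Sum>r<length ls. of_nat (ls ! r) / ?N * (?N * (edev ((k + ls ! r) # drop_nth r ls) + of_real (\<mu> (k + ls ! r)) * edev (drop_nth r ls)))))"
    (is "?lhs = of_real _ * (?A + ?B + ?C)")
  proof -
    let ?g = "\<lambda>k w. gtr n m (X w) k" and ?T = "\<lambda>ls w. tdevs n m ls (X w)"
    let ?RA = "\<lambda>w. ?M * (?g k w * ?T ls w)"
    let ?RB = "\<lambda>w. \<Sum>j<k. ?g (Suc j) w * ?g (k - 1 - j) w * ?T ls w"
    let ?RC = "\<lambda>w. \<Sum>r<length ls. of_nat (ls ! r) / ?N * (?g (k + ls ! r) w * ?T (drop_nth r ls) w)"
    have A: "integrable P ?RA" "integral\<^sup>L P ?RA = ?A"
      by (intro integrable_mult_right Li) (simp only: integral_mult_right_zero L)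
    have B: "integrable P ?RB" "integral\<^sup>L P ?RB = ?B"
      by (intro Bochner_Integration.integrable_sum Qi)
         (simp only: Bochner_Integration.integral_sum Qi Q)
    have C: "integrable P ?RC" "integral\<^sup>L P ?RC = ?C"
      by (intro Bochner_Integration.integrable_sum integrable_mult_right Li)
         (simp only: Bochner_Integration.integral_sum integrable_mult_right Li integral_mult_right_zero L)
    have "?lhs = (\<integral>w. ?g (Suc k) w * ?T ls w \<partial>P)" by (simp only: L)
    also have "\<dots> = of_real (1 / real m) * (\<integral>w. ?RA w + ?RB w + ?RC w \<partial>P)"
      unfolding edev_Suc_gtr distrib_right mult.assoc sum_distrib_right ..
    also have "(\<integral>w. ?RA w + ?RB w + ?RC w \<partial>P) = ?A + ?B + ?C"
      by (simp only: Bochner_Integration.integral_add Bochner_Integration.integrable_add A B C)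
    finally show ?thesis .
  qed
  also have "?B = ?N\<^sup>2 * ((\<Sum>j<k. of_real (\<mu> (Suc j)) * edev ((k - 1 - j) # ls)
        + of_real (\<mu> (k - 1 - j)) * edev (Suc j # ls) + edev (Suc j # (k - 1 - j) # ls))
      + (\<Sum>j<k. complex_of_real (\<mu> (Suc j) * \<mu> (k - 1 - j))) * edev ls)"
    (is "_ = _ * (?X + ?Y * _)")
    unfolding sum_distrib_right sum.distrib[symmetric] sum_distrib_left
    by (intro sum.cong refl) (simp add: algebra_simps)
  also have "?C = (\<Sum>r<length ls. of_nat (ls ! r) *
        (of_real (\<mu> (k + ls ! r)) * edev (drop_nth r ls) + edev ((k + ls ! r) # drop_nth r ls)))"
    (is "_ = ?W")
    using n by (intro sum.cong refl) (simp add: algebra_simps)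
  finally have 1: "?N * (edev (Suc k # ls) + of_real (\<mu> (Suc k)) * edev ls) =
    of_real (1 / real m) * (?A + ?N\<^sup>2 * (?X + ?Y * edev ls) + ?W)" .
  have 2: "of_real (\<mu> (Suc k)) = of_real (\<mu> k) + ?c * ?Y"
    unfolding \<mu>_def by (subst mp_moment.simps(2)) simp
  have alg: "eS = ek + N / M * X + 1 / (N * M) * W"
    if "N * (eS + (\<mu>k + N / M * Y) * eL) = 1 / M * (M * (N * (ek + \<mu>k * eL)) + N\<^sup>2 * (X + Y * eL) + W)"
      "N \<noteq> 0" "M \<noteq> 0" for N M eS ek eL X Y W \<mu>k :: complex
  proof -
    have "N * M * eS = N * M * ek + N\<^sup>2 * X + W"
      using that by (simp add: field_simps power2_eq_square)
    then show ?thesis using that(2,3) by (simp add: field_simps power2_eq_square)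
  qed
  show ?thesis
    using alg[OF 1[unfolded 2, unfolded of_real_divide of_real_of_nat_eq of_real_1]] n m
    by (simp only: of_real_divide of_real_of_nat_eq of_real_1 of_real_mult) simp
qed

end

text \<open>A product of \<open>s\<close> deviations has expectation \<open>O(n\<^sup>-\<^sup>s)\<close>: every term on the right-hand side
  of the loop equation has smaller total degree, and the only terms with fewer factors
  lose two of them and carry the factor \<open>1 / (n m)\<close>.\<close>

lemma edev_bigo:
  fixes P :: "'w measure" and N M :: "'t \<Rightarrow> nat" and Z :: "'t \<Rightarrow> nat \<times> nat \<Rightarrow> 'w \<Rightarrow> complex"
  defines "e \<equiv> \<lambda>t. 1 / complex_of_nat (N t)"
  assumes W: "\<And>t. t \<in> T \<Longrightarrow> wishart P (N t) (M t) (Z t)"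
    and C: "\<And>t. t \<in> T \<Longrightarrow> real (N t) \<le> C * real (M t)"
  shows "(\<lambda>t. wishart.edev P (N t) (M t) (Z t) ls) \<in> O[principal T](\<lambda>t. e t ^ length ls)"
proof -
  have N: "0 < N t" "0 < M t" if "t \<in> T" for t
    using W[OF that] by (auto simp: wishart_def)
  have cC: "real (N t) / real (M t) \<le> C" if "t \<in> T" for t
    using C[OF that] N[OF that] by (simp add: field_simps)
  have e1: "norm (e t) \<le> 1" if "t \<in> T" for t
    using N[OF that] by (auto simp: e_def norm_divide)
  \<comment> \<open>Along the filter \<open>principal T\<close> the O-notation is a bound uniform
    over all of \<open>T\<close>, which is what the later summation over sizes requires.\<close>
  have weak: "f \<in> O[principal T](\<lambda>t. e t ^ s)" if "f \<in> O[principal T](\<lambda>t. e t ^ s')" "s \<le> s'" for f s s'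
    using that(1)
  proof (rule landau_o.big_trans)
    show "(\<lambda>t. e t ^ s') \<in> O[principal T](\<lambda>t. e t ^ s)"
      by (rule landau_o.bigI[of 1])
         (use that(2) e1 in \<open>auto simp: eventually_principal norm_power intro!: power_decreasing\<close>)
  qed
  have mult: "(\<lambda>t. f t * g t) \<in> O[principal T](\<lambda>t. e t ^ s)"
    if "f \<in> O[principal T](\<lambda>t. e t ^ a)" "g \<in> O[principal T](\<lambda>t. e t ^ b)" "s \<le> a + b" for f g a b s
  proof -
    have "(\<lambda>t. f t * g t) \<in> O[principal T](\<lambda>t. e t ^ (a + b))"
      unfolding power_add by (rule landau_o.big.mult[OF that(1,2)])
    then show ?thesis by (rule weak) (rule that(3))
  qed
  have bounded: "f \<in> O[principal T](\<lambda>t. e t ^ 0)" if "\<And>t. t \<in> T \<Longrightarrow> norm (f t) \<le> K" for f :: "'t \<Rightarrow> complex" and K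
    by (rule landau_o.bigI[of "max 1 K"]) (use that in \<open>auto simp: eventually_principal le_max_iff_disj\<close>)
  \<comment> \<open>The recursion has nonnegative coefficients, so its value at the largest ratio
    \<open>C\<close> bounds the centring constants uniformly.\<close>
  have mono: "0 \<le> mp_moment c j \<and> mp_moment c j \<le> mp_moment C j" if "0 \<le> c" "c \<le> C" for c j
    using that
  proof (induction j rule: less_induct)
    case (less j)
    show ?case
    proof (cases j)
      case (Suc k)
      have "0 \<le> mp_moment c k" "mp_moment c k \<le> mp_moment C k" using less Suc by auto
      moreover have "0 \<le> (\<Sum>j<k. mp_moment c (Suc j) * mp_moment c (k - 1 - j))"
        by (intro sum_nonneg mult_nonneg_nonneg) (use less Suc in auto)
      moreover have "(\<Sum>j<k. mp_moment c (Suc j) * mp_moment c (k - 1 - j))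
          \<le> (\<Sum>j<k. mp_moment C (Suc j) * mp_moment C (k - 1 - j))"
        using less.IH less.prems Suc
        by (intro sum_mono mult_mono) (auto intro: order_trans)
      ultimately show ?thesis
        unfolding Suc mp_moment.simps(2)[of c k] mp_moment.simps(2)[of C k] using less.prems
        by (intro conjI add_mono mult_mono add_nonneg_nonneg mult_nonneg_nonneg) auto
    qed simp
  qed
  have \<mu>: "(\<lambda>t. complex_of_real (mp_moment (real (N t) / real (M t)) j)) \<in> O[principal T](\<lambda>t. e t ^ 0)" for j
    by (rule bounded[of _ "mp_moment C j"]) (use mono cC in auto)
  have c: "(\<lambda>t. complex_of_real (real (N t) / real (M t))) \<in> O[principal T](\<lambda>t. e t ^ 0)"
    by (rule bounded[of _ C]) (use cC in \<open>auto simp: norm_divide\<close>)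
  \<comment> \<open>These two orders pay for the two factors lost when a deviation is
    dropped.\<close>
  have c2: "(\<lambda>t. complex_of_real (1 / (real (N t) * real (M t)))) \<in> O[principal T](\<lambda>t. e t ^ 2)"
  proof (rule landau_o.bigI[of "max 1 C"])
    have "1 / (real (N t) * real (M t)) \<le> max 1 C * (1 / real (N t) ^ 2)" if "t \<in> T" for t
    proof -
      have "1 / (real (N t) * real (M t)) = (real (N t) / real (M t)) * (1 / real (N t) ^ 2)"
        using N[OF that] by (simp add: field_simps power2_eq_square)
      also have "\<dots> \<le> max 1 C * (1 / real (N t) ^ 2)"
        using cC[OF that] by (intro mult_right_mono) auto
      finally show ?thesis .
    qed
    then show "\<forall>\<^sub>F t in principal T. norm (complex_of_real (1 / (real (N t) * real (M t)))) \<le> max 1 C * norm ((e t)\<^sup>2)"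
      by (auto simp: eventually_principal e_def norm_power norm_divide norm_mult power_divide)
  qed auto
  show ?thesis
  proof (induction "sum_list ls" arbitrary: ls rule: less_induct)
    case less
    note IH = less
    show ?case
    proof (cases ls)
      case Nil
      then show ?thesis
        by (intro landau_o.bigI[of 1])
           (use W in \<open>auto simp: eventually_principal wishart.edev_def[OF W] prob_space.prob_space wishart_def\<close>)
    next
      case (Cons k' ls')
      show ?thesis
      proof (cases k')
        case 0
        \<comment> \<open>The trace of G^0 is exactly \<open>N t\<close>, so its deviation is
          identically 0.\<close>
        have "wishart.edev P (N t) (M t) (Z t) ls = 0" if "t \<in> T" for t
          using N[OF that] by (simp add: wishart.edev_def[OF W[OF that]] Cons 0 tdev_def gtr_def)
        then show ?thesis by (intro landau_o.bigI[of 1]) (auto simp: eventually_principal)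
      next
        case (Suc k)
        define edev where "edev = (\<lambda>ls t. wishart.edev P (N t) (M t) (Z t) ls)"
        define \<mu> where "\<mu> = (\<lambda>j t. complex_of_real (mp_moment (real (N t) / real (M t)) j))"
        define c where "c = (\<lambda>t. complex_of_real (real (N t) / real (M t)))"
        define c' where "c' = (\<lambda>t. complex_of_real (1 / (real (N t) * real (M t))))"
        have IH: "edev ks \<in> O[principal T](\<lambda>t. e t ^ s)" if "sum_list ks \<le> k + sum_list ls'" "s \<le> length ks" for ks s
          unfolding edev_def using that Cons Suc by (intro weak[OF IH that(2)]) auto
        let ?n = "length ls'"
        have eq: "edev ls t = edev (k # ls') t
          + c t * (\<Sum>j<k. \<mu> (Suc j) t * edev ((k - 1 - j) # ls') t
              + \<mu> (k - 1 - j) t * edev (Suc j # ls') t + edev (Suc j # (k - 1 - j) # ls') t)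
          + c' t * (\<Sum>r<?n. of_nat (ls' ! r) *
              (\<mu> (k + ls' ! r) t * edev (drop_nth r ls') t + edev ((k + ls' ! r) # drop_nth r ls') t))"
          if "t \<in> T" for t
          unfolding edev_def \<mu>_def c_def c'_def Cons Suc by (rule wishart.edev_Suc[OF W[OF that]])
        have dl: "length (drop_nth r ls') = ?n - 1" if "r < ?n" for r
          using that by (simp add: drop_nth_def)
        have ds: "ls' ! r + sum_list (drop_nth r ls') = sum_list ls'" if "r < ?n" for r
        proof -
          have "sum_list (take r ls' @ ls' ! r # drop (Suc r) ls') = sum_list ls'"
            using id_take_nth_drop[OF that] by simp
          then show ?thesis by (simp add: drop_nth_def)
        qed
        have "(\<lambda>t. edev (k # ls') t
          + c t * (\<Sum>j<k. \<mu> (Suc j) t * edev ((k - 1 - j) # ls') t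
              + \<mu> (k - 1 - j) t * edev (Suc j # ls') t + edev (Suc j # (k - 1 - j) # ls') t)
          + c' t * (\<Sum>r<?n. of_nat (ls' ! r) *
              (\<mu> (k + ls' ! r) t * edev (drop_nth r ls') t + edev ((k + ls' ! r) # drop_nth r ls') t)))
          \<in> O[principal T](\<lambda>t. e t ^ Suc ?n)"
        proof (intro sum_in_bigo(1))
          show "edev (k # ls') \<in> O[principal T](\<lambda>t. e t ^ Suc ?n)" by (rule IH) auto
          show "(\<lambda>t. c t * (\<Sum>j<k. \<mu> (Suc j) t * edev ((k - 1 - j) # ls') t
              + \<mu> (k - 1 - j) t * edev (Suc j # ls') t + edev (Suc j # (k - 1 - j) # ls') t)) \<in> O[principal T](\<lambda>t. e t ^ Suc ?n)"
            unfolding c_def \<mu>_def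
            by (rule mult[OF c, of _ "Suc ?n"], intro big_sum_in_bigo sum_in_bigo(1) mult[OF \<mu>, of _ "Suc ?n"] IH) auto
          show "(\<lambda>t. c' t * (\<Sum>r<?n. of_nat (ls' ! r) *
              (\<mu> (k + ls' ! r) t * edev (drop_nth r ls') t + edev ((k + ls' ! r) # drop_nth r ls') t))) \<in> O[principal T](\<lambda>t. e t ^ Suc ?n)"
            unfolding c'_def \<mu>_def
          \<comment> \<open>Dropping a factor leaves \<open>?n - 1\<close> of them, and
            \<open>2 + (?n - 1)\<close> is \<open>Suc ?n\<close>; for \<open>?n = 0\<close> the sum
            is empty and truncation only helps.\<close>
          proof (rule mult[OF c2, of _ "?n - 1"])
            show "(\<lambda>t. \<Sum>r<?n. of_nat (ls' ! r) *
              (of_real (mp_moment (real (N t) / real (M t)) (k + ls' ! r)) * edev (drop_nth r ls') t + edev ((k + ls' ! r) # drop_nth r ls') t))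
              \<in> O[principal T](\<lambda>t. e t ^ (?n - 1))"
            proof (rule big_sum_in_bigo)
              fix r assume "r \<in> {..<?n}"
              then have r: "r < ?n" by simp
              show "(\<lambda>t. of_nat (ls' ! r) *
                (of_real (mp_moment (real (N t) / real (M t)) (k + ls' ! r)) * edev (drop_nth r ls') t + edev ((k + ls' ! r) # drop_nth r ls') t))
                \<in> O[principal T](\<lambda>t. e t ^ (?n - 1))"
                by (rule mult[where a = 0 and b = "?n - 1"], rule bounded[of _ "real (ls' ! r)"],
                    simp, intro sum_in_bigo(1) mult[OF \<mu>, of _ "?n - 1"] IH)
                   (use ds[OF r] dl[OF r] in auto)
            qed
          qed auto
        qed
        then have "edev ls \<in> O[principal T](\<lambda>t. e t ^ Suc ?n)"
          by (rule landau_o.big.in_cong[THEN iffD2, rotated])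
             (use eq in \<open>auto simp: eventually_principal\<close>)
        then show ?thesis by (simp add: edev_def Cons)
      qed
    qed
  qed
qed

subsection \<open>Almost sure convergence of the moments\<close>

lemma cnj_gpow:
  assumes "x < n" "y < n"
  shows "cnj (gpow n m z k x y) = gpow n m z k y x"
  using assms
proof (induction k arbitrary: x y)
  case (Suc k)
  have "cnj (gpow n m z (Suc k) x y) = (\<Sum>u<n. gram m z y u * gpow n m z k u x)"
    using Suc by (simp add: gram_def mult.commute)
  also have "\<dots> = (\<Sum>u<n. gpow n m z (Suc 0) y u * gpow n m z k u x)"
    using Suc by (intro sum.cong refl arg_cong2[of _ _ _ _ "(*)"] gpow_1[symmetric]) auto
  finally show ?case using gpow_add[of x n m z "Suc 0" y k] Suc by simp
qed auto

lemma gtr_real: "gtr n m z k \<in> \<real>"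
proof -
  have "cnj (gtr n m z k) = gtr n m z k"
    unfolding gtr_def cnj_sum by (intro sum.cong refl cnj_gpow) auto
  then show ?thesis by (simp add: Reals_cnj_iff)
qed

text \<open>Because the traces are real, the fourth absolute power is itself a product of four
  deviations, and \<open>edev_bigo\<close> applies without conjugates.\<close>

lemma tdev_power4: "tdevs n m [k, k, k, k] z = of_real (norm (tdev n m k z) ^ 4)"
proof -
  have "tdev n m k z \<in> \<real>"
    unfolding tdev_def by (intro Reals_diff Reals_divide gtr_real) auto
  then obtain r where "tdev n m k z = of_real r" by (auto elim: Reals_cases)
  then show ?thesis by (simp add: power4_eq_xxxx flip: of_real_mult)
qed

lemma (in prob_space) AE_tendsto_0_if_summable_expectation:
  fixes X :: "nat \<Rightarrow> 'a \<Rightarrow> real"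
  assumes "\<And>n. integrable M (X n)" "\<And>n w. 0 \<le> X n w"
    and "\<And>n. expectation (X n) \<le> a n" "summable a"
  shows "AE w in M. (\<lambda>n. X n w) \<longlonglongrightarrow> 0"
proof -
  have a: "0 \<le> a n" for n
    by (rule order_trans[OF Bochner_Integration.integral_nonneg assms(3)]) (rule assms(2))
  have "(\<integral>\<^sup>+w. (\<Sum>n. ennreal (X n w)) \<partial>M) = (\<Sum>n. \<integral>\<^sup>+w. ennreal (X n w) \<partial>M)"
    using assms(1) by (intro nn_integral_suminf) auto
  also have "\<dots> = (\<Sum>n. ennreal (expectation (X n)))"
    using assms(1,2) by (simp add: nn_integral_eq_integral)
  also have "\<dots> \<le> (\<Sum>n. ennreal (a n))"
    by (intro suminf_le ennreal_leI assms) auto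
  also have "\<dots> < \<top>"
    by (subst suminf_ennreal2[OF a assms(4)]) simp
  finally have "AE w in M. (\<Sum>n. ennreal (X n w)) \<noteq> \<infinity>"
    using assms(1) by (intro nn_integral_PInf_AE) auto
  then show ?thesis
  proof (rule eventually_mono)
    fix w assume "(\<Sum>n. ennreal (X n w)) \<noteq> \<infinity>"
    then have "summable (\<lambda>n. X n w)"
      using assms(2) by (intro summable_suminf_not_top) auto
    then show "(\<lambda>n. X n w) \<longlonglongrightarrow> 0" by (rule summable_LIMSEQ_zero)
  qed
qed

lemma continuous_mp_moment: "continuous_on A (\<lambda>c. mp_moment c k)"
proof (induction k rule: less_induct)
  case (less k)
  show ?case
  proof (cases k)
    case (Suc j)
    have "continuous_on A (\<lambda>c. mp_moment c j + c * (\<Sum>i<j. mp_moment c (Suc i) * mp_moment c (j - 1 - i)))"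
      using less Suc by (intro continuous_intros) auto
    then show ?thesis unfolding Suc mp_moment.simps(2)[of _ j] .
  qed simp
qed

lemma wishart_iid_gaussian_matrix:
  assumes "prob_space P" "0 < n" "0 < m" "iid_gaussian_matrix P n m (1 / real m) H"
  shows "wishart P n m (\<lambda>i w. H w $$ i)"
  using assms by (auto simp: wishart_def iid_gaussian_matrix_def)

text \<open>The null set is fixed before the sequences \<open>N\<close>, \<open>M\<close>,
  \<open>L\<close>. \<open>X n\<close> sums the fourth powers over all admissible
  \<open>(m, l)\<close> with first size \<open>n\<close>; it dominates whichever pair a sequence
  selects, and composing its convergence with \<open>N\<close> covers arbitrarily slow
  growth.\<close>

lemma AE_tdev_tendsto_0:
  fixes H :: "nat \<Rightarrow> nat \<Rightarrow> nat \<Rightarrow> 'w \<Rightarrow> complex mat"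
  assumes P: "prob_space P"
    and H: "\<And>n m l. 0 < n \<Longrightarrow> 0 < m \<Longrightarrow> 0 < l \<Longrightarrow> iid_gaussian_matrix P n m (1 / real m) (H n m l)"
  shows "AE w in P. \<forall>N M L. filterlim N at_top sequentially \<longrightarrow>
    (\<forall>\<^sub>F t in sequentially. 0 < M t \<and> 0 < L t \<and> N t \<le> C * M t \<and> M t \<le> C * N t \<and> L t \<le> C * N t) \<longrightarrow>
    (\<lambda>t. tdev (N t) (M t) k (\<lambda>i. H (N t) (M t) (L t) w $$ i)) \<longlonglongrightarrow> 0"
proof -
  interpret prob_space P by fact
  define S where "S n = {(m, l). 0 < m \<and> 0 < l \<and> n \<le> C * m \<and> m \<le> C * n \<and> l \<le> C * n}" for n
  define T where "T = {(n, m, l). 0 < n \<and> (m, l) \<in> S n}"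
  define Y where "Y n m l w = norm (tdev n m k (\<lambda>i. H n m l w $$ i)) ^ 4" for n m l w
  have Ssub: "S n \<subseteq> {..C * n} \<times> {..C * n}" for n by (auto simp: S_def)
  then have fin: "finite (S n)" for n by (rule finite_subset) auto
  have cardS: "real (card (S n)) \<le> (real C * real n + 1)\<^sup>2" for n
  proof -
    have "card (S n) \<le> card ({..C * n} \<times> {..C * n})" by (intro card_mono Ssub) auto
    then have "real (card (S n)) \<le> real ((C * n + 1) * (C * n + 1))"
      unfolding of_nat_le_iff by (simp add: card_cartesian_product)
    then show ?thesis by (simp add: power2_eq_square algebra_simps)
  qed
  have W: "wishart P n m (\<lambda>i w. H n m l w $$ i)" if "(n, m, l) \<in> T" for n m l
    using that by (intro wishart_iid_gaussian_matrix P H) (auto simp: T_def S_def)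
  have edevY: "wishart.edev P n m (\<lambda>i w. H n m l w $$ i) [k, k, k, k] = of_real (expectation (Y n m l))"
    and intY: "integrable P (Y n m l)" if "(n, m, l) \<in> T" for n m l
  proof -
    have *: "tdevs n m [k, k, k, k] (\<lambda>i. H n m l w $$ i) = of_real (Y n m l w)" for w
      unfolding tdev_power4 Y_def ..
    show "wishart.edev P n m (\<lambda>i w. H n m l w $$ i) [k, k, k, k] = of_real (expectation (Y n m l))"
      unfolding wishart.edev_def[OF W[OF that]] * by simp
    have "integrable P (\<lambda>w. complex_of_real (Y n m l w))"
      using wishart.integrable_tdevs[OF W[OF that], of "[k, k, k, k]"] unfolding * .
    then show "integrable P (Y n m l)" by (simp add: complex_of_real_integrable_eq)
  qed
  have "(\<lambda>t. wishart.edev P (fst t) (fst (snd t)) (\<lambda>i w. H (fst t) (fst (snd t)) (snd (snd t)) w $$ i) [k, k, k, k])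
      \<in> O[principal T](\<lambda>t. (1 / complex_of_nat (fst t)) ^ length [k, k, k, k])"
    by (rule edev_bigo[of T P fst "\<lambda>t. fst (snd t)" _ "real C"])
       (use W in \<open>auto simp: T_def S_def simp flip: of_nat_mult\<close>)
  then obtain B where B: "0 < B" "\<And>n m l. (n, m, l) \<in> T \<Longrightarrow> expectation (Y n m l) \<le> B * (1 / real n ^ 4)"
  proof (elim landau_o.bigE)
    fix B :: real
    assume B: "0 < B" and "\<forall>\<^sub>F t in principal T. norm (wishart.edev P (fst t) (fst (snd t)) (\<lambda>i w. H (fst t) (fst (snd t)) (snd (snd t)) w $$ i) [k, k, k, k])
      \<le> B * norm ((1 / complex_of_nat (fst t)) ^ length [k, k, k, k])"
    then have "norm (wishart.edev P n m (\<lambda>i w. H n m l w $$ i) [k, k, k, k]) \<le> B * norm ((1 / complex_of_nat n) ^ 4)"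
      if "(n, m, l) \<in> T" for n m l
      using that by (force simp: eventually_principal numeral_eq_Suc)
    then have "expectation (Y n m l) \<le> B * (1 / real n ^ 4)" if "(n, m, l) \<in> T" for n m l
      using edevY[OF that] that by (fastforce simp: norm_power norm_divide power_divide)
    with B that show thesis by blast
  qed
  define X where "X n = (if n = 0 then (\<lambda>_. 0) else (\<lambda>w. \<Sum>(m, l)\<in>S n. Y n m l w))" for n
  have "AE w in P. (\<lambda>n. X n w) \<longlonglongrightarrow> 0"
  proof (rule AE_tendsto_0_if_summable_expectation[where a = "\<lambda>n. (real C + 1)\<^sup>2 * B * (1 / real n ^ 2)"])
    show "integrable P (X n)" for n
      unfolding X_def by (auto intro!: Bochner_Integration.integrable_sum intY simp: T_def)
    show "0 \<le> X n w" for n w by (auto simp: X_def Y_def intro!: sum_nonneg)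
    show "summable (\<lambda>n. (real C + 1)\<^sup>2 * B * (1 / real n ^ 2))"
      by (intro summable_mult) (use inverse_power_summable[of 2, where 'a = real] in \<open>simp add: inverse_eq_divide\<close>)
    show "expectation (X n) \<le> (real C + 1)\<^sup>2 * B * (1 / real n ^ 2)" for n
    proof (cases "n = 0")
      case False
      have "expectation (X n) = (\<Sum>(m, l)\<in>S n. expectation (Y n m l))"
        unfolding X_def using False
        by (auto simp: T_def case_prod_beta intro!: Bochner_Integration.integral_sum intY)
      also have "\<dots> \<le> (\<Sum>(m, l)\<in>S n. B * (1 / real n ^ 4))"
        using False by (intro sum_mono) (auto intro!: B(2)[of _ _, simplified] simp: T_def)
      also have "\<dots> = real (card (S n)) * (B * (1 / real n ^ 4))"
        by simp
      also have "\<dots> \<le> ((real C + 1) * real n)\<^sup>2 * (B * (1 / real n ^ 4))"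
        using B(1) False
        by (intro mult_right_mono order_trans[OF cardS] power_mono) (auto simp: algebra_simps)
      also have "\<dots> = (real C + 1)\<^sup>2 * B * (1 / real n ^ 2)"
        using False by (simp add: field_simps power2_eq_square power4_eq_xxxx)
      finally show ?thesis .
    qed (simp add: X_def)
  qed
  then show ?thesis
  proof (rule eventually_mono, intro allI impI)
    fix w N M L
    assume X: "(\<lambda>n. X n w) \<longlonglongrightarrow> 0" and N: "filterlim N at_top sequentially"
      and ev: "\<forall>\<^sub>F t in sequentially. 0 < M t \<and> 0 < L t \<and> N t \<le> C * M t \<and> M t \<le> C * N t \<and> L t \<le> C * N t"
    have lim: "(\<lambda>t. X (N t) w) \<longlonglongrightarrow> 0"
      by (rule filterlim_compose[OF X N])
    have "\<forall>\<^sub>F t in sequentially. 1 \<le> N t"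
      using N by (simp add: filterlim_at_top)
    with ev have "\<forall>\<^sub>F t in sequentially. norm (Y (N t) (M t) (L t) w) \<le> norm (X (N t) w) * 1"
    proof eventually_elim
      case (elim t)
      have "Y (N t) (M t) (L t) w = (\<lambda>(m, l). Y (N t) m l w) (M t, L t)" by simp
      also have "\<dots> \<le> (\<Sum>(m, l)\<in>S (N t). Y (N t) m l w)"
        using elim by (intro member_le_sum fin) (auto simp: S_def Y_def)
      finally show ?case using elim by (simp add: X_def) (simp add: Y_def)
    qed
    then have "(\<lambda>t. Y (N t) (M t) (L t) w) \<longlonglongrightarrow> 0"
      by (rule tendsto_0_le[OF lim])
    then have "(\<lambda>t. root 4 (norm (tdev (N t) (M t) k (\<lambda>i. H (N t) (M t) (L t) w $$ i)) ^ 4)) \<longlonglongrightarrow> root 4 0"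
      unfolding Y_def by (rule tendsto_real_root)
    then show "(\<lambda>t. tdev (N t) (M t) k (\<lambda>i. H (N t) (M t) (L t) w $$ i)) \<longlonglongrightarrow> 0"
      by (simp add: real_root_power_cancel tendsto_norm_zero_iff)
  qed
qed

lemma AE_wishart_moments_tendsto:
  fixes H :: "nat \<Rightarrow> nat \<Rightarrow> nat \<Rightarrow> 'w \<Rightarrow> complex mat"
  assumes P: "prob_space P"
    and H: "\<And>n m l. 0 < n \<Longrightarrow> 0 < m \<Longrightarrow> 0 < l \<Longrightarrow> iid_gaussian_matrix P n m (1 / real m) (H n m l)"
    and lim: "filterlim N at_top sequentially" "filterlim M at_top sequentially" "filterlim L at_top sequentially"
    and \<alpha>: "0 < \<alpha>" "(\<lambda>t. real (M t) / real (N t)) \<longlonglongrightarrow> \<alpha>" "(\<lambda>t. real (L t) / real (N t)) \<longlonglongrightarrow> \<gamma>"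
  shows "AE w in P. \<forall>k. (\<lambda>t. gtr (N t) (M t) (\<lambda>i. H (N t) (M t) (L t) w $$ i) k / of_nat (N t))
     \<longlonglongrightarrow> of_real (mp_moment (1 / \<alpha>) k)"
proof -
  \<comment> \<open>Strict bounds on the limits make the three inequalities between sizes hold
    eventually. \<open>L\<close> is confined too, since the matrix may change with its third
    index.\<close>
  obtain C :: nat where C: "1 / \<alpha> < real C" "\<alpha> < real C" "\<gamma> < real C"
    using reals_Archimedean2[of "max (1 / \<alpha>) (max \<alpha> \<gamma>)"] by auto
  have pos: "\<forall>\<^sub>F t in sequentially. 1 \<le> N t" "\<forall>\<^sub>F t in sequentially. 1 \<le> M t" "\<forall>\<^sub>F t in sequentially. 1 \<le> L t"
    using lim by (simp_all add: filterlim_at_top)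
  have lim': "(\<lambda>t. real (N t) / real (M t)) \<longlonglongrightarrow> 1 / \<alpha>"
    using tendsto_inverse[OF \<alpha>(2)] \<alpha>(1) by (simp add: inverse_eq_divide)
  have ev: "\<forall>\<^sub>F t in sequentially. 0 < M t \<and> 0 < L t \<and> N t \<le> C * M t \<and> M t \<le> C * N t \<and> L t \<le> C * N t"
    using pos order_tendstoD(2)[OF lim' C(1)] order_tendstoD(2)[OF \<alpha>(2) C(2)] order_tendstoD(2)[OF \<alpha>(3) C(3)]
  proof eventually_elim
    case (elim t)
    then have "real (N t) \<le> real (C * M t)" "real (M t) \<le> real (C * N t)" "real (L t) \<le> real (C * N t)"
      by (simp_all add: field_simps)
    then show ?case using elim unfolding of_nat_le_iff by auto
  qed
  have "AE w in P. \<forall>k. (\<lambda>t. tdev (N t) (M t) k (\<lambda>i. H (N t) (M t) (L t) w $$ i)) \<longlonglongrightarrow> 0"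
    unfolding AE_all_countable
  proof
    fix k
    show "AE w in P. (\<lambda>t. tdev (N t) (M t) k (\<lambda>i. H (N t) (M t) (L t) w $$ i)) \<longlonglongrightarrow> 0"
      using AE_tdev_tendsto_0[where H = H and C = C and k = k, OF P H] by (rule eventually_mono) (use lim ev in auto)
  qed
  then show ?thesis
  proof (rule eventually_mono, intro allI impI)
    fix w k
    assume *: "\<forall>k. (\<lambda>t. tdev (N t) (M t) k (\<lambda>i. H (N t) (M t) (L t) w $$ i)) \<longlonglongrightarrow> 0"
    have "isCont (\<lambda>c. mp_moment c k) (1 / \<alpha>)"
      using continuous_mp_moment[of UNIV k] by (simp add: continuous_on_eq_continuous_at)
    then have "(\<lambda>t. mp_moment (real (N t) / real (M t)) k) \<longlonglongrightarrow> mp_moment (1 / \<alpha>) k"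
      using lim' by (rule isCont_tendsto_compose)
    from tendsto_add[OF spec[OF *, of k] tendsto_of_real[OF this]]
    show "(\<lambda>t. gtr (N t) (M t) (\<lambda>i. H (N t) (M t) (L t) w $$ i) k / of_nat (N t))
      \<longlonglongrightarrow> of_real (mp_moment (1 / \<alpha>) k)"
      by (simp add: tdev_def)
  qed
qed

subsection \<open>The moments of the Marchenko--Pastur density\<close>

text \<open>The trigonometric moments \<open>semi s n (k + 1)\<close> are those of \<open>L\<^sup>n U\<^sub>k\<close>, where \<open>U\<^sub>k\<close> is a Chebyshev
  polynomial of the second kind and \<open>L\<close> is an affine function of a semicircular variable. Multiplication
  by \<open>L\<close> acts tridiagonally on them, and the first-passage decomposition of the associated
  lattice paths gives the recursion of \<^const>\<open>mp_moment\<close>.\<close>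

definition semi :: "real \<Rightarrow> nat \<Rightarrow> nat \<Rightarrow> real" where
  "semi s n k = 2 / pi * integral {0..pi} (\<lambda>t. (1 + s\<^sup>2 + 2 * s * cos t) ^ n * (sin (real k * t) * sin t))"

lemma semi_0_right [simp]: "semi s n 0 = 0"
  by (simp add: semi_def)

lemma semi_0_left: "semi s 0 k = (if k = 1 then 1 else 0)"
proof -
  have cosint: "integral {0..pi} (\<lambda>t. cos (real_of_int j * t)) = (if j = 0 then pi else 0)" for j :: int
  proof (cases "j = 0")
    case False
    have "((\<lambda>t. cos (real_of_int j * t)) has_integral
      (sin (real_of_int j * pi) / real_of_int j - sin (real_of_int j * 0) / real_of_int j)) {0..pi}"
      using False by (intro fundamental_theorem_of_calculus)
        (auto intro!: derivative_eq_intros simp flip: has_real_derivative_iff_has_vector_derivative)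
    moreover have "sin (real_of_int j * pi) = 0"
      using sin_integer_2pi sin_zero_iff_int2 by blast
    ultimately show ?thesis using False by (simp add: integral_unique)
  qed simp
  have "integral {0..pi} (\<lambda>t. sin (real k * t) * sin t)
      = integral {0..pi} (\<lambda>t. (cos (real_of_int (int k - 1) * t) - cos (real_of_int (int k + 1) * t)) / 2)"
    by (intro integral_cong) (simp add: left_diff_distrib distrib_right cos_diff cos_add)
  also have "\<dots> = (integral {0..pi} (\<lambda>t. cos (real_of_int (int k - 1) * t))
      - integral {0..pi} (\<lambda>t. cos (real_of_int (int k + 1) * t))) / 2"
    by (simp only: integral_divide, subst integral_diff)
       (auto intro!: integrable_continuous_real continuous_intros)
  also have "\<dots> = (if k = 1 then pi / 2 else 0)"
    unfolding cosint by auto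
  finally show ?thesis by (simp add: semi_def)
qed

lemma semi_Suc: "semi s (Suc n) (Suc k) = (1 + s\<^sup>2) * semi s n (Suc k) + s * (semi s n (Suc (Suc k)) + semi s n k)"
proof -
  let ?L = "\<lambda>t. 1 + s\<^sup>2 + 2 * s * cos t"
  have *: "2 * cos t * sin (real (Suc k) * t) = sin (real (Suc (Suc k)) * t) + sin (real k * t)" for t
    using sin_times_cos[of "real (Suc k) * t" t] by (simp add: algebra_simps)
  have int: "(\<lambda>t. ?L t ^ n * (sin (real j * t) * sin t)) integrable_on {0..pi}" for j n
    by (intro integrable_continuous_real continuous_intros)
  have eq: "?L t ^ Suc n * (sin (real (Suc k) * t) * sin t)
     = (1 + s\<^sup>2) * (?L t ^ n * (sin (real (Suc k) * t) * sin t))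
       + s * (?L t ^ n * (sin (real (Suc (Suc k)) * t) * sin t) + ?L t ^ n * (sin (real k * t) * sin t))" for t
  proof -
    have "?L t ^ Suc n * (sin (real (Suc k) * t) * sin t)
      = (1 + s\<^sup>2) * (?L t ^ n * (sin (real (Suc k) * t) * sin t))
        + s * (?L t ^ n * ((2 * cos t * sin (real (Suc k) * t)) * sin t))"
      by (simp add: algebra_simps)
    then show ?thesis unfolding * by (simp add: algebra_simps)
  qed
  have "integral {0..pi} (\<lambda>t. ?L t ^ Suc n * (sin (real (Suc k) * t) * sin t))
     = (1 + s\<^sup>2) * integral {0..pi} (\<lambda>t. ?L t ^ n * (sin (real (Suc k) * t) * sin t))
       + s * (integral {0..pi} (\<lambda>t. ?L t ^ n * (sin (real (Suc (Suc k)) * t) * sin t))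
         + integral {0..pi} (\<lambda>t. ?L t ^ n * (sin (real k * t) * sin t)))"
    unfolding eq
    by (intro integral_unique has_integral_add has_integral_mult_right integrable_integral int)
  moreover have "c * (A * x + s * (y + z)) = A * (c * x) + s * (c * y + c * z)" for c A x y z :: real
    by (simp add: algebra_simps)
  ultimately show ?thesis unfolding semi_def by simp
qed

text \<open>By \<open>semi_Suc\<close>, \<open>semi s n k\<close> is the total weight of lattice
  paths with \<open>n\<close> steps from height \<open>k\<close> to height 1 that stay positive;
  level steps weigh \<open>1 + s^2\<close>, the others \<open>s\<close>. Cut such a path at its
  first visit to height 1: before it, after j + 1 steps, lies a path above height 1, shifted down by
  one, and the step weighs \<open>s\<close>.\<close>

lemma semi_first_passage:
  "semi s n (Suc (Suc k)) = s * (\<Sum>j<n. semi s j (Suc k) * semi s (n - 1 - j) 1)"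
proof (induction n arbitrary: k)
  case 0
  then show ?case by (simp add: semi_0_left)
next
  case (Suc n)
  have "semi s (Suc n) (Suc (Suc k)) = (1 + s\<^sup>2) * semi s n (Suc (Suc k)) + s * (semi s n (Suc (Suc (Suc k))) + semi s n (Suc k))"
    by (rule semi_Suc)
  also have "\<dots> = s * (\<Sum>j<n. ((1 + s\<^sup>2) * semi s j (Suc k) + s * (semi s j (Suc (Suc k)) + semi s j k)) * semi s (n - 1 - j) 1)
      + s * semi s 0 (Suc k) * semi s n 1"
  proof (cases k)
    case 0
    have "(1 + s\<^sup>2) * semi s n (Suc (Suc k)) + s * (semi s n (Suc (Suc (Suc k))) + semi s n (Suc k))
      = (1 + s\<^sup>2) * (s * (\<Sum>j<n. semi s j (Suc k) * semi s (n - 1 - j) 1))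
        + s * (s * (\<Sum>j<n. semi s j (Suc (Suc k)) * semi s (n - 1 - j) 1)) + s * semi s n (Suc k)"
      by (subst (1 2) Suc.IH) (simp add: algebra_simps)
    then show ?thesis
      using 0 by (simp add: semi_0_left sum_distrib_left sum.distrib algebra_simps)
  next
    case (Suc k')
    have "(1 + s\<^sup>2) * semi s n (Suc (Suc k)) + s * (semi s n (Suc (Suc (Suc k))) + semi s n (Suc k))
      = (1 + s\<^sup>2) * (s * (\<Sum>j<n. semi s j (Suc k) * semi s (n - 1 - j) 1))
        + s * (s * (\<Sum>j<n. semi s j (Suc (Suc k)) * semi s (n - 1 - j) 1)
          + s * (\<Sum>j<n. semi s j k * semi s (n - 1 - j) 1))"
      unfolding Suc by (simp only: Suc.IH)
    then show ?thesis
      using Suc by (simp add: semi_0_left sum_distrib_left sum.distrib algebra_simps)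
  qed
  also have "\<dots> = s * (\<Sum>j<Suc n. semi s j (Suc k) * semi s (Suc n - 1 - j) 1)"
    unfolding semi_Suc[symmetric]
    by (subst sum.lessThan_Suc_shift) (simp add: algebra_simps)
  finally show ?case .
qed

lemma semi_1_Suc:
  "semi s (Suc n) 1 = (1 + s\<^sup>2) * semi s n 1 + s\<^sup>2 * (\<Sum>j<n. semi s j 1 * semi s (n - 1 - j) 1)"
  using semi_Suc[of s n 0] semi_first_passage[of s n 0] by (simp add: power2_eq_square)

lemma mp_moment_eq_semi: "mp_moment (s\<^sup>2) (Suc n) = semi s n 1"
proof (induction n rule: less_induct)
  case (less n)
  show ?case
  proof (cases n)
    case 0
    then show ?thesis by (simp add: mp_moment.simps(2)[of _ 0] semi_0_left)
  next
    case (Suc p)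
    have "mp_moment (s\<^sup>2) (Suc n) = mp_moment (s\<^sup>2) (Suc p)
        + s\<^sup>2 * (\<Sum>j<Suc p. mp_moment (s\<^sup>2) (Suc j) * mp_moment (s\<^sup>2) (p - j))"
      using Suc by (subst mp_moment.simps(2)) simp
    also have "\<dots> = semi s p 1 + s\<^sup>2 * (\<Sum>j<Suc p. semi s j 1 * mp_moment (s\<^sup>2) (p - j))"
      using less Suc by simp
    \<comment> \<open>The term \<open>j = p\<close> contains \<open>mp_moment 0 = 1\<close>. Split
      off, it supplies the \<open>s^2\<close> in the weight \<open>1 + s^2\<close> of a level
      step.\<close>
    also have "(\<Sum>j<Suc p. semi s j 1 * mp_moment (s\<^sup>2) (p - j))
        = (\<Sum>j<p. semi s j 1 * mp_moment (s\<^sup>2) (Suc (p - 1 - j))) + semi s p 1"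
      by simp (intro sum.cong refl, simp add: Suc_diff_Suc)
    also have "\<dots> = (\<Sum>j<p. semi s j 1 * semi s (p - 1 - j) 1) + semi s p 1"
      using less Suc by simp
    finally show ?thesis
      unfolding Suc semi_1_Suc by (simp add: algebra_simps)
  qed
qed

text \<open>The density multiplied by \<open>l\<close>. It is continuous even when
  \<open>a = 0\<close>, and it matches test functions that carry a factor x.\<close>

definition mp_weight :: "real \<Rightarrow> real \<Rightarrow> real \<Rightarrow> real" where
  "mp_weight a b l = sqrt ((l - a) * (b - l)) / (2 * pi)"

text \<open>Substitute l = 1 + s^2 - 2 s cos t. The minus sign makes the substitution increasing and
  produces \<open>semi (-s)\<close>; \<open>mp_moment\<close> sees only \<open>s^2\<close>. The
  square root becomes \<open>2 * s * sin t\<close>, the second sine of \<open>semi\<close>.\<close>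

lemma integral_power_mp_weight:
  assumes s: "0 < s"
  shows "((\<lambda>l. l ^ n * mp_weight ((1 - s)\<^sup>2) ((1 + s)\<^sup>2) l) has_integral s\<^sup>2 * mp_moment (s\<^sup>2) (Suc n))
    {(1 - s)\<^sup>2..(1 + s)\<^sup>2}"
proof -
  let ?a = "(1 - s)\<^sup>2" and ?b = "(1 + s)\<^sup>2"
  let ?g = "\<lambda>t. 1 + s\<^sup>2 - 2 * s * cos t"
  let ?f = "\<lambda>l. l ^ n * mp_weight ?a ?b l"
  have ab: "?a \<le> ?b" using s by (simp add: power2_eq_square algebra_simps)
  have g: "?g 0 = ?a" "?g pi = ?b" by (simp_all add: power2_eq_square algebra_simps)
  have "?g ` {0..pi} \<subseteq> {?a..?b}"
  proof safe
    fix t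
    have "s * cos t \<le> s * 1" "s * (-1) \<le> s * cos t" using s by (intro mult_left_mono; simp)+
    then show "?g t \<in> {?a..?b}" by (simp add: power2_eq_square algebra_simps)
  qed
  moreover have cont: "continuous_on {?a..?b} ?f" unfolding mp_weight_def by (intro continuous_intros) auto
  ultimately have "((\<lambda>t. (2 * s * sin t) *\<^sub>R ?f (?g t)) has_integral integral {?g 0..?g pi} ?f) {0..pi}"
    using ab g
    by (intro has_integral_substitution[where c = ?a and d = ?b])
       (auto intro!: derivative_eq_intros simp flip: has_real_derivative_iff_has_vector_derivative)
  then have "integral {?a..?b} ?f = integral {0..pi} (\<lambda>t. (2 * s * sin t) * ?f (?g t))"
    unfolding g by (simp add: integral_unique)
  also have "\<dots> = integral {0..pi} (\<lambda>t. (2 * s\<^sup>2 / pi) * ((1 + (-s)\<^sup>2 + 2 * (-s) * cos t) ^ n * (sin (real 1 * t) * sin t)))"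
  proof (rule integral_cong)
    fix t assume t: "t \<in> {0..pi}"
    have "(?g t - ?a) * (?b - ?g t) = (2 * s * sin t)\<^sup>2"
      using sin_squared_eq[of t] by (simp add: power_mult_distrib) (simp add: power2_eq_square algebra_simps)
    moreover have "0 \<le> 2 * s * sin t" using s t sin_ge_zero[of t] by auto
    ultimately have "sqrt ((?g t - ?a) * (?b - ?g t)) = 2 * s * sin t" by simp
    then have "mp_weight ?a ?b (?g t) = s * sin t / pi" by (simp add: mp_weight_def)
    then show "(2 * s * sin t) * ?f (?g t) = (2 * s\<^sup>2 / pi) * ((1 + (-s)\<^sup>2 + 2 * (-s) * cos t) ^ n * (sin (real 1 * t) * sin t))"
      by (simp add: power2_eq_square mult_ac)
  qed
  also have "\<dots> = s\<^sup>2 * semi (-s) n 1"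
    by (simp only: integral_mult_right semi_def) simp
  also have "\<dots> = s\<^sup>2 * mp_moment (s\<^sup>2) (Suc n)"
    using mp_moment_eq_semi[of "-s" n] by simp
  finally show ?thesis
    using integrable_integral[OF integrable_continuous_real[OF cont]] by simp
qed

subsection \<open>From moments to the water level\<close>

definition list_avg :: "real list \<Rightarrow> (real \<Rightarrow> real) \<Rightarrow> real" where
  "list_avg ls f = (\<Sum>n<length ls. f (ls ! n)) / real (length ls)"

lemma list_avg_mono: "(\<And>x. x \<in> set ls \<Longrightarrow> f x \<le> g x) \<Longrightarrow> list_avg ls f \<le> list_avg ls g"
  unfolding list_avg_def by (intro divide_right_mono sum_mono) auto

lemma list_avg_linear:
  "list_avg ls (\<lambda>x. f x + g x) = list_avg ls f + list_avg ls g"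
  "list_avg ls (\<lambda>x. f x - g x) = list_avg ls f - list_avg ls g"
  "list_avg ls (\<lambda>x. c * f x) = c * list_avg ls f"
  "list_avg ls (\<lambda>x. \<Sum>i\<in>I. h i x) = (\<Sum>i\<in>I. list_avg ls (h i))"
  unfolding list_avg_def
  by (simp_all add: sum.distrib add_divide_distrib sum_subtractf diff_divide_distrib sum_distrib_left
      sum_divide_distrib sum.swap[of _ _ I])

locale mp_interval =
  fixes a b :: real
  assumes ab: "0 \<le> a" "a < b"
begin

abbreviation "w \<equiv> mp_weight a b"

lemma w_nonneg: "l \<in> {a..b} \<Longrightarrow> 0 \<le> w l"
  by (auto simp: mp_weight_def)

lemma w_cont: "continuous_on A w"
  unfolding mp_weight_def by (intro continuous_intros) auto

lemma w_int: "continuous_on {c..b} f \<Longrightarrow> (\<lambda>l. f l * w l) integrable_on {c..b}"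
  by (intro integrable_continuous_real continuous_intros w_cont)

end

text \<open>Only moments of order at least 1 occur, so zero eigenvalues, and with them a possible
  atom at 0, contribute nothing.\<close>

locale mp_limit = mp_interval +
  fixes ls :: "nat \<Rightarrow> real list"
  assumes nonneg: "\<And>t x. x \<in> set (ls t) \<Longrightarrow> 0 \<le> x"
    and moments: "\<And>k. (\<lambda>t. list_avg (ls t) (\<lambda>x. x * x ^ k)) \<longlonglongrightarrow> integral {a..b} (\<lambda>l. l ^ k * mp_weight a b l)"
begin

text \<open>On \<open>{0..R}\<close> with \<open>R > b\<close> the function is replaced by a
  Weierstrass polynomial. Beyond \<open>R\<close> the error is at most \<open>B * x ^ q\<close>,
  hence at most \<open>B * x ^ q * (x / R) ^ s\<close> for every \<open>s\<close>; the limit of its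
  average is bounded by a multiple of \<open>(b / R) ^ s\<close>. Thus a few large eigenvalues do no
  harm.\<close>

lemma list_avg_tendsto:
  assumes g: "continuous_on {0..} g" and K: "\<And>x. 0 \<le> x \<Longrightarrow> \<bar>g x\<bar> \<le> K"
  shows "(\<lambda>t. list_avg (ls t) (\<lambda>x. x * g x)) \<longlonglongrightarrow> integral {a..b} (\<lambda>l. g l * w l)"
proof (rule LIMSEQ_I)
  fix e :: real assume e: "0 < e"
  define \<mu> where "\<mu> k = integral {a..b} (\<lambda>l. l ^ k * w l)" for k
  have pint: "(\<lambda>l. l ^ k * w l) integrable_on {a..b}" for k
    by (intro w_int continuous_intros)
  have \<mu>0: "0 \<le> \<mu> 0" unfolding \<mu>_def by (intro integral_nonneg pint) (auto intro: w_nonneg)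
  have \<mu>k: "\<mu> k \<le> b ^ k * \<mu> 0" for k
  proof -
    have "\<mu> k \<le> integral {a..b} (\<lambda>l. b ^ k * (l ^ 0 * w l))"
      unfolding \<mu>_def using ab
      by (intro integral_le pint integrable_on_mult_right) (auto intro!: mult_right_mono power_mono w_nonneg)
    then show ?thesis by (simp add: \<mu>_def)
  qed
  \<comment> \<open>The budget: \<open>2 * d * \<mu> 0 + d\<close> for passing from \<open>g\<close>
    to the polynomial in the average, \<open>d\<close> for the convergence of the polynomial
    averages, \<open>d * \<mu> 0\<close> for passing back in the integral.\<close>
  define d where "d = e / (3 * \<mu> 0 + 2)"
  have d: "0 < d" using e \<mu>0 by (simp add: d_def)
  define R where "R = b + 1"
  have R: "1 \<le> R" "b < R" using ab by (auto simp: R_def)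
  obtain p where p: "real_polynomial_function p" "\<And>x. x \<in> {0..R} \<Longrightarrow> \<bar>g x - p x\<bar> < d"
    using Stone_Weierstrass_real_polynomial_function[of "{0..R}" g d] d continuous_on_subset[OF g, of "{0..R}"]
    by auto
  obtain c q where pc: "p = (\<lambda>x. \<Sum>i\<le>q. c i * x ^ i)"
    using p(1) unfolding real_polynomial_function_iff_sum by auto
  define B where "B = \<bar>K\<bar> + (\<Sum>i\<le>q. \<bar>c i\<bar>)"
  have B: "\<bar>g x - p x\<bar> \<le> B * x ^ q" if "1 \<le> x" for x
  proof -
    have "1 \<le> x ^ q" using that by simp
    then have "\<bar>g x\<bar> \<le> \<bar>K\<bar> * x ^ q"
      using K[of x] that by (smt (verit) mult_left_mono mult_cancel_left1)
    moreover have "\<bar>p x\<bar> \<le> (\<Sum>i\<le>q. \<bar>c i\<bar> * x ^ q)"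
      unfolding pc using that
      by (intro order_trans[OF sum_abs] sum_mono) (auto simp: abs_mult intro!: mult_left_mono power_increasing)
    ultimately show ?thesis by (simp add: B_def distrib_right sum_distrib_right)
  qed
  have B0: "0 \<le> B" by (simp add: B_def sum_nonneg)
  have "(\<lambda>s. B * b ^ q * (b / R) ^ s) \<longlonglongrightarrow> B * b ^ q * 0"
    using ab R by (intro tendsto_intros LIMSEQ_power_zero) auto
  then have "\<forall>\<^sub>F s in sequentially. B * b ^ q * (b / R) ^ s < d"
    using d by (auto intro: order_tendstoD)
  then obtain s where s: "B * b ^ q * (b / R) ^ s < d"
    by (auto simp: eventually_sequentially)
  define D where "D t = d * list_avg (ls t) (\<lambda>x. x * x ^ 0) + B / R ^ s * list_avg (ls t) (\<lambda>x. x * x ^ (q + s))" for t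
  have Dlim: "D \<longlonglongrightarrow> d * \<mu> 0 + B / R ^ s * \<mu> (q + s)"
    unfolding D_def \<mu>_def by (intro tendsto_intros moments)
  have "B / R ^ s * \<mu> (q + s) \<le> B / R ^ s * (b ^ (q + s) * \<mu> 0)"
    using B0 R by (intro mult_left_mono \<mu>k) auto
  also have "\<dots> = B * b ^ q * (b / R) ^ s * \<mu> 0" by (simp add: power_add power_divide)
  also have "\<dots> \<le> d * \<mu> 0" using s \<mu>0 by (intro mult_right_mono) auto
  finally have "d * \<mu> 0 + B / R ^ s * \<mu> (q + s) < 2 * d * \<mu> 0 + d" using d by simp
  then have ev1: "\<forall>\<^sub>F t in sequentially. D t < 2 * d * \<mu> 0 + d"
    using Dlim by (rule order_tendstoD(2)[rotated])
  have diff: "\<bar>list_avg (ls t) (\<lambda>x. x * g x) - list_avg (ls t) (\<lambda>x. x * p x)\<bar> \<le> D t" for t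
  proof -
    have pt: "\<bar>x * g x - x * p x\<bar> \<le> d * (x * x ^ 0) + B / R ^ s * (x * x ^ (q + s))" if "0 \<le> x" for x
    proof (cases "x \<le> R")
      case True
      have "\<bar>g x - p x\<bar> \<le> d" using p(2)[of x] True that by auto
      then have "x * \<bar>g x - p x\<bar> \<le> x * d" using that by (intro mult_left_mono)
      moreover have "\<bar>x * g x - x * p x\<bar> = x * \<bar>g x - p x\<bar>"
        using that by (simp add: abs_mult flip: right_diff_distrib)
      moreover have "0 \<le> B / R ^ s * (x * x ^ (q + s))"
        using B0 R that by auto
      ultimately show ?thesis by (simp add: mult.commute)
    next
      case False
      have "1 \<le> (x / R) ^ s" using False R by (intro one_le_power) auto
      have "\<bar>g x - p x\<bar> \<le> B * x ^ q" using False R by (intro B) auto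
      also have "\<dots> \<le> B * x ^ q * (x / R) ^ s"
        using \<open>1 \<le> (x / R) ^ s\<close> B0 that mult_left_mono[of 1 "(x / R) ^ s" "B * x ^ q"] by simp
      finally have "x * \<bar>g x - p x\<bar> \<le> x * (B * x ^ q * (x / R) ^ s)" using that by (intro mult_left_mono)
      moreover have "\<bar>x * g x - x * p x\<bar> = x * \<bar>g x - p x\<bar>"
        using that by (simp add: abs_mult flip: right_diff_distrib)
      moreover have "0 \<le> d * x" using d that by simp
      ultimately show ?thesis by (simp add: power_add power_divide mult_ac)
    qed
    have "list_avg (ls t) (\<lambda>x. x * g x) - list_avg (ls t) (\<lambda>x. x * p x) \<le> D t"
      unfolding D_def list_avg_linear[symmetric]
      by (rule list_avg_mono) (use pt nonneg in \<open>fastforce simp: abs_le_iff\<close>)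
    moreover have "list_avg (ls t) (\<lambda>x. x * p x) - list_avg (ls t) (\<lambda>x. x * g x) \<le> D t"
      unfolding D_def list_avg_linear[symmetric]
      by (rule list_avg_mono) (use pt nonneg in \<open>fastforce simp: abs_le_iff\<close>)
    ultimately show ?thesis by simp
  qed
  have pw: "integral {a..b} (\<lambda>l. p l * w l) = (\<Sum>i\<le>q. c i * \<mu> i)"
  proof -
    have "((\<lambda>l. \<Sum>i\<le>q. c i * (l ^ i * w l)) has_integral (\<Sum>i\<le>q. c i * \<mu> i)) {a..b}"
      unfolding \<mu>_def by (intro has_integral_sum has_integral_mult_right integrable_integral pint) auto
    then show ?thesis unfolding pc by (simp add: integral_unique sum_distrib_right mult.assoc)
  qed
  have "(\<lambda>t. list_avg (ls t) (\<lambda>x. x * p x)) = (\<lambda>t. \<Sum>i\<le>q. c i * list_avg (ls t) (\<lambda>x. x * x ^ i))"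
    unfolding pc list_avg_linear[symmetric] by (simp add: sum_distrib_left mult_ac)
  also have "\<dots> \<longlonglongrightarrow> integral {a..b} (\<lambda>l. p l * w l)"
    unfolding pw \<mu>_def by (intro tendsto_intros moments)
  finally have "\<forall>\<^sub>F t in sequentially. \<bar>list_avg (ls t) (\<lambda>x. x * p x) - integral {a..b} (\<lambda>l. p l * w l)\<bar> < d"
    using d by (auto simp: tendsto_iff dist_real_def)
  with ev1 have "\<forall>\<^sub>F t in sequentially. norm (list_avg (ls t) (\<lambda>x. x * g x) - integral {a..b} (\<lambda>l. g l * w l)) < e"
  proof eventually_elim
    case (elim t)
    have gi: "(\<lambda>l. g l * w l) integrable_on {a..b}" "(\<lambda>l. p l * w l) integrable_on {a..b}"
      using continuous_on_subset[OF g, of "{a..b}"] ab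
      by (auto intro!: w_int continuous_intros simp: pc)
    have "norm (integral {a..b} (\<lambda>l. p l * w l - g l * w l)) \<le> integral {a..b} (\<lambda>l. d * (l ^ 0 * w l))"
    proof (rule integral_norm_bound_integral)
      fix l assume l: "l \<in> {a..b}"
      have "\<bar>g l - p l\<bar> * w l \<le> d * w l"
        using p(2)[of l] l ab R w_nonneg[OF l] by (intro mult_right_mono) auto
      moreover have "\<bar>p l * w l - g l * w l\<bar> = \<bar>g l - p l\<bar> * w l"
        using w_nonneg[OF l] by (simp add: abs_mult abs_minus_commute flip: left_diff_distrib)
      ultimately show "norm (p l * w l - g l * w l) \<le> d * (l ^ 0 * w l)" by simp
    qed (intro integrable_diff gi integrable_on_mult_right pint)+
    also have "\<dots> = d * \<mu> 0" by (simp add: \<mu>_def)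
    finally have "\<bar>integral {a..b} (\<lambda>l. p l * w l) - integral {a..b} (\<lambda>l. g l * w l)\<bar> \<le> d * \<mu> 0"
      using gi by (simp add: Henstock_Kurzweil_Integration.integral_diff)
    with elim diff[of t] have "\<bar>list_avg (ls t) (\<lambda>x. x * g x) - integral {a..b} (\<lambda>l. g l * w l)\<bar>
      < 2 * d * \<mu> 0 + d + d + d * \<mu> 0"
      by linarith
    also have "\<dots> = d * (3 * \<mu> 0 + 2)" by (simp add: algebra_simps)
    also have "\<dots> = e" using \<mu>0 by (simp add: d_def)
    finally show ?case by simp
  qed
  then show "\<exists>no. \<forall>n\<ge>no. norm (list_avg (ls n) (\<lambda>x. x * g x) - integral {a..b} (\<lambda>l. g l * w l)) < e"
    by (simp add: eventually_sequentially)
qed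

end

text \<open>\<open>x * wf_kernel s v x\<close> is the power allocated to the eigenvalue \<open>x\<close>; dividing by \<open>x\<close> is harmless because
  the power vanishes near 0.\<close>

definition wf_kernel :: "real \<Rightarrow> real \<Rightarrow> real \<Rightarrow> real" where
  "wf_kernel s v l = max 0 (v * l - s) / (max l (s / v))\<^sup>2"

section \<open>Limiting power and limiting fraction of active modes as functions of the
  level\<close>

locale mp_water_filling = mp_interval +
  fixes s p :: real
  assumes s: "0 < s" and p: "0 < p"
begin

lemma wf_kernel_cont: "0 < v \<Longrightarrow> continuous_on A (wf_kernel s v)"
proof -
  assume "0 < v"
  then have "0 < max x (s / v)" for x using s by (simp add: less_max_iff_disj)
  then have "(max x (s / v))\<^sup>2 \<noteq> 0" for x by (metis less_irrefl zero_eq_power2)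
  then show ?thesis unfolding wf_kernel_def by (intro continuous_intros) auto
qed

lemma wf_kernel_above:
  assumes "0 < v" "s / v \<le> l"
  shows "wf_kernel s v l = (v - s / l) / l"
proof -
  have "0 < s / v" using assms s by simp
  then have l: "0 < l" using assms by linarith
  have m: "max l (s / v) = l" using assms by simp
  have "0 \<le> v * l - s" using assms by (simp add: field_simps)
  then show ?thesis unfolding wf_kernel_def m using l by (simp add: field_simps power2_eq_square)
qed

lemma wf_kernel_below:
  assumes "0 < v" "l \<le> s / v"
  shows "wf_kernel s v l = 0"
proof -
  have "v * l - s \<le> 0" using assms by (simp add: field_simps)
  then show ?thesis by (simp add: wf_kernel_def)
qed

lemma mult_wf_kernel:
  assumes "0 < v" "0 \<le> x"
  shows "x * wf_kernel s v x = wf_power s v x"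
proof (cases "x \<le> s / v")
  case True
  have "v - s / x \<le> 0" if "x \<noteq> 0" using True assms that by (simp add: field_simps)
  then show ?thesis using True assms by (simp add: wf_kernel_below wf_power_def)
next
  case False
  have "0 < s / v" using assms s by simp
  then have x: "0 < x" using False by linarith
  moreover have "0 \<le> v - s / x" using False assms x by (simp add: field_simps)
  ultimately show ?thesis using False assms by (simp add: wf_kernel_above wf_power_def)
qed

lemma wf_kernel_bound:
  assumes "0 < v" "0 \<le> x"
  shows "\<bar>wf_kernel s v x\<bar> \<le> v / (s / v)"
proof -
  define y where "y = max x (s / v)"
  have y: "0 < s / v" "s / v \<le> y" "x \<le> y" "0 < y" using assms s by (auto simp: y_def less_max_iff_disj)
  have "max 0 (v * x - s) \<le> v * x" using assms s by auto
  also have "\<dots> \<le> v * y" using y(3) assms by (intro mult_left_mono) auto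
  finally have "max 0 (v * x - s) / y\<^sup>2 \<le> v * y / y\<^sup>2"
    using y by (intro divide_right_mono) auto
  also have "\<dots> = v / y" using y by (simp add: power2_eq_square)
  also have "\<dots> \<le> v / (s / v)" using y assms by (intro divide_left_mono mult_pos_pos) auto
  finally show ?thesis by (simp add: wf_kernel_def y_def)
qed

text \<open>\<open>W\<close> is the limit of the average power at level \<open>v\<close>, and
  \<open>F\<close> below is that of the fraction of active modes. \<open>F\<close> acts as the slope
  of the convex function \<open>W\<close>; \<open>W_diff_le\<close> and \<open>W_diff_ge\<close>
  express this without derivatives.\<close>

definition W :: "real \<Rightarrow> real" where
  "W v = integral {a..b} (\<lambda>l. wf_kernel s v l * w l)"

definition low :: "real \<Rightarrow> real" where
  "low v = max (s / v) a"

definition F :: "real \<Rightarrow> real" where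
  "F v = integral {low v..b} (\<lambda>l. 1 / l * w l)"

lemma b_pos: "0 < b" using ab by simp

lemma low_props:
  assumes "s / b < v"
  shows "0 < v" "0 < low v" "a \<le> low v" "low v < b" "s / v \<le> low v"
proof -
  show "0 < v" using assms s b_pos by (meson divide_pos_pos order_less_trans)
  then show "0 < low v" "a \<le> low v" "low v < b" "s / v \<le> low v"
    using assms s ab b_pos by (auto simp: low_def less_max_iff_disj field_simps)
qed

lemma wf_kernel_mono: "0 < v \<Longrightarrow> v \<le> v' \<Longrightarrow> 0 \<le> l \<Longrightarrow> wf_kernel s v l \<le> wf_kernel s v' l"
proof -
  assume *: "0 < v" "v \<le> v'" "0 \<le> l"
  show "wf_kernel s v l \<le> wf_kernel s v' l"
  proof (cases "l \<le> s / v")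
    case True
    then have "wf_kernel s v l = 0" using * by (intro wf_kernel_below)
    then show ?thesis by (simp add: wf_kernel_def[of _ v'])
  next
    case False
    have "s / v' \<le> s / v" using * s by (intro divide_left_mono) auto
    then show ?thesis using False * wf_kernel_above[of v l] wf_kernel_above[of v' l]
      by (simp add: divide_right_mono)
  qed
qed

lemma kint: "0 < v \<Longrightarrow> (\<lambda>l. wf_kernel s v l * w l) integrable_on {c..b}"
  by (intro w_int wf_kernel_cont)

lemma rint: "0 < c \<Longrightarrow> (\<lambda>l. 1 / l * w l) integrable_on {c..b}"
  by (intro w_int continuous_intros) auto

lemma rw_nonneg: "0 < c \<Longrightarrow> a \<le> c \<Longrightarrow> l \<in> {c..b} \<Longrightarrow> 0 \<le> 1 / l * w l"
  using w_nonneg[of l] by (intro mult_nonneg_nonneg) auto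

lemma W_restrict:
  assumes "0 < v" "a \<le> c" "c \<le> b" "c \<le> s / v \<or> c = a"
  shows "W v = integral {c..b} (\<lambda>l. wf_kernel s v l * w l)"
proof -
  have "integral {a..c} (\<lambda>l. wf_kernel s v l * w l) = 0"
  proof (cases "c = a")
    case False
    have "integral {a..c} (\<lambda>l. wf_kernel s v l * w l) = integral {a..c} (\<lambda>_. 0)"
      using assms False by (intro integral_cong) (auto simp: wf_kernel_below)
    then show ?thesis by simp
  qed simp
  then show ?thesis
    using Henstock_Kurzweil_Integration.integral_combine[OF assms(2,3) kint[OF assms(1)]] by (simp add: W_def)
qed

lemma low_cases: "low v \<le> s / v \<or> low v = a"
  by (auto simp: low_def max_def)

lemma W_eq:
  assumes "s / b < v"
  shows "W v = integral {low v..b} (\<lambda>l. (v - s / l) * mp_density a b l)"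
proof -
  note lp = low_props[OF assms]
  have "W v = integral {low v..b} (\<lambda>l. wf_kernel s v l * w l)"
    by (rule W_restrict) (use lp low_cases[of v] in auto)
  also have "\<dots> = integral {low v..b} (\<lambda>l. (v - s / l) * mp_density a b l)"
    using lp by (intro integral_cong) (auto simp: wf_kernel_above mp_density_def mp_weight_def)
  finally show ?thesis .
qed

lemma F_eq: "F v = integral {low v..b} (mp_density a b)"
  unfolding F_def by (intro integral_cong) (simp add: mp_density_def mp_weight_def)

lemma low_antimono: "0 < v \<Longrightarrow> v \<le> v' \<Longrightarrow> low v' \<le> low v"
  unfolding low_def using s by (intro max.mono divide_left_mono) auto

text \<open>Every mode active at \<open>v'\<close> gains at most \<open>v' - v\<close>: a mode
  inactive at \<open>v\<close> has \<open>v - s / l\<close> nonpositive and so starts from 0 instead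
  of a negative value.\<close>

lemma W_diff_le:
  assumes "0 < v" "v \<le> v'" "s / b < v'"
  shows "W v' - W v \<le> (v' - v) * F v'"
proof -
  note lp = low_props[OF assms(3)]
  have le: "s / v' \<le> s / v" using assms s lp by (intro divide_left_mono) auto
  have 1: "W v' = integral {low v'..b} (\<lambda>l. wf_kernel s v' l * w l)"
    by (rule W_restrict) (use lp low_cases[of v'] in auto)
  have 2: "W v = integral {low v'..b} (\<lambda>l. wf_kernel s v l * w l)"
    by (rule W_restrict) (use assms le lp low_cases[of v'] in auto)
  have "W v' - W v = integral {low v'..b} (\<lambda>l. wf_kernel s v' l * w l - wf_kernel s v l * w l)"
    unfolding 1 2 using kint assms lp by (subst Henstock_Kurzweil_Integration.integral_diff) auto
  also have "\<dots> \<le> integral {low v'..b} (\<lambda>l. (v' - v) * (1 / l * w l))"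
  proof (rule integral_le)
    fix l assume l: "l \<in> {low v'..b}"
    have "wf_kernel s v' l - wf_kernel s v l \<le> (v' - v) / l"
    proof (cases "l \<le> s / v")
      case True
      then have "v - s / l \<le> 0" using assms l lp by (auto simp: field_simps)
      then have "(v' - s / l) / l \<le> (v' - v) / l" using l lp by (intro divide_right_mono) auto
      then show ?thesis using True assms l lp by (simp add: wf_kernel_above wf_kernel_below)
    next
      case False
      then show ?thesis using assms l lp by (simp add: wf_kernel_above flip: diff_divide_distrib)
    qed
    then have "(wf_kernel s v' l - wf_kernel s v l) * w l \<le> (v' - v) / l * w l"
      using l lp by (intro mult_right_mono w_nonneg) auto
    then show "wf_kernel s v' l * w l - wf_kernel s v l * w l \<le> (v' - v) * (1 / l * w l)"
      by (simp add: left_diff_distrib)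
  qed (intro integrable_diff kint integrable_on_mult_right rint assms lp)+
  also have "\<dots> = (v' - v) * F v'" by (simp only: F_def integral_mult_right)
  finally show ?thesis .
qed

lemma W_diff_ge:
  assumes "s / b < v" "v \<le> v'"
  shows "(v' - v) * F v \<le> W v' - W v"
proof -
  note lp = low_props[OF assms(1)]
  have b': "s / b < v'" "0 < v'" using assms lp by auto
  have le: "s / v' \<le> s / v" using assms s lp by (intro divide_left_mono) auto
  have "(v' - v) * F v = integral {low v..b} (\<lambda>l. (v' - v) * (1 / l * w l))"
    by (simp only: F_def integral_mult_right)
  also have "\<dots> \<le> integral {low v..b} (\<lambda>l. wf_kernel s v' l * w l - wf_kernel s v l * w l)"
  proof (rule integral_le)
    fix l assume l: "l \<in> {low v..b}"
    then have "wf_kernel s v' l - wf_kernel s v l = (v' - v) / l"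
      using lp b' le by (simp add: wf_kernel_above flip: diff_divide_distrib)
    then show "(v' - v) * (1 / l * w l) \<le> wf_kernel s v' l * w l - wf_kernel s v l * w l"
      by (simp flip: left_diff_distrib)
  qed (intro integrable_diff kint integrable_on_mult_right rint b' lp)+
  also have "\<dots> \<le> integral {a..b} (\<lambda>l. wf_kernel s v' l * w l - wf_kernel s v l * w l)"
  proof (rule integral_subset_le)
    show "\<forall>l\<in>{a..b}. 0 \<le> wf_kernel s v' l * w l - wf_kernel s v l * w l"
    proof
      fix l assume l: "l \<in> {a..b}"
      then have "wf_kernel s v l * w l \<le> wf_kernel s v' l * w l"
        using lp ab assms by (intro mult_right_mono wf_kernel_mono w_nonneg) auto
      then show "0 \<le> wf_kernel s v' l * w l - wf_kernel s v l * w l" by simp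
    qed
  qed (use lp in \<open>auto intro!: integrable_diff kint b'\<close>)
  also have "\<dots> = W v' - W v"
    unfolding W_def using kint b' lp by (subst Henstock_Kurzweil_Integration.integral_diff) auto
  finally show ?thesis .
qed

lemma F_pos:
  assumes "s / b < v"
  shows "0 < F v"
proof -
  note lp = low_props[OF assms]
  have nn: "0 \<le> F v" unfolding F_def
    by (intro integral_nonneg rint lp) (use rw_nonneg lp in blast)
  have c: "continuous_on {low v..b} (\<lambda>l. 1 / l * w l)"
    using lp by (intro continuous_intros w_cont) auto
  have "F v \<noteq> 0"
  proof
    assume "F v = 0"
    then have "\<forall>l\<in>{low v..b}. 1 / l * w l = 0"
      using integral_eq_0_iff[OF c lp(4)] rw_nonneg[OF lp(2,3)] by (simp add: F_def)
    moreover define m where "m = (low v + b) / 2"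
    moreover have m: "low v < m" "m < b" using lp by (simp_all add: m_def)
    ultimately have "w m = 0" using lp by auto
    then show False using lp m by (simp add: mp_weight_def)
  qed
  with nn show ?thesis by simp
qed

lemma W_strict_mono:
  assumes "s / b < v" "v < v'"
  shows "W v < W v'"
  using W_diff_ge[of v v'] F_pos[OF assms(1)] assms mult_pos_pos[of "v' - v" "F v"]
  by linarith

lemma F_mono:
  assumes "s / b < v" "v \<le> v'"
  shows "F v \<le> F v'"
  unfolding F_def using low_props[OF assms(1)] low_props[of v'] assms low_antimono[of v v']
  by (intro integral_subset_le rint ballI rw_nonneg[of "low v'"]) auto

lemma limit_level_iff: "is_limit_water_level s p a b v \<longleftrightarrow> s / b < v \<and> W v = p"
  using W_eq[of v] by (auto simp: is_limit_water_level_def low_def)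

lemma ex1_limit_level: "\<exists>!v. is_limit_water_level s p a b v"
proof -
  define v0 where "v0 = s / b"
  define v1 where "v1 = v0 + 1"
  have v0: "0 < v0" using s b_pos by (simp add: v0_def)
  have F1: "0 < F v1" by (rule F_pos) (simp add: v1_def v0_def)
  \<comment> \<open>From \<open>v1\<close> on the slope is at least \<open>F v1 > 0\<close>, so
    raising the level by \<open>p / F v1\<close> adds at least the power \<open>p\<close>. Together
    with \<open>W v0 = 0\<close> this brackets the solution.\<close>
  define v2 where "v2 = v1 + p / F v1"
  have v2: "v1 \<le> v2" using F1 p by (simp add: v2_def)
  have W0: "W v0 = 0"
    using v0 s b_pos integral_cong[of "{a..b}" "\<lambda>l. wf_kernel s v0 l * w l" "\<lambda>_. 0"]
    by (auto simp: W_def wf_kernel_below v0_def)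
  have W1: "0 \<le> W v1" unfolding W_def
    by (intro integral_nonneg kint mult_nonneg_nonneg w_nonneg)
       (use v0 in \<open>auto simp: v1_def wf_kernel_def\<close>)
  have W2: "p \<le> W v2"
    using W_diff_ge[of v1 v2] v2 W1 F1 by (simp add: v1_def v0_def v2_def)
  have "F v2 \<ge> 0" using F_pos[of v2] v2 by (simp add: v1_def v0_def)
  have lip: "\<bar>W x - W y\<bar> \<le> F v2 * \<bar>x - y\<bar>" if "x \<in> {v0..v2}" "y \<in> {v0..v2}" for x y
  proof -
    have *: "\<bar>W x - W y\<bar> \<le> F v2 * \<bar>x - y\<bar>" if "y < x" "v0 \<le> y" "x \<le> v2" for x y
    proof -
      have xb: "s / b < x" using that by (simp add: v0_def)
      have "W x - W y \<le> (x - y) * F x" using that v0 xb by (intro W_diff_le) auto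
      also have "\<dots> \<le> (x - y) * F v2" using that xb by (intro mult_left_mono F_mono) auto
      finally have "W x - W y \<le> (x - y) * F v2" .
      moreover have "W y \<le> W x"
        unfolding W_def using that v0 ab
        by (intro integral_le kint mult_right_mono wf_kernel_mono w_nonneg) auto
      ultimately show ?thesis using that by (simp add: mult.commute)
    qed
    show ?thesis using *[of y x] *[of x y] that by (cases x y rule: linorder_cases) (auto simp: abs_minus_commute)
  qed
  have "continuous_on {v0..v2} W"
    by (rule lipschitz_on_continuous_on[where L = "F v2"])
       (auto intro!: lipschitz_onI lip \<open>F v2 \<ge> 0\<close> simp: dist_real_def)
  then obtain v where v: "v0 \<le> v" "v \<le> v2" "W v = p"
    using IVT'[of W v0 p v2] W0 W2 p v2 by (auto simp: v1_def)
  then have "v0 \<noteq> v" using W0 p by auto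
  then have "is_limit_water_level s p a b v"
    using v by (simp add: limit_level_iff v0_def)
  then show ?thesis
    using W_strict_mono unfolding limit_level_iff
    by (intro ex1I[of _ v]) (auto simp: limit_level_iff, metis less_irrefl linorder_neqE_linordered_idom)
qed

end

section \<open>Water-filling over finitely many eigenvalues and passage to the limit\<close>

lemma wf_power_diff:
  assumes "v \<le> v'"
  shows "(v' - v) * (if 0 < wf_power s v x then 1 else 0) \<le> wf_power s v' x - wf_power s v x"
    and "wf_power s v' x - wf_power s v x \<le> (v' - v) * (if 0 < wf_power s v' x then 1 else 0)"
  using assms by (auto simp: wf_power_def max_def)

locale mp_water_limit = mp_water_filling a b s p + mp_limit a b ls
  for a b s p :: real and ls :: "nat \<Rightarrow> real list"
begin

definition cnt :: "nat \<Rightarrow> real \<Rightarrow> real" where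
  "cnt t v = real (card {n. n < length (ls t) \<and> 0 < wf_power s v (ls t ! n)}) / real (length (ls t))"

lemma cnt_eq: "cnt t v = list_avg (ls t) (\<lambda>x. if 0 < wf_power s v x then 1 else 0)"
proof -
  have "{n. n < length (ls t) \<and> 0 < wf_power s v (ls t ! n)} = {..<length (ls t)} \<inter> {n. 0 < wf_power s v (ls t ! n)}"
    by auto
  then show ?thesis
    by (simp add: cnt_def list_avg_def sum.If_cases)
qed

definition Wt :: "nat \<Rightarrow> real \<Rightarrow> real" where
  "Wt t v = list_avg (ls t) (wf_power s v)"

lemma Wt_diff:
  assumes "v \<le> v'"
  shows "(v' - v) * cnt t v \<le> Wt t v' - Wt t v" "Wt t v' - Wt t v \<le> (v' - v) * cnt t v'"
  unfolding Wt_def cnt_eq list_avg_linear[symmetric]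
  using wf_power_diff[OF assms] by (auto intro!: list_avg_mono)

lemma cnt_nonneg: "0 \<le> cnt t v"
  by (simp add: cnt_def)

lemma wf_power_mono: "v \<le> v' \<Longrightarrow> wf_power s v x \<le> wf_power s v' x"
  by (auto simp: wf_power_def)

lemma cnt_mono: "v \<le> v' \<Longrightarrow> cnt t v \<le> cnt t v'"
  unfolding cnt_eq using wf_power_mono[of v v'] by (intro list_avg_mono) (auto intro: less_le_trans)

lemma Wt_tendsto:
  assumes "0 < v"
  shows "(\<lambda>t. Wt t v) \<longlonglongrightarrow> W v"
proof -
  have "list_avg (ls t) (\<lambda>x. x * wf_kernel s v x) = Wt t v" for t
    unfolding Wt_def by (intro antisym list_avg_mono) (auto simp: mult_wf_kernel[OF assms] dest: nonneg)
  then show ?thesis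
    using list_avg_tendsto[OF wf_kernel_cont[OF assms], of "v / (s / v)"] wf_kernel_bound[OF assms]
    by (simp add: W_def)
qed

text \<open>The definite description needs uniqueness: where the average power equals
  \<open>p > 0\<close>, some mode is active, so the power increases strictly to the right of that
  level.\<close>

lemma water_level_eqI:
  assumes "Wt t v = p"
  shows "water_level s p (ls t) = v"
proof -
  have ne: "ls t \<noteq> []" using assms p by (auto simp: Wt_def list_avg_def)
  have iff: "(\<Sum>n<length (ls t). wf_power s u (ls t ! n)) = real (length (ls t)) * p \<longleftrightarrow> Wt t u = p" for u
    using ne by (simp add: Wt_def list_avg_def field_simps)
  have str: "Wt t x < Wt t y" if "Wt t x = p" "x < y" for x y
  proof -
    have "cnt t x \<noteq> 0"
    proof
      assume "cnt t x = 0"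
      then have "{n. n < length (ls t) \<and> 0 < wf_power s x (ls t ! n)} = {}" using ne by (simp add: cnt_def)
      then have "wf_power s x (ls t ! n) \<le> 0" if "n < length (ls t)" for n using that by force
      then have "Wt t x \<le> 0" unfolding Wt_def list_avg_def by (intro divide_nonpos_nonneg sum_nonpos) auto
      then show False using that p by simp
    qed
    then have "0 < (y - x) * cnt t x" using cnt_nonneg[of t x] that by (intro mult_pos_pos) auto
    then show ?thesis using Wt_diff(1)[of x y t] that by simp
  qed
  show ?thesis
    unfolding water_level_def iff
  proof (rule the_equality)
    fix u assume "Wt t u = p"
    then show "u = v" using str[of u v] str[of v u] assms by (cases u v rule: linorder_cases) auto
  qed (rule assms)
qed

lemma Wt_cont: "continuous_on A (Wt t)"
proof -
  have "continuous_on A (\<lambda>v. wf_power s v x)" for x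
    by (cases "x = 0") (auto simp: wf_power_def intro!: continuous_intros)
  then show ?thesis
    unfolding Wt_def list_avg_def by (cases "ls t = []") (auto intro!: continuous_intros)
qed

lemma F_cont:
  assumes "s / b < v"
  shows "isCont F v"
proof -
  define u where "u = (s / b + v) / 2"
  have u: "s / b < u" "u < v"
    using less_half_sum[OF assms] gt_half_sum[OF assms] by (simp_all add: u_def)
  note lp = low_props[OF u(1)]
  have u': "s / b < v + 1" using assms by simp
  have J: "continuous_on {low (v + 1)..b} (\<lambda>c. integral {c..b} (\<lambda>l. 1 / l * w l))"
    by (intro indefinite_integral_continuous_1' rint low_props(2)[OF u'])
  have "continuous_on {u..v + 1} low"
    unfolding low_def using lp(1) by (intro continuous_intros) auto
  then have "continuous_on {u..v + 1} F"
    unfolding F_def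
  proof (rule continuous_on_compose2[OF J])
    show "low ` {u..v + 1} \<subseteq> {low (v + 1)..b}"
    proof safe
      fix x assume x: "x \<in> {u..v + 1}"
      then have "s / b < x" using u by simp
      from low_props[OF this] low_antimono[of x "v + 1"] x show "low x \<in> {low (v + 1)..b}" by auto
    qed
  qed
  then show ?thesis
    by (rule continuous_on_interior) (use u in \<open>simp add: interior_atLeastAtMost_real\<close>)
qed

text \<open>Strict monotonicity of \<open>W\<close> traps the water level between
  \<open>v - r\<close> and \<open>v + r\<close>. By convexity the count there lies between the
  difference quotients of \<open>Wt\<close> over the adjacent intervals of length \<open>r\<close>;
  these converge, and their limits are compared with \<open>F (v - 2 * r)\<close> and
  \<open>F (v + 2 * r)\<close>, both close to \<open>F v\<close>.\<close>

lemma cnt_water_level_tendsto: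
  assumes "is_limit_water_level s p a b v"
  shows "(\<lambda>t. cnt t (water_level s p (ls t))) \<longlonglongrightarrow> F v"
proof (rule LIMSEQ_I)
  fix e :: real assume e: "0 < e"
  have v: "s / b < v" "W v = p" using assms by (auto simp: limit_level_iff)
  have bp: "0 < s / b" using s b_pos by simp
  obtain d where d: "0 < d" "\<And>x. \<bar>x - v\<bar> < d \<Longrightarrow> \<bar>F x - F v\<bar> < e / 2"
    using F_cont[OF v(1)] e unfolding isCont_def LIM_eq by (metis half_gt_zero real_norm_def diff_self abs_zero)
  define r where "r = min d (v - s / b) / 4"
  have "0 < min d (v - s / b)" using d(1) v(1) by simp
  then have r: "0 < r" "4 * r \<le> d" "4 * r \<le> v - s / b" by (simp_all add: r_def)
  then have r: "0 < r" "2 * r < d" "s / b < v - 2 * r" by simp_all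
  have W1: "W (v - r) < p" and W2: "p < W (v + r)"
    using W_strict_mono[of "v - r" v] W_strict_mono[of v "v + r"] v r by auto
  have up: "(\<lambda>t. (Wt t (v + 2 * r) - Wt t (v + r)) / r) \<longlonglongrightarrow> (W (v + 2 * r) - W (v + r)) / r"
    using r bp by (intro tendsto_intros Wt_tendsto) auto
  have dn: "(\<lambda>t. (Wt t (v - r) - Wt t (v - 2 * r)) / r) \<longlonglongrightarrow> (W (v - r) - W (v - 2 * r)) / r"
    using r bp by (intro tendsto_intros Wt_tendsto) auto
  have "W (v + 2 * r) - W (v + r) \<le> r * F (v + 2 * r)"
    using W_diff_le[of "v + r" "v + 2 * r"] r bp by auto
  then have "(W (v + 2 * r) - W (v + r)) / r \<le> F (v + 2 * r)" using r by (simp add: field_simps)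
  moreover have "F (v + 2 * r) < F v + e / 2" using d(2)[of "v + 2 * r"] r by linarith
  ultimately have ev_up: "\<forall>\<^sub>F t in sequentially. (Wt t (v + 2 * r) - Wt t (v + r)) / r < F v + e / 2"
    by (intro order_tendstoD(2)[OF up]) auto
  have "r * F (v - 2 * r) \<le> W (v - r) - W (v - 2 * r)"
    using W_diff_ge[of "v - 2 * r" "v - r"] r bp by auto
  then have "F (v - 2 * r) \<le> (W (v - r) - W (v - 2 * r)) / r" using r by (simp add: field_simps)
  moreover have "F v - e / 2 < F (v - 2 * r)" using d(2)[of "v - 2 * r"] r by linarith
  ultimately have ev_dn: "\<forall>\<^sub>F t in sequentially. F v - e / 2 < (Wt t (v - r) - Wt t (v - 2 * r)) / r"
    by (intro order_tendstoD(1)[OF dn]) auto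
  have "\<forall>\<^sub>F t in sequentially. Wt t (v - r) < p"
    by (rule order_tendstoD(2)[OF Wt_tendsto W1]) (use r bp in auto)
  moreover have "\<forall>\<^sub>F t in sequentially. p < Wt t (v + r)"
    by (rule order_tendstoD(1)[OF Wt_tendsto W2]) (use r bp in auto)
  ultimately have "\<forall>\<^sub>F t in sequentially. norm (cnt t (water_level s p (ls t)) - F v) < e"
    using ev_up ev_dn
  proof eventually_elim
    case (elim t)
    obtain x where x: "v - r \<le> x" "x \<le> v + r" "Wt t x = p"
      using IVT'[of "Wt t" "v - r" p "v + r"] elim r Wt_cont by auto
    have "cnt t x \<le> cnt t (v + r)" using x by (intro cnt_mono) auto
    also have "\<dots> \<le> (Wt t (v + 2 * r) - Wt t (v + r)) / r"
      using Wt_diff(1)[of "v + r" "v + 2 * r" t] r by (simp add: field_simps)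
    finally have 1: "cnt t x < F v + e / 2" using elim by simp
    have "(Wt t (v - r) - Wt t (v - 2 * r)) / r \<le> cnt t (v - r)"
      using Wt_diff(2)[of "v - 2 * r" "v - r" t] r by (simp add: field_simps)
    also have "\<dots> \<le> cnt t x" using x by (intro cnt_mono) auto
    finally have 2: "F v - e / 2 < cnt t x" using elim by simp
    show ?case using 1 2 e unfolding water_level_eqI[OF x(3)] by auto
  qed
  then show "\<exists>no. \<forall>t\<ge>no. norm (cnt t (water_level s p (ls t)) - F v) < e"
    by (simp add: eventually_sequentially)
qed

end

subsection \<open>Generic position of a Gaussian matrix\<close>

inductive polyfun :: "'e set \<Rightarrow> (('e \<Rightarrow> complex) \<Rightarrow> complex) \<Rightarrow> bool" for I where
  const: "polyfun I (\<lambda>_. c)"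
| coord: "e \<in> I \<Longrightarrow> polyfun I (\<lambda>x. x e)"
| add: "polyfun I f \<Longrightarrow> polyfun I g \<Longrightarrow> polyfun I (\<lambda>x. f x + g x)"
| mult: "polyfun I f \<Longrightarrow> polyfun I g \<Longrightarrow> polyfun I (\<lambda>x. f x * g x)"

lemma polyfun_sum: "(\<And>i. i \<in> A \<Longrightarrow> polyfun I (f i)) \<Longrightarrow> polyfun I (\<lambda>x. \<Sum>i\<in>A. f i x)"
  by (induction A rule: infinite_finite_induct) (auto intro: polyfun.intros)

lemma polyfun_prod: "(\<And>i. i \<in> A \<Longrightarrow> polyfun I (f i)) \<Longrightarrow> polyfun I (\<lambda>x. \<Prod>i\<in>A. f i x)"
  by (induction A rule: infinite_finite_induct) (auto intro: polyfun.intros)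

lemma det_mat_expand:
  "det (mat r r f) = (\<Sum>p\<in>{p. p permutes {0..<r}}. signof p * (\<Prod>i=0..<r. f (i, p i)))"
proof -
  have "det (mat r r f) = (\<Sum>p\<in>{p. p permutes {0..<r}}. signof p * (\<Prod>i=0..<r. mat r r f $$ (i, p i)))"
    by (simp add: det_def)
  also have "\<dots> = (\<Sum>p\<in>{p. p permutes {0..<r}}. signof p * (\<Prod>i=0..<r. f (i, p i)))"
    by (intro sum.cong refl arg_cong2[of _ _ _ _ "(*)"] prod.cong)
       (auto dest: permutes_in_image[THEN iffD2])
  finally show ?thesis .
qed

lemma polyfun_det:
  assumes "\<And>i j. i < r \<Longrightarrow> j < r \<Longrightarrow> polyfun I (\<lambda>x. f x (i, j))"
  shows "polyfun I (\<lambda>x. det (mat r r (f x)))"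
  unfolding det_mat_expand
  by (intro polyfun_sum polyfun.mult polyfun.const polyfun_prod assms)
     (auto dest: permutes_in_image[THEN iffD2])

lemma measurable_det:
  assumes "\<And>i j. i < r \<Longrightarrow> j < r \<Longrightarrow> (\<lambda>x. f x (i, j)) \<in> borel_measurable M"
  shows "(\<lambda>x. det (mat r r (f x) :: complex mat)) \<in> borel_measurable M"
  unfolding det_mat_expand
  by (intro borel_measurable_sum borel_measurable_times borel_measurable_const borel_measurable_prod assms)
     (auto dest: permutes_in_image[THEN iffD2])

lemma polyfun_measurable:
  assumes "polyfun I f"
  shows "f \<in> borel_measurable (PiM I (\<lambda>_. borel))"
  using assms by (induction rule: polyfun.induct) (auto intro!: measurable_component_singleton)

lemma polyfun_fix_coord:
  assumes "polyfun (insert i I) f"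
  shows "polyfun I (\<lambda>x. f (x(i := c)))"
  using assms
proof (induction rule: polyfun.induct)
  case (coord e)
  then show ?case by (cases "e = i") (auto intro: polyfun.intros)
qed (auto intro: polyfun.intros)

lemma polyfun_slice:
  assumes "polyfun I f"
  shows "\<exists>q. \<forall>t. f (x(i := t)) = poly q t"
  using assms
proof (induction rule: polyfun.induct)
  case (const c)
  show ?case by (rule exI[of _ "[:c:]"]) simp
next
  case (coord e)
  show ?case
    by (cases "e = i", rule exI[of _ "[:0, 1:]"], simp, rule exI[of _ "[:x e:]"], simp)
next
  case (add f g)
  then show ?case by (metis poly_add)
next
  case (mult f g)
  then show ?case by (metis poly_mult)
qed

lemma polyfun_restrict:
  assumes "polyfun I f"
  shows "f (restrict x I) = f x"
  using assms by (induction rule: polyfun.induct) auto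

text \<open>Induction on the variables. With the new coordinate frozen at \<open>x0 i\<close>, the
  induction hypothesis makes almost every slice a nonzero polynomial in one variable; its finitely
  many roots are null, and Fubini concludes.\<close>

lemma AE_polyfun_nonzero:
  assumes I: "finite I"
    and M: "\<And>i. prob_space (M i)" "\<And>i. sets (M i) = sets borel" "\<And>i c. emeasure (M i) {c} = 0"
    and f: "polyfun I f" "f x0 \<noteq> 0"
  shows "AE x in PiM I M. f x \<noteq> 0"
  using I f
proof (induction I arbitrary: f rule: finite_induct)
  case empty
  have "f x = f x0" for x
    using polyfun_restrict[OF empty(1), of x] polyfun_restrict[OF empty(1), of x0] by simp
  then have "f x \<noteq> 0" for x using empty(2) by metis
  then show ?case by simp
next
  case (insert i I)
  interpret product_prob_space M by (rule product_prob_spaceI) (rule M)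
  interpret Mi: prob_space "M i" by (rule M)
  let ?S = "{x \<in> space (PiM (insert i I) M). f x = 0}"
  have meas: "f \<in> borel_measurable (PiM (insert i I) M)"
    using polyfun_measurable[OF insert.prems(1)] M(2) by (simp cong: measurable_cong_sets sets_PiM_cong)
  have S: "?S \<in> sets (PiM (insert i I) M)"
    using meas by measurable
  have fin0: "emeasure (M i) A = 0" if "finite A" for A
    using that
  proof (induction A rule: finite_induct)
    case (insert c A)
    have "emeasure (M i) (insert c A) \<le> emeasure (M i) {c} + emeasure (M i) A"
      using emeasure_subadditive[of "{c}" "M i" A] insert M(2) by (simp add: finite_imp_closed)
    then show ?case using insert M(3) by simp
  qed simp
  have "emeasure (PiM (insert i I) M) ?S = (\<integral>\<^sup>+x. indicator ?S x \<partial>PiM (insert i I) M)"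
    using S by simp
  also have "\<dots> = (\<integral>\<^sup>+x. (\<integral>\<^sup>+y. indicator ?S (x(i := y)) \<partial>M i) \<partial>PiM I M)"
    by (rule product_nn_integral_insert[OF insert.hyps]) (use S in measurable)
  also have "\<dots> = (\<integral>\<^sup>+x. 0 \<partial>PiM I M)"
  proof (rule nn_integral_cong_AE)
    have "AE x in PiM I M. f (x(i := x0 i)) \<noteq> 0"
      by (rule insert.IH[OF polyfun_fix_coord[OF insert.prems(1)]]) (use insert.prems in \<open>simp add: fun_upd_idem\<close>)
    then show "AE x in PiM I M. (\<integral>\<^sup>+y. indicator ?S (x(i := y)) \<partial>M i) = 0"
    proof (rule eventually_mono)
      fix x assume x: "f (x(i := x0 i)) \<noteq> 0"
      obtain q where q: "\<And>t. f (x(i := t)) = poly q t"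
        using polyfun_slice[OF insert.prems(1)] by blast
      then have "q \<noteq> 0" using x by auto
      then have fin: "finite {t. poly q t = 0}" by (rule poly_roots_finite)
      have "(\<integral>\<^sup>+y. indicator ?S (x(i := y)) \<partial>M i) \<le> (\<integral>\<^sup>+y. indicator {t. poly q t = 0} y \<partial>M i)"
        by (intro nn_integral_mono) (auto simp: indicator_def q)
      also have "\<dots> = emeasure (M i) {t. poly q t = 0}"
        using fin M(2) by (intro nn_integral_indicator) (simp add: finite_imp_closed)
      finally show "(\<integral>\<^sup>+y. indicator ?S (x(i := y)) \<partial>M i) = 0" using fin0[OF fin] by simp
    qed
  qed
  finally have "emeasure (PiM (insert i I) M) ?S = 0" by simp
  then show ?case
    using S by (intro AE_I[of _ _ ?S]) auto
qed

lemma emeasure_circ_sym_gaussian_singleton: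
  assumes "prob_space P" "circ_sym_gaussian P v Z" "Z \<in> borel_measurable P"
  shows "emeasure (distr P borel Z) {c} = 0"
proof -
  have X: "distributed P lborel (\<lambda>w. Re (Z w)) (normal_density 0 (sqrt (v / 2)))"
    using assms(2) by (simp add: circ_sym_gaussian_def)
  have "emeasure (distr P borel Z) {c} = emeasure P (Z -` {c} \<inter> space P)"
    using assms(3) by (simp add: emeasure_distr)
  also have "\<dots> \<le> emeasure P ((\<lambda>w. Re (Z w)) -` {Re c} \<inter> space P)"
    using distributed_measurable[OF X] by (intro emeasure_mono) auto
  also have "\<dots> = (\<integral>\<^sup>+x. ennreal (normal_density 0 (sqrt (v / 2)) x) * indicator {Re c} x \<partial>lborel)"
    by (rule distributed_emeasure[OF X]) simp
  also have "\<dots> = 0"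
    by (subst nn_integral_0_iff_AE) (auto intro!: AE_I[of _ _ "{Re c}"] simp: indicator_def)
  finally show ?thesis by simp
qed

section \<open>Orthogonal projections and their compressions\<close>

lemma det_mat_eq_0_iff:
  fixes f :: "nat \<times> nat \<Rightarrow> complex"
  shows "det (mat r r f) = 0 \<longleftrightarrow> (\<exists>x. (\<exists>i<r. x i \<noteq> 0) \<and> (\<forall>i<r. (\<Sum>j<r. f (i, j) * x j) = 0))"
proof -
  have mv: "(mat r r f *\<^sub>v v) $ i = (\<Sum>j<r. f (i, j) * v $ j)" if "i < r" "v \<in> carrier_vec r" for i v
    using that by (simp add: scalar_prod_def atLeast0LessThan)
  have "det (mat r r f) = 0 \<longleftrightarrow> (\<exists>v\<in>carrier_vec r. v \<noteq> 0\<^sub>v r \<and> mat r r f *\<^sub>v v = 0\<^sub>v r)"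
    by (subst det_0_iff_vec_prod_zero_field[of _ r]) auto
  also have "\<dots> \<longleftrightarrow> (\<exists>x. (\<exists>i<r. x i \<noteq> 0) \<and> (\<forall>i<r. (\<Sum>j<r. f (i, j) * x j) = 0))"
  proof safe
    fix v assume v: "v \<in> carrier_vec r" "v \<noteq> 0\<^sub>v r" "mat r r f *\<^sub>v v = 0\<^sub>v r"
    have "(\<exists>i<r. v $ i \<noteq> 0)" using v(1,2) by (auto simp: vec_eq_iff)
    moreover have "\<forall>i<r. (\<Sum>j<r. f (i, j) * v $ j) = 0" using mv[OF _ v(1)] v(3) by (metis index_zero_vec(1))
    ultimately show "\<exists>x. (\<exists>i<r. x i \<noteq> 0) \<and> (\<forall>i<r. (\<Sum>j<r. f (i, j) * x j) = 0)"
      by (intro exI[of _ "\<lambda>i. v $ i"]) auto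
  next
    fix x i assume x: "\<forall>i<r. (\<Sum>j<r. f (i, j) * x j) = 0" "i < r" "x i \<noteq> 0"
    have "vec r x \<noteq> 0\<^sub>v r" using x(2,3) by (auto simp: vec_eq_iff)
    moreover have "mat r r f *\<^sub>v vec r x = 0\<^sub>v r"
      using x(1) mv[of _ "vec r x"] by (intro eq_vecI) auto
    ultimately show "\<exists>v\<in>carrier_vec r. v \<noteq> 0\<^sub>v r \<and> mat r r f *\<^sub>v v = 0\<^sub>v r"
      by (intro bexI[of _ "vec r x"]) auto
  qed
  finally show ?thesis .
qed

text \<open>A Hermitian idempotent has rank equal to its trace. Asking for rank at least
  \<open>r\<close> through the trace keeps the predicate measurable in the entries of
  \<open>A\<close>.\<close>

definition is_proj :: "nat \<Rightarrow> nat \<Rightarrow> (nat \<Rightarrow> nat \<Rightarrow> complex) \<Rightarrow> bool" where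
  "is_proj n r A \<longleftrightarrow> (\<forall>u<n. \<forall>v<n. cnj (A u v) = A v u) \<and>
     (\<forall>u<n. \<forall>v<n. (\<Sum>x<n. A u x * A x v) = A u v) \<and> real r \<le> Re (\<Sum>u<n. A u u)"

text \<open>The determinant of Y_r^* A Y_r, where Y_r consists of the first \<open>r\<close> columns
  of Y. Unlike a minor of U^* Y it depends on the projection alone and not on a basis of its
  range.\<close>

definition compress_det :: "nat \<Rightarrow> nat \<Rightarrow> (nat \<Rightarrow> nat \<Rightarrow> complex) \<Rightarrow> (nat \<times> nat \<Rightarrow> complex) \<Rightarrow> complex" where
  "compress_det n r A y = det (mat r r (\<lambda>(i, j). \<Sum>u<n. \<Sum>v<n. cnj (y (u, i)) * A u v * y (v, j)))"

lemma sum_cnj_mult_self_eq_0: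
  fixes f :: "nat \<Rightarrow> complex"
  assumes "(\<Sum>i<n. cnj (f i) * f i) = 0" "i < n"
  shows "f i = 0"
proof -
  have "(\<Sum>i<n. cnj (f i) * f i) = of_real (\<Sum>i<n. (norm (f i))\<^sup>2)"
    by (simp add: complex_norm_square mult.commute del: of_real_power)
  then have "complex_of_real (\<Sum>i<n. (norm (f i))\<^sup>2) = 0" using assms(1) by (rule trans[OF sym])
  then have "(\<Sum>i<n. (norm (f i))\<^sup>2) = 0" by (simp only: of_real_eq_0_iff)
  then show ?thesis using assms(2) by (subst (asm) sum_nonneg_eq_0_iff) auto
qed

text \<open>Orthonormal vectors in the range are found one by one. Subtracting from \<open>A\<close>
  the projection onto those already found leaves \<open>Q\<close> with positive trace, hence a
  nonzero diagonal entry \<open>Q u0 u0\<close>; column \<open>u0\<close> of \<open>Q\<close> is the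
  next direction.\<close>

lemma is_proj_frame:
  assumes "is_proj n r A"
  shows "\<exists>V. (\<forall>i<r. \<forall>j<r. (\<Sum>u<n. cnj (V u i) * V u j) = (if i = j then 1 else 0)) \<and>
    (\<forall>u<n. \<forall>i<r. (\<Sum>v<n. A u v * V v i) = V u i)"
  using assms
proof (induction r)
  case 0
  show ?case by simp
next
  case (Suc r)
  from Suc.prems have "is_proj n r A" by (auto simp: is_proj_def)
  from Suc.IH[OF this] obtain V where
    V: "\<And>i j. i < r \<Longrightarrow> j < r \<Longrightarrow> (\<Sum>u<n. cnj (V u i) * V u j) = (if i = j then 1 else 0)"
    and AV: "\<And>u i. u < n \<Longrightarrow> i < r \<Longrightarrow> (\<Sum>v<n. A u v * V v i) = V u i" by blast
  have herm: "\<And>u v. u < n \<Longrightarrow> v < n \<Longrightarrow> cnj (A u v) = A v u"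
    and idem: "\<And>u v. u < n \<Longrightarrow> v < n \<Longrightarrow> (\<Sum>x<n. A u x * A x v) = A u v"
    and tr: "real (Suc r) \<le> Re (\<Sum>u<n. A u u)"
    using Suc.prems by (auto simp: is_proj_def)
  define Q where "Q u v = A u v - (\<Sum>i<r. V u i * cnj (V v i))" for u v
  have "(\<Sum>u<n. \<Sum>i<r. V u i * cnj (V u i)) = (\<Sum>i<r. (\<Sum>u<n. cnj (V u i) * V u i))"
    by (subst sum.swap) (simp add: mult.commute)
  also have "\<dots> = of_nat r" by (simp add: V)
  finally have "(\<Sum>u<n. Q u u) = (\<Sum>u<n. A u u) - of_nat r"
    by (simp add: Q_def sum_subtractf)
  then have "Re (\<Sum>u<n. Q u u) > 0" using tr by simp
  then obtain u0 where u0: "u0 < n" "Q u0 u0 \<noteq> 0"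
    by (metis (no_types, lifting) lessThan_iff less_irrefl sum.neutral zero_complex.simps(1))
  define y where "y v = Q v u0" for v
  have Ay: "(\<Sum>v<n. A u v * y v) = y u" if "u < n" for u
  proof -
    have "(\<Sum>v<n. A u v * y v) = (\<Sum>v<n. A u v * A v u0) - (\<Sum>v<n. \<Sum>i<r. A u v * V v i * cnj (V u0 i))"
      by (simp add: y_def Q_def right_diff_distrib sum_subtractf sum_distrib_left mult.assoc)
    also have "(\<Sum>v<n. \<Sum>i<r. A u v * V v i * cnj (V u0 i)) = (\<Sum>i<r. V u i * cnj (V u0 i))"
      by (subst sum.swap) (simp add: sum_distrib_right[symmetric] AV that)
    finally show ?thesis using idem[OF that u0(1)] by (simp add: y_def Q_def)
  qed
  have orth: "(\<Sum>v<n. cnj (V v i) * y v) = 0" if "i < r" for i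
  proof -
    have "(\<Sum>v<n. cnj (V v i) * y v) = (\<Sum>v<n. cnj (V v i) * A v u0) - (\<Sum>v<n. \<Sum>j<r. cnj (V v i) * V v j * cnj (V u0 j))"
      by (simp add: y_def Q_def right_diff_distrib sum_subtractf sum_distrib_left mult.assoc)
    also have "(\<Sum>v<n. \<Sum>j<r. cnj (V v i) * V v j * cnj (V u0 j)) = (\<Sum>j<r. (if i = j then 1 else 0) * cnj (V u0 j))"
      by (subst sum.swap) (simp add: sum_distrib_right[symmetric] V that)
    also have "\<dots> = cnj (V u0 i)" using that by (simp add: if_distrib[of "\<lambda>t. t * _"] sum.delta' cong: if_cong)
    also have "(\<Sum>v<n. cnj (V v i) * A v u0) = cnj (\<Sum>v<n. A u0 v * V v i)"
      using u0 by (simp add: herm mult.commute)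
    also have "\<dots> = cnj (V u0 i)" by (simp only: AV[OF u0(1) that])
    finally show ?thesis by simp
  qed
  define s where "s = (\<Sum>v<n. (norm (y v))\<^sup>2)"
  have ss: "(\<Sum>v<n. cnj (y v) * y v) = of_real s"
    by (simp add: s_def complex_norm_square mult.commute del: of_real_power)
  have s0: "0 < s"
  proof -
    have "s \<noteq> 0"
      using sum_cnj_mult_self_eq_0[where f = y and n = n and i = u0] u0 ss by (auto simp: y_def)
    moreover have "0 \<le> s" by (simp add: s_def sum_nonneg)
    ultimately show ?thesis by simp
  qed
  define V' where "V' u i = (if i = r then y u / of_real (sqrt s) else V u i)" for u i
  have s2: "complex_of_real (sqrt s) * complex_of_real (sqrt s) = of_real s"
    using s0 by (simp flip: of_real_mult)
  have "(\<Sum>u<n. cnj (V' u i) * V' u j) = (if i = j then 1 else 0)" if ij: "i < Suc r" "j < Suc r" for i j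
  proof -
    consider "i = r" "j = r" | "i = r" "j < r" | "i < r" "j = r" | "i < r" "j < r"
      using ij by (auto simp: less_Suc_eq)
    then show ?thesis
    proof cases
      case 1
      then show ?thesis
        using ss s0 s2 by (simp add: V'_def sum_divide_distrib[symmetric])
    next
      case 2
      have "(\<Sum>v<n. cnj (y v) * V v j) = cnj (\<Sum>v<n. cnj (V v j) * y v)"
        by (simp add: mult.commute)
      then have "(\<Sum>v<n. cnj (y v) * V v j) = 0" by (simp only: orth[OF 2(2)] complex_cnj_zero)
      then show ?thesis using 2 by (simp add: V'_def sum_divide_distrib[symmetric])
    next
      case 3
      then show ?thesis using orth[OF 3(1)] by (simp add: V'_def sum_divide_distrib[symmetric])
    next
      case 4
      then show ?thesis using V by (simp add: V'_def)
    qed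
  qed
  moreover have "(\<Sum>v<n. A u v * V' v i) = V' u i" if "u < n" "i < Suc r" for u i
    using that AV Ay by (cases "i = r") (auto simp: V'_def sum_divide_distrib[symmetric])
  ultimately show ?case by (intro exI[of _ V'] conjI allI impI)
qed

text \<open>\<open>compress_det\<close> involves conjugates of \<open>y\<close> and is not a
  \<open>polyfun\<close>. It is replaced by \<open>f\<close>, the determinant of V^* Y_r for an
  orthonormal frame V in the range of \<open>A\<close>: \<open>f\<close> is polynomial and equals 1
  at V. A null vector x of the compression makes the squared norm of A Y_r x vanish, so V^* Y_r x =
  0 and \<open>f y = 0\<close>.\<close>

lemma AE_compress_det_nonzero:
  assumes D: "\<And>i. prob_space (D i)" "\<And>i. sets (D i) = sets borel" "\<And>i c. emeasure (D i) {c} = 0"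
    and A: "is_proj n r A" and r: "r \<le> l"
  shows "AE y in PiM ({..<n} \<times> {..<l}) D. compress_det n r A y \<noteq> 0"
proof -
  obtain V where
    V: "\<And>i j. i < r \<Longrightarrow> j < r \<Longrightarrow> (\<Sum>u<n. cnj (V u i) * V u j) = (if i = j then 1 else 0)"
    and AV: "\<And>u i. u < n \<Longrightarrow> i < r \<Longrightarrow> (\<Sum>v<n. A u v * V v i) = V u i"
    using is_proj_frame[OF A] by blast
  have herm: "\<And>u v. u < n \<Longrightarrow> v < n \<Longrightarrow> cnj (A u v) = A v u"
    and idem: "\<And>u v. u < n \<Longrightarrow> v < n \<Longrightarrow> (\<Sum>x<n. A u x * A x v) = A u v"
    using A by (auto simp: is_proj_def)
  define f where "f y = det (mat r r (\<lambda>(i, j). \<Sum>u<n. cnj (V u i) * y (u, j)))" for y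
  have "polyfun ({..<n} \<times> {..<l}) f"
    unfolding f_def by (rule polyfun_det) (use r in \<open>auto intro!: polyfun_sum polyfun.intros\<close>)
  moreover have "mat r r (\<lambda>(i, j). \<Sum>u<n. cnj (V u i) * (\<lambda>(u, j). V u j) (u, j)) = 1\<^sub>m r"
    by (rule eq_matI) (auto simp: V)
  then have "f (\<lambda>(u, j). V u j) \<noteq> 0" by (simp add: f_def)
  ultimately have "AE y in PiM ({..<n} \<times> {..<l}) D. f y \<noteq> 0"
    by (intro AE_polyfun_nonzero D) auto
  then show ?thesis
  proof (rule eventually_mono)
    fix y assume f: "f y \<noteq> 0"
    show "compress_det n r A y \<noteq> 0"
    proof
      assume "compress_det n r A y = 0"
      then obtain x i where x: "i < r" "x i \<noteq> 0"
        "\<And>i. i < r \<Longrightarrow> (\<Sum>j<r. (\<Sum>u<n. \<Sum>v<n. cnj (y (u, i)) * A u v * y (v, j)) * x j) = 0"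
        unfolding compress_det_def det_mat_eq_0_iff by auto
      define b where "b u = (\<Sum>j<r. y (u, j) * x j)" for u
      define c where "c u = (\<Sum>v<n. A u v * b v)" for u
      have "(\<Sum>u<n. cnj (b u) * c u) = (\<Sum>i<r. cnj (x i) * (\<Sum>j<r. (\<Sum>u<n. \<Sum>v<n. cnj (y (u, i)) * A u v * y (v, j)) * x j))"
      proof -
        have "(\<Sum>u<n. cnj (b u) * c u) = (\<Sum>u<n. \<Sum>i<r. \<Sum>v<n. \<Sum>j<r. cnj (x i) * (cnj (y (u, i)) * A u v * y (v, j) * x j))"
          unfolding b_def c_def cnj_sum sum_distrib_right
          unfolding sum_distrib_left by (intro sum.cong refl) (simp add: mult_ac)
        also have "\<dots> = (\<Sum>i<r. \<Sum>u<n. \<Sum>j<r. \<Sum>v<n. cnj (x i) * (cnj (y (u, i)) * A u v * y (v, j) * x j))"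
          by (subst sum.swap) (intro sum.cong refl sum.swap)
        also have "\<dots> = (\<Sum>i<r. \<Sum>j<r. \<Sum>u<n. \<Sum>v<n. cnj (x i) * (cnj (y (u, i)) * A u v * y (v, j) * x j))"
          by (intro sum.cong refl sum.swap)
        finally show ?thesis by (simp add: sum_distrib_left sum_distrib_right)
      qed
      also have "\<dots> = 0" using x(3) by simp
      finally have bc: "(\<Sum>u<n. cnj (b u) * c u) = 0" .
      have Ac: "(\<Sum>u<n. A v u * c u) = c v" if "v < n" for v
      proof -
        have "(\<Sum>u<n. A v u * c u) = (\<Sum>w<n. (\<Sum>u<n. A v u * A u w) * b w)"
          unfolding c_def sum_distrib_left sum_distrib_right by (subst sum.swap) (simp add: mult.assoc)
        then show ?thesis using idem that by (simp add: c_def)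
      qed
      have "(\<Sum>u<n. cnj (c u) * c u) = (\<Sum>u<n. \<Sum>v<n. cnj (A u v * b v) * c u)"
        by (simp add: c_def sum_distrib_right)
      also have "\<dots> = (\<Sum>v<n. cnj (b v) * (\<Sum>u<n. A v u * c u))"
        by (subst sum.swap) (simp add: herm sum_distrib_left mult_ac)
      also have "\<dots> = 0" using Ac bc by simp
      finally have c0: "c u = 0" if "u < n" for u using sum_cnj_mult_self_eq_0 that by blast
      have "(\<Sum>j<r. (\<Sum>u<n. cnj (V u i) * y (u, j)) * x j) = 0" if "i < r" for i
      proof -
        have "(\<Sum>j<r. (\<Sum>u<n. cnj (V u i) * y (u, j)) * x j) = (\<Sum>u<n. cnj (V u i) * b u)"
          unfolding b_def sum_distrib_left sum_distrib_right by (subst sum.swap) (simp add: mult.assoc)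
        also have "\<dots> = (\<Sum>u<n. cnj (\<Sum>v<n. A u v * V v i) * b u)"
          using AV that by (intro sum.cong refl) simp
        also have "\<dots> = (\<Sum>u<n. \<Sum>v<n. cnj (V v i) * (A v u * b u))"
          by (simp add: herm sum_distrib_left sum_distrib_right mult_ac)
        also have "\<dots> = (\<Sum>v<n. cnj (V v i) * c v)"
          by (subst sum.swap) (simp add: c_def sum_distrib_left)
        finally show ?thesis using c0 by simp
      qed
      then have "f y = 0" unfolding f_def det_mat_eq_0_iff using x(1,2) by auto
      with f show False by simp
    qed
  qed
qed

section \<open>Spectral projections as measurable limits of polynomials in G\<close>

definition plim :: "(nat \<Rightarrow> real poly) \<Rightarrow> nat \<Rightarrow> nat \<Rightarrow> (nat \<times> nat \<Rightarrow> complex) \<Rightarrow> nat \<Rightarrow> nat \<Rightarrow> complex" where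
  "plim p n m z u v = lim (\<lambda>k. \<Sum>j\<le>degree (p k). of_real (coeff (p k) j) * gpow n m z j u v)"

lemma gpow_restrict:
  assumes "u < n" "v < n"
  shows "gpow n m (restrict z ({..<n} \<times> {..<m})) k u v = gpow n m z k u v"
  using assms by (induction k arbitrary: v) (auto simp: gram_def intro!: sum.cong)

lemma plim_restrict:
  assumes "u < n" "v < n"
  shows "plim p n m (restrict z ({..<n} \<times> {..<m})) u v = plim p n m z u v"
  using assms by (simp add: plim_def gpow_restrict)

lemma is_proj_cong:
  assumes "\<And>u v. u < n \<Longrightarrow> v < n \<Longrightarrow> A u v = B u v"
  shows "is_proj n r A \<longleftrightarrow> is_proj n r B"
  using assms by (simp add: is_proj_def cong: conj_cong)

lemma compress_det_cong:
  assumes "\<And>u v. u < n \<Longrightarrow> v < n \<Longrightarrow> A u v = B u v" "\<And>u j. u < n \<Longrightarrow> j < r \<Longrightarrow> y (u, j) = y' (u, j)"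
  shows "compress_det n r A y = compress_det n r B y'"
  unfolding compress_det_def
  by (intro arg_cong[of _ _ det] eq_matI) (auto simp: assms intro!: sum.cong)

lemma measurable_gpow:
  assumes "u < n" "v < n"
  shows "(\<lambda>z. gpow n m z k u v) \<in> borel_measurable (PiM ({..<n} \<times> {..<m}) (\<lambda>_. borel))"
  using assms
proof (induction k arbitrary: v)
  case (Suc k)
  have cnj_m: "cnj \<in> borel_measurable borel"
    by (intro borel_measurable_continuous_onI continuous_intros)
  have "(\<lambda>z. gram m z x v) \<in> borel_measurable (PiM ({..<n} \<times> {..<m}) (\<lambda>_. borel))" if "x < n" for x
    unfolding gram_def
  proof (intro borel_measurable_sum borel_measurable_times)
    fix a assume "a \<in> {..<m}"
    then have *: "(x, a) \<in> {..<n} \<times> {..<m}" "(v, a) \<in> {..<n} \<times> {..<m}" using that Suc.prems by auto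
    show "(\<lambda>z. z (x, a)) \<in> borel_measurable (PiM ({..<n} \<times> {..<m}) (\<lambda>_. borel))"
      by (rule measurable_component_singleton[OF *(1)])
    show "(\<lambda>z. cnj (z (v, a))) \<in> borel_measurable (PiM ({..<n} \<times> {..<m}) (\<lambda>_. borel))"
      by (rule measurable_compose[OF measurable_component_singleton[OF *(2)] cnj_m])
  qed
  moreover have "(\<lambda>z. gpow n m z k u x) \<in> borel_measurable (PiM ({..<n} \<times> {..<m}) (\<lambda>_. borel))" if "x < n" for x
    using Suc that by auto
  ultimately show ?case unfolding gpow.simps by (intro borel_measurable_sum borel_measurable_times) auto
qed simp

text \<open>\<open>lim\<close> is total, so the limit is measurable everywhere; arguments at which
  it fails to be a projection are excluded by the premise \<open>is_proj\<close> in
  \<open>AE_generic_position\<close>.\<close>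

lemma measurable_plim:
  assumes "u < n" "v < n"
  shows "(\<lambda>z. plim p n m z u v) \<in> borel_measurable (PiM ({..<n} \<times> {..<m}) (\<lambda>_. borel))"
  unfolding plim_def
  by (intro borel_measurable_lim_metric borel_measurable_sum borel_measurable_times borel_measurable_const measurable_gpow assms)

text \<open>By independence the joint law is a product, so for each fixed value of X the projection
  is deterministic and \<open>AE_compress_det_nonzero\<close> applies to Y. Joint measurability of
  \<open>Q\<close> then permits Fubini.\<close>

lemma AE_generic_position:
  assumes P: "prob_space P" and pos: "0 < n" "0 < m" "0 < l"
    and X: "iid_gaussian_matrix P n m vx X" and Y: "iid_gaussian_matrix P n l vy Y"
    and XY: "indep_matrices P n m X n l Y" and r: "r \<le> l"
  shows "AE w in P. is_proj n r (plim p n m (\<lambda>i. X w $$ i)) \<longrightarrow>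
    compress_det n r (plim p n m (\<lambda>i. X w $$ i)) (\<lambda>i. Y w $$ i) \<noteq> 0"
proof -
  interpret prob_space P by fact
  let ?I = "{..<n} \<times> {..<m}" and ?J = "{..<n} \<times> {..<l}"
  let ?BI = "PiM ?I (\<lambda>_. borel) :: (nat \<times> nat \<Rightarrow> complex) measure"
  let ?BJ = "PiM ?J (\<lambda>_. borel) :: (nat \<times> nat \<Rightarrow> complex) measure"
  let ?x = "\<lambda>w. \<lambda>i\<in>?I. X w $$ i" and ?y = "\<lambda>w. \<lambda>i\<in>?J. Y w $$ i"
  have J: "?J \<noteq> {}" using pos by auto
  have indY: "indep_vars (\<lambda>_. borel) (\<lambda>ij w. Y w $$ ij) ?J"
    and gY: "\<And>ij. ij \<in> ?J \<Longrightarrow> circ_sym_gaussian P vy (\<lambda>w. Y w $$ ij)"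
    using Y by (auto simp: iid_gaussian_matrix_def)
  have mY: "(\<lambda>w. Y w $$ ij) \<in> borel_measurable P" if "ij \<in> ?J" for ij
    using indep_vars_def2[of "\<lambda>_. borel" "\<lambda>ij w. Y w $$ ij" ?J] indY that by auto
  have xy: "?x \<in> measurable P ?BI" "?y \<in> measurable P ?BJ"
    "distr P ?BI ?x \<Otimes>\<^sub>M distr P ?BJ ?y = distr P (?BI \<Otimes>\<^sub>M ?BJ) (\<lambda>w. (?x w, ?y w))"
    using XY unfolding indep_matrices_def indep_var_distribution_eq by auto
  define ij0 where "ij0 = (0::nat, 0::nat)"
  \<comment> \<open>Outside \<open>?J\<close> the law of one genuine entry is repeated, so that
    every \<open>D ij\<close> is a non-atomic probability measure.\<close>
  define D where "D ij = distr P borel (\<lambda>w. Y w $$ (if ij \<in> ?J then ij else ij0))" for ij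
  have ij0: "ij0 \<in> ?J" using pos by (simp add: ij0_def)
  have D: "prob_space (D ij)" "sets (D ij) = sets borel" "emeasure (D ij) {c} = 0" for ij c
    unfolding D_def using ij0 mY
    by (auto intro!: prob_space_distr emeasure_circ_sym_gaussian_singleton[OF P gY])
  have dY: "distr P ?BJ ?y = PiM ?J D"
  proof -
    have "distr P ?BJ ?y = PiM ?J (\<lambda>ij. distr P borel (\<lambda>w. Y w $$ ij))"
      using indep_vars_iff_distr_eq_PiM'[OF J mY] indY by simp
    also have "\<dots> = PiM ?J D" by (intro PiM_cong refl) (simp add: D_def)
    finally show ?thesis .
  qed
  define Q where "Q z \<longleftrightarrow> (is_proj n r (plim p n m (fst z)) \<longrightarrow> compress_det n r (plim p n m (fst z)) (snd z) \<noteq> 0)" for z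
  interpret DX: prob_space "distr P ?BI ?x" by (rule prob_space_distr[OF xy(1)])
  interpret DY: prob_space "distr P ?BJ ?y" by (rule prob_space_distr[OF xy(2)])
  interpret pair_sigma_finite "distr P ?BI ?x" "distr P ?BJ ?y" ..
  have cnj_m: "cnj \<in> borel_measurable borel"
    by (intro borel_measurable_continuous_onI continuous_intros)
  have m1: "(\<lambda>z. plim p n m (fst z) u v) \<in> borel_measurable (?BI \<Otimes>\<^sub>M ?BJ)" if "u < n" "v < n" for u v
    by (rule measurable_compose[OF measurable_fst measurable_plim[OF that]])
  have m2: "(\<lambda>z. snd z (u, j)) \<in> borel_measurable (?BI \<Otimes>\<^sub>M ?BJ)" if "u < n" "j < r" for u j
    by (rule measurable_compose[OF measurable_snd measurable_component_singleton]) (use that r in auto)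
  have m3: "(\<lambda>z. compress_det n r (plim p n m (fst z)) (snd z)) \<in> borel_measurable (?BI \<Otimes>\<^sub>M ?BJ)"
    unfolding compress_det_def
    by (intro measurable_det) (auto intro!: borel_measurable_sum borel_measurable_times m1 m2 measurable_compose[OF _ cnj_m])
  \<comment> \<open>Extension by 0 gives measurability for all index pairs, which lets the
    quantifiers of \<open>is_proj\<close> be handled automatically.\<close>
  define f where "f u v z = (if u < n \<and> v < n then plim p n m (fst z) u v else 0)"
    for u v and z :: "(nat \<times> nat \<Rightarrow> complex) \<times> (nat \<times> nat \<Rightarrow> complex)"
  have [measurable]: "f u v \<in> borel_measurable (?BI \<Otimes>\<^sub>M ?BJ)" "(\<lambda>z. cnj (f u v z)) \<in> borel_measurable (?BI \<Otimes>\<^sub>M ?BJ)" for u v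
  proof -
    show "f u v \<in> borel_measurable (?BI \<Otimes>\<^sub>M ?BJ)"
      unfolding f_def using m1[of u v] by (cases "u < n \<and> v < n") auto
    then show "(\<lambda>z. cnj (f u v z)) \<in> borel_measurable (?BI \<Otimes>\<^sub>M ?BJ)"
      by (rule measurable_compose[OF _ cnj_m])
  qed
  have "is_proj n r (plim p n m (fst z)) \<longleftrightarrow> is_proj n r (\<lambda>u v. f u v z)" for z
    by (rule is_proj_cong) (simp add: f_def)
  then have "Measurable.pred (?BI \<Otimes>\<^sub>M ?BJ) (\<lambda>z. is_proj n r (plim p n m (fst z)))"
    unfolding is_proj_def by simp measurable
  then have mQ: "Measurable.pred (?BI \<Otimes>\<^sub>M ?BJ) Q"
    unfolding Q_def using m3 by measurable
  have "AE z in distr P ?BI ?x \<Otimes>\<^sub>M distr P ?BJ ?y. Q z"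
  proof (rule AE_pair_measure)
    show "{z \<in> space (distr P ?BI ?x \<Otimes>\<^sub>M distr P ?BJ ?y). Q z} \<in> sets (distr P ?BI ?x \<Otimes>\<^sub>M distr P ?BJ ?y)"
      using mQ by (simp add: pred_def space_pair_measure cong: sets_pair_measure_cong)
    show "AE x in distr P ?BI ?x. AE y in distr P ?BJ ?y. Q (x, y)"
    proof (rule AE_I2)
      fix x
      show "AE y in distr P ?BJ ?y. Q (x, y)"
        unfolding dY Q_def fst_conv snd_conv using AE_compress_det_nonzero[OF D _ r]
        by (cases "is_proj n r (plim p n m x)") auto
    qed
  qed
  then have "AE w in P. Q (?x w, ?y w)"
    unfolding xy(3) using xy(1,2) mQ by (subst (asm) AE_distr_iff) (auto simp: pred_def)
  then show ?thesis
  proof (rule eventually_mono)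
    fix w assume Q: "Q (?x w, ?y w)"
    have pl: "plim p n m (?x w) u v = plim p n m (\<lambda>i. X w $$ i) u v" if "u < n" "v < n" for u v
      using plim_restrict[OF that] .
    have "is_proj n r (plim p n m (?x w)) \<longleftrightarrow> is_proj n r (plim p n m (\<lambda>i. X w $$ i))"
      by (rule is_proj_cong) (rule pl)
    moreover have "compress_det n r (plim p n m (?x w)) (?y w) = compress_det n r (plim p n m (\<lambda>i. X w $$ i)) (\<lambda>i. Y w $$ i)"
      by (rule compress_det_cong) (use pl r in auto)
    ultimately show "is_proj n r (plim p n m (\<lambda>i. X w $$ i)) \<longrightarrow>
      compress_det n r (plim p n m (\<lambda>i. X w $$ i)) (\<lambda>i. Y w $$ i) \<noteq> 0"
      using Q by (simp add: Q_def)
  qed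
qed

subsection \<open>Kernel dimension and singular values\<close>

text \<open>The leading \<open>min q l\<close> columns are independent. If \<open>l \<le> q\<close>,
  the kernel is trivial; otherwise the leading square block is invertible, so the row echelon form
  has \<open>q\<close> nonzero rows and the kernel has dimension \<open>l - q\<close>.\<close>

lemma kernel_dim_if_columns_independent:
  fixes B :: "complex mat"
  assumes B: "B \<in> carrier_mat q l"
    and inj: "\<And>x. (\<And>i. i < q \<Longrightarrow> (\<Sum>j<min q l. B $$ (i, j) * x j) = 0) \<Longrightarrow> (\<And>j. j < min q l \<Longrightarrow> x j = 0)"
  shows "kernel_dim B = l - min q l"
proof (cases "l \<le> q")
  case True
  have "mat_kernel B = {0\<^sub>v l}"
  proof safe
    fix v assume "v \<in> mat_kernel B"
    then have v: "v \<in> carrier_vec l" "B *\<^sub>v v = 0\<^sub>v q" using mat_kernelD[OF B] by auto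
    have "(\<Sum>j<l. B $$ (i, j) * v $ j) = (B *\<^sub>v v) $ i" if "i < q" for i
      using B v(1) that by (simp add: scalar_prod_def atLeast0LessThan)
    then have "v $ j = 0" if "j < l" for j
      using inj[of "\<lambda>j. v $ j" j] that True v(2) by (simp add: min_absorb2)
    then show "v = 0\<^sub>v l" using v(1) by (intro eq_vecI) auto
  qed (use B in \<open>auto intro!: mat_kernelI\<close>)
  moreover have "mat_kernel (1\<^sub>m l :: complex mat) = {0\<^sub>v l}"
    using mat_kernelD[of "1\<^sub>m l :: complex mat" l l] by (auto intro!: mat_kernelI[of _ l l])
  ultimately have id: "mat_kernel B = mat_kernel (1\<^sub>m l :: complex mat)" by simp
  have "kernel.dim l B = 0"
    unfolding id by (rule kernel_one_mat)
  then show ?thesis using B True by (simp add: kernel_dim_def)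
next
  case False
  then have r: "min q l = q" by simp
  let ?E = "gauss_jordan_single B"
  from gauss_jordan_single[OF B refl] obtain P Q where
    E: "?E = P * B" and QP: "Q * P = 1\<^sub>m q" and P: "P \<in> carrier_mat q q" and Q: "Q \<in> carrier_mat q q"
    and Ec: "?E \<in> carrier_mat q l" and row: "row_echelon_form ?E" by auto
  have PQ: "P * Q = 1\<^sub>m q" using mat_mult_left_right_inverse[OF Q P QP] .
  have "{i. i < q \<and> row ?E i \<noteq> 0\<^sub>v l} = {i. i < q}"
  proof (rule ccontr)
    assume "\<not> ?thesis"
    \<comment> \<open>A zero row of \<open>P * B\<close> makes row \<open>i0\<close> of
      \<open>P\<close> a left null vector of the invertible block, hence 0, against
      \<open>P * Q = 1\<close>.\<close>
    then obtain i0 where i0: "i0 < q" "row ?E i0 = 0\<^sub>v l" by auto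
    have z: "(\<Sum>k<q. P $$ (i0, k) * B $$ (k, j)) = 0" if "j < l" for j
    proof -
      have "(\<Sum>k<q. P $$ (i0, k) * B $$ (k, j)) = row ?E i0 $ j"
        using P B i0(1) that unfolding E by (simp add: scalar_prod_def atLeast0LessThan)
      then show ?thesis using i0(2) that by simp
    qed
    have "det (mat q q (\<lambda>(i, j). B $$ (i, j))) \<noteq> 0"
      unfolding det_mat_eq_0_iff using inj unfolding r by auto
    moreover have "transpose_mat (mat q q (\<lambda>(i, j). B $$ (i, j))) = mat q q (\<lambda>(i, j). B $$ (j, i))"
      by (rule eq_matI) auto
    ultimately have "det (mat q q (\<lambda>(i, j). B $$ (j, i))) \<noteq> 0"
      using det_transpose[of "mat q q (\<lambda>(i, j). B $$ (i, j))" q] by simp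
    then have "P $$ (i0, k) = 0" if "k < q" for k
      using z that False unfolding det_mat_eq_0_iff by (auto simp: mult.commute)
    then have "(P * Q) $$ (i0, i0) = 0"
      using P Q i0(1) by (simp add: scalar_prod_def)
    then show False using PQ i0(1) by simp
  qed
  then have card: "card {i. i < q \<and> row ?E i \<noteq> 0\<^sub>v l} = q" by simp
  interpret K: kernel q l ?E by unfold_locales (rule Ec)
  have "kernel_dim B = K.dim"
    unfolding kernel_dim_def using B mat_kernel_mult_eq[OF B P Q QP, folded E] by simp
  also have "\<dots> = l - q" using find_base_vectors[OF row Ec] card by simp
  finally show ?thesis using r by simp
qed

section \<open>Singular value decompositions in terms of entries\<close>

lemma mat_mult_entry:
  fixes A B :: "complex mat"
  assumes "A \<in> carrier_mat n k" "B \<in> carrier_mat k m" "i < n" "j < m"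
  shows "(A * B) $$ (i, j) = (\<Sum>x<k. A $$ (i, x) * B $$ (x, j))"
  using assms by (simp add: scalar_prod_def atLeast0LessThan)

lemma sum_mult_orthonormal:
  fixes f g :: "nat \<Rightarrow> nat \<Rightarrow> complex"
  assumes "\<And>i j. i < d \<Longrightarrow> j < d \<Longrightarrow> (\<Sum>a<N. f a i * g a j) = (if i = j then 1 else 0)"
  shows "(\<Sum>a<N. (\<Sum>i<d. p i * f a i) * (\<Sum>j<d. q j * g a j)) = (\<Sum>i<d. p i * q i)"
proof -
  have "(\<Sum>a<N. (\<Sum>i<d. p i * f a i) * (\<Sum>j<d. q j * g a j)) = (\<Sum>a<N. \<Sum>i<d. \<Sum>j<d. p i * q j * (f a i * g a j))"
    by (simp add: sum_product mult_ac)
  also have "\<dots> = (\<Sum>i<d. \<Sum>a<N. \<Sum>j<d. p i * q j * (f a i * g a j))"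
    by (rule sum.swap)
  also have "\<dots> = (\<Sum>i<d. \<Sum>j<d. p i * q j * (\<Sum>a<N. f a i * g a j))"
    unfolding sum_distrib_left by (rule sum.cong[OF refl], rule sum.swap)
  also have "\<dots> = (\<Sum>i<d. \<Sum>j<d. p i * q j * (if i = j then 1 else 0))"
    by (intro sum.cong refl arg_cong2[of _ _ _ _ "(*)"] assms) auto
  also have "\<dots> = (\<Sum>i<d. p i * q i)"
    by (intro sum.cong refl) (simp add: if_distrib[of "\<lambda>t. _ * t"] sum.delta cong: if_cong)
  finally show ?thesis .
qed

lemma index_mat_adjoint [simp]:
  fixes A :: "complex mat"
  assumes "i < dim_col A" "j < dim_row A"
  shows "mat_adjoint A $$ (i, j) = cnj (A $$ (j, i))"
  using assms by (simp add: mat_adjoint_def mat_of_rows_index cols_def)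

lemma dim_mat_adjoint [simp]:
  fixes A :: "complex mat"
  shows "dim_row (mat_adjoint A) = dim_col A" "dim_col (mat_adjoint A) = dim_row A"
  by (simp_all add: mat_adjoint_def)

lemma proots_prod_linear:
  "proots (\<Prod>l\<leftarrow>ls. [:- complex_of_real l, 1:]) = mset (map complex_of_real ls)"
proof (induction ls)
  case (Cons a ls)
  have "(\<Prod>l\<leftarrow>ls. [:- complex_of_real l, 1:]) \<noteq> 0"
    by (auto simp: prod_list_zero_iff)
  then show ?case using Cons by (simp add: proots_mult del: mult_pCons_left)
qed simp

lemma eigenvalues_desc_eqI:
  assumes "sorted_wrt (\<ge>) ls" "char_poly A = (\<Prod>l\<leftarrow>ls. [:- complex_of_real l, 1:])"
  shows "eigenvalues_desc A = ls"
  unfolding eigenvalues_desc_def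
proof (rule the_equality)
  fix ls' assume ls': "sorted_wrt (\<ge>) ls' \<and> char_poly A = (\<Prod>l\<leftarrow>ls'. [:- complex_of_real l, 1:])"
  then have "image_mset complex_of_real (mset ls') = image_mset complex_of_real (mset ls)"
    using assms(2) proots_prod_linear[of ls] proots_prod_linear[of ls'] by (simp add: mset_map)
  then have "image_mset Re (image_mset complex_of_real (mset ls')) = image_mset Re (image_mset complex_of_real (mset ls))"
    by simp
  then have "mset (rev ls') = mset (rev ls)" by (simp add: image_mset.compositionality comp_def)
  moreover have "sorted (rev ls)" "sorted (rev ls')"
    using assms(1) ls' by (simp_all add: sorted_wrt_rev)
  ultimately have "rev ls' = rev ls" by (metis properties_for_sort)
  then show "ls' = ls" by simp
qed (use assms in auto)

locale svd_entries =
  fixes n m :: nat and H U V :: "complex mat" and s :: "nat \<Rightarrow> real"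
  assumes H: "H \<in> carrier_mat n m" and U: "U \<in> carrier_mat n n" and V: "V \<in> carrier_mat m m"
    and UU: "\<And>i j. i < n \<Longrightarrow> j < n \<Longrightarrow> (\<Sum>x<n. cnj (U $$ (x, i)) * U $$ (x, j)) = (if i = j then 1 else 0)"
    and UU': "\<And>x y. x < n \<Longrightarrow> y < n \<Longrightarrow> (\<Sum>i<n. U $$ (x, i) * cnj (U $$ (y, i))) = (if x = y then 1 else 0)"
    and VV: "\<And>i j. i < m \<Longrightarrow> j < m \<Longrightarrow> (\<Sum>x<m. cnj (V $$ (x, i)) * V $$ (x, j)) = (if i = j then 1 else 0)"
    and VV': "\<And>x y. x < m \<Longrightarrow> y < m \<Longrightarrow> (\<Sum>i<m. V $$ (x, i) * cnj (V $$ (y, i))) = (if x = y then 1 else 0)"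
    and s0: "\<And>i. i < min n m \<Longrightarrow> 0 \<le> s i"
    and s_desc: "\<And>i j. i \<le> j \<Longrightarrow> j < min n m \<Longrightarrow> s j \<le> s i"
    and H_entry: "\<And>x a. x < n \<Longrightarrow> a < m \<Longrightarrow> H $$ (x, a) = (\<Sum>i<min n m. U $$ (x, i) * of_real (s i) * cnj (V $$ (a, i)))"

lemma unitary_matrix_entries:
  assumes "unitary_matrix n U"
  shows "U \<in> carrier_mat n n"
    and "i < n \<Longrightarrow> j < n \<Longrightarrow> (\<Sum>x<n. cnj (U $$ (x, i)) * U $$ (x, j)) = (if i = j then 1 else 0)"
    and "x < n \<Longrightarrow> y < n \<Longrightarrow> (\<Sum>i<n. U $$ (x, i) * cnj (U $$ (y, i))) = (if x = y then 1 else 0)"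
proof -
  have U: "U \<in> carrier_mat n n" "mat_adjoint U * U = 1\<^sub>m n" "U * mat_adjoint U = 1\<^sub>m n"
    using assms by (auto simp: unitary_matrix_def)
  show "U \<in> carrier_mat n n" by (rule U)
  show "(\<Sum>x<n. cnj (U $$ (x, i)) * U $$ (x, j)) = (if i = j then 1 else 0)" if "i < n" "j < n"
  proof -
    have "(mat_adjoint U * U) $$ (i, j) = (\<Sum>x<n. cnj (U $$ (x, i)) * U $$ (x, j))"
      using U(1) that by (simp add: scalar_prod_def atLeast0LessThan)
    then show ?thesis using U(2) that by simp
  qed
  show "(\<Sum>i<n. U $$ (x, i) * cnj (U $$ (y, i))) = (if x = y then 1 else 0)" if "x < n" "y < n"
  proof -
    have "(U * mat_adjoint U) $$ (x, y) = (\<Sum>i<n. U $$ (x, i) * cnj (U $$ (y, i)))"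
      using U(1) that by (simp add: scalar_prod_def atLeast0LessThan)
    then show ?thesis using U(3) that by simp
  qed
qed

lemma is_svd_entries:
  assumes H: "H \<in> carrier_mat n m" and svd: "is_svd H U S V"
  shows "\<exists>s. svd_entries n m H U V s"
proof -
  let ?d = "min n m"
  from svd H obtain s where U: "unitary_matrix n U" and V: "unitary_matrix m V"
    and s: "\<And>i. i < ?d \<Longrightarrow> 0 \<le> s i" "\<And>i j. j < ?d \<Longrightarrow> i \<le> j \<Longrightarrow> s j \<le> s i"
    and S: "S = mat n m (\<lambda>(i, j). if i = j then complex_of_real (s i) else 0)"
    and HU: "H = U * S * mat_adjoint V"
    by (auto simp: is_svd_def)
  note Ue = unitary_matrix_entries[OF U] and Ve = unitary_matrix_entries[OF V]
  have "H $$ (x, a) = (\<Sum>i<?d. U $$ (x, i) * of_real (s i) * cnj (V $$ (a, i)))" if x: "x < n" "a < m" for x a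
  proof -
    have US: "(U * S) $$ (x, j) = (if j < n then U $$ (x, j) * of_real (s j) else 0)" if "j < m" for j
    proof -
      have "(U * S) $$ (x, j) = (\<Sum>i<n. U $$ (x, i) * (if i = j then of_real (s i) else 0))"
        using Ue(1) x that by (simp add: S scalar_prod_def atLeast0LessThan)
      also have "\<dots> = (if j < n then U $$ (x, j) * of_real (s j) else 0)"
        by (simp add: if_distrib[of "\<lambda>t. _ * t"] sum.delta cong: if_cong)
      finally show ?thesis .
    qed
    have "H $$ (x, a) = (\<Sum>j<m. (U * S) $$ (x, j) * cnj (V $$ (a, j)))"
      unfolding HU using Ue(1) Ve(1) x
      by (subst mat_mult_entry[of _ n m _ m]) (auto simp: S intro!: sum.cong)
    also have "\<dots> = (\<Sum>j\<in>{..<m}. if j \<in> {..<n} then U $$ (x, j) * of_real (s j) * cnj (V $$ (a, j)) else 0)"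
      by (intro sum.cong refl) (simp add: US)
    also have "\<dots> = (\<Sum>j\<in>{..<m} \<inter> {..<n}. U $$ (x, j) * of_real (s j) * cnj (V $$ (a, j)))"
      by (rule sum.inter_restrict[symmetric]) simp
    also have "{..<m} \<inter> {..<n} = {..<?d}" by auto
    finally show ?thesis .
  qed
  then have "svd_entries n m H U V s"
    unfolding svd_entries_def using H Ue Ve s by auto
  then show ?thesis by blast
qed

context svd_entries
begin

text \<open>Squared singular values padded with zeros: the first \<open>n\<close> are the
  eigenvalues of H H^* and the first \<open>m\<close> those of H^* H.\<close>

definition ev :: "nat \<Rightarrow> real" where
  "ev i = (if i < min n m then (s i)\<^sup>2 else 0)"

lemma ev_nonneg: "0 \<le> ev i"
  by (simp add: ev_def)

lemma ev_desc: "i \<le> j \<Longrightarrow> ev j \<le> ev i"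
  using s_desc[of i j] s0[of j] by (auto simp: ev_def power_mono)

lemma gram_H:
  assumes "x < n" "y < n"
  shows "gram m (\<lambda>i. H $$ i) x y = (\<Sum>i<n. U $$ (x, i) * of_real (ev i) * cnj (U $$ (y, i)))"
proof -
  let ?d = "min n m"
  have "gram m (\<lambda>i. H $$ i) x y = (\<Sum>a<m. (\<Sum>i<?d. (U $$ (x, i) * of_real (s i)) * cnj (V $$ (a, i)))
      * (\<Sum>j<?d. (of_real (s j) * cnj (U $$ (y, j))) * V $$ (a, j)))"
    unfolding gram_def using assms by (intro sum.cong refl) (simp add: H_entry mult_ac)
  also have "\<dots> = (\<Sum>i<?d. (U $$ (x, i) * of_real (s i)) * (of_real (s i) * cnj (U $$ (y, i))))"
    by (rule sum_mult_orthonormal) (rule VV, auto)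
  also have "\<dots> = (\<Sum>i\<in>{..<n} \<inter> {..<?d}. U $$ (x, i) * of_real (ev i) * cnj (U $$ (y, i)))"
    by (intro sum.cong) (auto simp: ev_def power2_eq_square mult.assoc)
  also have "\<dots> = (\<Sum>i<n. U $$ (x, i) * of_real (ev i) * cnj (U $$ (y, i)))"
    by (rule sum.mono_neutral_left) (auto simp: ev_def)
  finally show ?thesis .
qed

lemma gpow_H:
  assumes "x < n" "y < n"
  shows "gpow n m (\<lambda>i. H $$ i) k x y = (\<Sum>i<n. U $$ (x, i) * of_real (ev i ^ k) * cnj (U $$ (y, i)))"
  using assms
proof (induction k arbitrary: y)
  case 0
  then show ?case using UU'[of x y] by simp
next
  case (Suc k)
  have "gpow n m (\<lambda>i. H $$ i) (Suc k) x y = (\<Sum>u<n. (\<Sum>i<n. (U $$ (x, i) * of_real (ev i ^ k)) * cnj (U $$ (u, i)))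
      * (\<Sum>j<n. (of_real (ev j) * cnj (U $$ (y, j))) * U $$ (u, j)))"
    unfolding gpow.simps using Suc by (intro sum.cong refl) (simp add: gram_H mult_ac)
  also have "\<dots> = (\<Sum>i<n. (U $$ (x, i) * of_real (ev i ^ k)) * (of_real (ev i) * cnj (U $$ (y, i))))"
    by (rule sum_mult_orthonormal) (rule UU, auto)
  finally show ?case by (simp add: mult_ac)
qed

lemma gtr_H: "gtr n m (\<lambda>i. H $$ i) k = of_real (\<Sum>i<n. ev i ^ k)"
proof -
  have "gtr n m (\<lambda>i. H $$ i) k = (\<Sum>x<n. \<Sum>i<n. of_real (ev i ^ k) * (cnj (U $$ (x, i)) * U $$ (x, i)))"
    unfolding gtr_def by (intro sum.cong refl) (simp add: gpow_H mult_ac)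
  also have "\<dots> = (\<Sum>i<n. of_real (ev i ^ k) * (\<Sum>x<n. cnj (U $$ (x, i)) * U $$ (x, i)))"
    by (subst sum.swap) (simp add: sum_distrib_left)
  also have "\<dots> = (\<Sum>i<n. of_real (ev i ^ k))"
    by (intro sum.cong refl) (subst UU, auto)
  finally show ?thesis by simp
qed

text \<open>This links traces of H H^* to eigenvalues of H^* H. The exponent must be positive, so
  that the padding zeros contribute nothing.\<close>

lemma sum_ev_power_Suc: "(\<Sum>i<m. ev i ^ Suc k) = (\<Sum>i<n. ev i ^ Suc k)"
proof -
  have "(\<Sum>i<m. ev i ^ Suc k) = (\<Sum>i<min n m. ev i ^ Suc k)"
    by (rule sum.mono_neutral_right) (auto simp: ev_def)
  also have "\<dots> = (\<Sum>i<n. ev i ^ Suc k)"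
    by (rule sum.mono_neutral_left) (auto simp: ev_def)
  finally show ?thesis .
qed

lemma adjoint_mult_entry:
  assumes "x < m" "y < m"
  shows "(mat_adjoint H * H) $$ (x, y) = (\<Sum>i<m. V $$ (x, i) * of_real (ev i) * cnj (V $$ (y, i)))"
proof -
  let ?d = "min n m"
  have "(mat_adjoint H * H) $$ (x, y) = (\<Sum>a<n. cnj (H $$ (a, x)) * H $$ (a, y))"
    using H assms by (simp add: scalar_prod_def atLeast0LessThan)
  also have "\<dots> = (\<Sum>a<n. (\<Sum>i<?d. (V $$ (x, i) * of_real (s i)) * cnj (U $$ (a, i)))
      * (\<Sum>j<?d. (of_real (s j) * cnj (V $$ (y, j))) * U $$ (a, j)))"
    using assms by (intro sum.cong refl) (simp add: H_entry mult_ac)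
  also have "\<dots> = (\<Sum>i<?d. (V $$ (x, i) * of_real (s i)) * (of_real (s i) * cnj (V $$ (y, i))))"
    by (rule sum_mult_orthonormal) (rule UU, auto)
  also have "\<dots> = (\<Sum>i\<in>{..<m} \<inter> {..<?d}. V $$ (x, i) * of_real (ev i) * cnj (V $$ (y, i)))"
    by (intro sum.cong) (auto simp: ev_def power2_eq_square mult.assoc)
  also have "\<dots> = (\<Sum>i<m. V $$ (x, i) * of_real (ev i) * cnj (V $$ (y, i)))"
    by (rule sum.mono_neutral_left) (auto simp: ev_def)
  finally show ?thesis .
qed

lemma eigenvalues_desc_H: "eigenvalues_desc (mat_adjoint H * H) = map ev [0..<m]"
proof (rule eigenvalues_desc_eqI)
  show "sorted_wrt (\<ge>) (map ev [0..<m])"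
    by (auto simp: sorted_wrt_map sorted_wrt_iff_nth_less intro: ev_desc)
  let ?D = "mat m m (\<lambda>(i, j). if i = j then complex_of_real (ev i) else 0)"
  have VD: "(V * ?D) $$ (x, j) = V $$ (x, j) * of_real (ev j)" if "x < m" "j < m" for x j
  proof -
    have "(V * ?D) $$ (x, j) = (\<Sum>i<m. V $$ (x, i) * (if i = j then of_real (ev i) else 0))"
      using V that by (simp add: scalar_prod_def atLeast0LessThan)
    then show ?thesis using that by (simp add: if_distrib[of "\<lambda>t. _ * t"] sum.delta cong: if_cong)
  qed
  have eq: "mat_adjoint H * H = V * ?D * mat_adjoint V"
  proof (rule eq_matI)
    fix x y assume "x < dim_row (V * ?D * mat_adjoint V)" "y < dim_col (V * ?D * mat_adjoint V)"
    then have xy: "x < m" "y < m" using V by auto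
    have "(V * ?D * mat_adjoint V) $$ (x, y) = (\<Sum>i<m. (V * ?D) $$ (x, i) * cnj (V $$ (y, i)))"
      using V xy by (subst mat_mult_entry[of _ m m _ m]) (auto intro!: sum.cong)
    then show "(mat_adjoint H * H) $$ (x, y) = (V * ?D * mat_adjoint V) $$ (x, y)"
      using adjoint_mult_entry[OF xy] VD xy by simp
  qed (use H V in auto)
  have "V * mat_adjoint V = 1\<^sub>m m"
    using V by (intro eq_matI) (auto simp: scalar_prod_def atLeast0LessThan VV')
  moreover have "mat_adjoint V * V = 1\<^sub>m m"
    using V by (intro eq_matI) (auto simp: scalar_prod_def atLeast0LessThan VV)
  ultimately have "similar_mat (mat_adjoint H * H) ?D"
    unfolding similar_mat_def similar_mat_wit_def
    using H V eq by (intro exI[of _ V] exI[of _ "mat_adjoint V"]) (auto simp: Let_def)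
  then have "char_poly (mat_adjoint H * H) = char_poly ?D" by (rule char_poly_similar)
  also have "\<dots> = (\<Prod>l\<leftarrow>diag_mat ?D. [:- l, 1:])"
    by (rule char_poly_upper_triangular[of _ m]) auto
  also have "diag_mat ?D = map (\<lambda>i. complex_of_real (ev i)) [0..<m]"
    by (simp add: diag_mat_def)
  finally show "char_poly (mat_adjoint H * H) = (\<Prod>l\<leftarrow>map ev [0..<m]. [:- complex_of_real l, 1:])"
    by (simp add: comp_def)
qed

end

text \<open>\<open>f k\<close> is a ramp of slope \<open>k\<close> rising from 0 at \<open>t\<close>
  to 1, approximated within \<open>1 / Suc k\<close> on \<open>{0..k}\<close>. Slope and interval
  grow together, so each \<open>x \<noteq> t\<close> is eventually inside the interval and off the
  ramp. The polynomials depend on \<open>t\<close> only, not on a matrix.\<close>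

lemma step_polynomials:
  fixes t :: real
  shows "\<exists>p :: nat \<Rightarrow> real poly. \<forall>x\<ge>0. x \<noteq> t \<longrightarrow> (\<lambda>k. poly (p k) x) \<longlonglongrightarrow> (if t < x then 1 else 0)"
proof -
  define f where "f k x = max 0 (min 1 (real k * (x - t)))" for k :: nat and x
  have "\<exists>p. \<forall>x\<in>{0..real k}. \<bar>f k x - poly p x\<bar> < 1 / real (Suc k)" for k
  proof -
    have "continuous_on {0..real k} (f k)"
      unfolding f_def by (intro continuous_intros)
    then obtain g where g: "real_polynomial_function g" "\<And>x. x \<in> {0..real k} \<Longrightarrow> \<bar>f k x - g x\<bar> < 1 / real (Suc k)"
      using Stone_Weierstrass_real_polynomial_function[of "{0..real k}" "f k" "1 / real (Suc k)"] by auto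
    obtain c q where "g = (\<lambda>x. \<Sum>i\<le>q. c i * x ^ i)"
      using g(1) unfolding real_polynomial_function_iff_sum by auto
    then have "g x = poly (\<Sum>i\<le>q. monom (c i) i) x" for x by (simp add: poly_sum poly_monom)
    then show ?thesis using g(2) by (intro exI[of _ "\<Sum>i\<le>q. monom (c i) i"]) auto
  qed
  then obtain p where p: "\<And>k x. x \<in> {0..real k} \<Longrightarrow> \<bar>f k x - poly (p k) x\<bar> < 1 / real (Suc k)" by metis
  have "(\<lambda>k. poly (p k) x) \<longlonglongrightarrow> (if t < x then 1 else 0)" if x: "0 \<le> x" "x \<noteq> t" for x
  proof -
    obtain k0 :: nat where k0: "max x (1 / \<bar>x - t\<bar>) < real k0" using reals_Archimedean2 by blast
    have "\<forall>\<^sub>F k in sequentially. norm (poly (p k) x - (if t < x then 1 else 0)) \<le> 1 / real (Suc k)"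
    proof (rule eventually_sequentiallyI[of k0])
      fix k assume "k0 \<le> k"
      then have k: "x \<le> real k" "1 / \<bar>x - t\<bar> \<le> real k" using k0 by auto
      then have "1 \<le> real k * \<bar>x - t\<bar>" using x by (simp add: field_simps)
      then have "f k x = (if t < x then 1 else 0)"
      proof (cases "t < x")
        case False
        have "real k * (x - t) \<le> 0" using False by (intro mult_nonneg_nonpos) auto
        then show ?thesis using False by (simp add: f_def)
      qed (simp add: f_def)
      then show "norm (poly (p k) x - (if t < x then 1 else 0)) \<le> 1 / real (Suc k)"
        using p[of x k] x k by (simp add: abs_minus_commute)
    qed
    moreover have "(\<lambda>k. 1 / real (Suc k)) \<longlonglongrightarrow> 0"
      using LIMSEQ_inverse_real_of_nat by (simp add: inverse_eq_divide)
    ultimately have "(\<lambda>k. poly (p k) x - (if t < x then 1 else 0)) \<longlonglongrightarrow> 0"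
      by (rule Lim_null_comparison)
    then show ?thesis by (simp add: LIM_zero_iff)
  qed
  then show ?thesis by blast
qed

definition step_poly :: "real \<Rightarrow> nat \<Rightarrow> real poly" where
  "step_poly t = (SOME p. \<forall>x\<ge>0. x \<noteq> t \<longrightarrow> (\<lambda>k. poly (p k) x) \<longlonglongrightarrow> (if t < x then 1 else 0))"

lemma step_poly_tendsto:
  "0 \<le> x \<Longrightarrow> x \<noteq> t \<Longrightarrow> (\<lambda>k. poly (step_poly t k) x) \<longlonglongrightarrow> (if t < x then 1 else 0)"
  using someI_ex[OF step_polynomials[of t]] unfolding step_poly_def by blast

lemma downward_closed_eq_lessThan_card:
  fixes A :: "nat set"
  assumes "finite A" "\<And>i j. j \<in> A \<Longrightarrow> i \<le> j \<Longrightarrow> i \<in> A"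
  shows "A = {..<card A}"
proof (cases "A = {}")
  case False
  have "A = {..Max A}"
    using assms False by (auto intro: Max_ge assms(2)[OF Max_in])
  then show ?thesis by (metis card_atMost lessThan_Suc_atMost)
qed simp

context svd_entries
begin

definition eig_proj :: "nat \<Rightarrow> nat \<Rightarrow> nat \<Rightarrow> complex" where
  "eig_proj q u v = (\<Sum>i<q. U $$ (u, i) * cnj (U $$ (v, i)))"

lemma plim_step_poly:
  assumes t: "\<And>i. i < q \<Longrightarrow> t < ev i" "\<And>i. q \<le> i \<Longrightarrow> ev i < t" and q: "q \<le> n" and uv: "u < n" "v < n"
  shows "plim (step_poly t) n m (\<lambda>i. H $$ i) u v = eig_proj q u v"
proof -
  let ?p = "step_poly t"
  have eq: "(\<Sum>j\<le>degree (?p k). of_real (coeff (?p k) j) * gpow n m (\<lambda>i. H $$ i) j u v)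
     = (\<Sum>i<n. U $$ (u, i) * cnj (U $$ (v, i)) * of_real (poly (?p k) (ev i)))" for k
    unfolding gpow_H[OF uv] poly_altdef of_real_sum sum_distrib_left
    by (subst sum.swap) (simp add: mult_ac)
  have "(\<lambda>k. \<Sum>i<n. U $$ (u, i) * cnj (U $$ (v, i)) * of_real (poly (?p k) (ev i)))
     \<longlonglongrightarrow> (\<Sum>i<n. U $$ (u, i) * cnj (U $$ (v, i)) * of_real (if t < ev i then 1 else 0))"
  proof (intro tendsto_intros step_poly_tendsto ev_nonneg)
    show "ev i \<noteq> t" for i using t[of i] by (cases "i < q") auto
  qed
  also have "(\<Sum>i<n. U $$ (u, i) * cnj (U $$ (v, i)) * of_real (if t < ev i then 1 else 0))
     = (\<Sum>i<n. if i \<in> {..<q} then U $$ (u, i) * cnj (U $$ (v, i)) else 0)"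
    using t by (intro sum.cong refl) (force simp: not_less dest: less_imp_le)
  also have "\<dots> = (\<Sum>i\<in>{..<n} \<inter> {..<q}. U $$ (u, i) * cnj (U $$ (v, i)))"
    by (rule sum.inter_restrict[symmetric]) simp
  also have "{..<n} \<inter> {..<q} = {..<q}" using q by auto
  finally show ?thesis unfolding plim_def eq eig_proj_def by (rule limI)
qed

lemma is_proj_eig_proj:
  assumes "r \<le> q" "q \<le> n"
  shows "is_proj n r (eig_proj q)"
  unfolding is_proj_def
proof (intro conjI allI impI)
  fix u v assume "u < n" "v < n"
  show "cnj (eig_proj q u v) = eig_proj q v u"
    by (simp add: eig_proj_def mult.commute)
  have "(\<Sum>x<n. eig_proj q u x * eig_proj q x v) = (\<Sum>x<n. (\<Sum>i<q. U $$ (u, i) * cnj (U $$ (x, i))) * (\<Sum>j<q. cnj (U $$ (v, j)) * U $$ (x, j)))"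
    by (simp add: eig_proj_def mult.commute)
  also have "\<dots> = eig_proj q u v"
    unfolding eig_proj_def by (rule sum_mult_orthonormal) (rule UU, use assms in auto)
  finally show "(\<Sum>x<n. eig_proj q u x * eig_proj q x v) = eig_proj q u v" .
next
  have "(\<Sum>u<n. eig_proj q u u) = (\<Sum>i<q. \<Sum>u<n. cnj (U $$ (u, i)) * U $$ (u, i))"
    unfolding eig_proj_def by (subst sum.swap) (simp add: mult.commute)
  also have "\<dots> = (\<Sum>i<q. 1)" by (intro sum.cong refl) (subst UU, use assms in auto)
  finally show "real r \<le> Re (\<Sum>u<n. eig_proj q u u)" using assms by simp
qed

text \<open>\<open>eig_proj q\<close> is the product of the first \<open>q\<close> columns of U with
  their adjoint, so \<open>compress_det\<close> is the Gram determinant of the leading columns of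
  the matrix in question; being nonzero, it makes them independent.\<close>

lemma kernel_dim_first_rows:
  assumes Y: "Y \<in> carrier_mat n l" and q: "q \<le> n"
    and nz: "compress_det n (min q l) (eig_proj q) (\<lambda>i. Y $$ i) \<noteq> 0"
  shows "kernel_dim (first_rows q (mat_adjoint U * Y)) = l - min q l"
proof -
  let ?r = "min q l" and ?B = "first_rows q (mat_adjoint U * Y)"
  have B: "?B \<in> carrier_mat q l" using Y by (simp add: first_rows_def)
  have Be: "?B $$ (i, j) = (\<Sum>u<n. cnj (U $$ (u, i)) * Y $$ (u, j))" if "i < q" "j < l" for i j
  proof -
    have "?B $$ (i, j) = (mat_adjoint U * Y) $$ (i, j)" using that Y by (simp add: first_rows_def)
    also have "\<dots> = (\<Sum>u<n. mat_adjoint U $$ (i, u) * Y $$ (u, j))"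
      using that q Y U by (intro mat_mult_entry[of _ n n _ l]) auto
    also have "\<dots> = (\<Sum>u<n. cnj (U $$ (u, i)) * Y $$ (u, j))"
      using that q U by (intro sum.cong refl) simp
    finally show ?thesis .
  qed
  show ?thesis
  proof (rule kernel_dim_if_columns_independent[OF B])
    fix x j assume x: "\<And>i. i < q \<Longrightarrow> (\<Sum>j<?r. ?B $$ (i, j) * x j) = 0" and j: "j < ?r"
    have "(\<Sum>j<?r. (\<Sum>u<n. \<Sum>v<n. cnj (Y $$ (u, i)) * eig_proj q u v * Y $$ (v, j)) * x j) = 0" if i: "i < ?r" for i
    proof -
      have "(\<Sum>u<n. \<Sum>v<n. cnj (Y $$ (u, i)) * eig_proj q u v * Y $$ (v, j)) = (\<Sum>k<q. cnj (?B $$ (k, i)) * ?B $$ (k, j))"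
        if "j < ?r" for j
      proof -
        have "(\<Sum>u<n. \<Sum>v<n. cnj (Y $$ (u, i)) * eig_proj q u v * Y $$ (v, j))
          = (\<Sum>u<n. \<Sum>v<n. \<Sum>k<q. cnj (Y $$ (u, i)) * U $$ (u, k) * (cnj (U $$ (v, k)) * Y $$ (v, j)))"
          by (simp add: eig_proj_def sum_distrib_left sum_distrib_right mult.assoc)
        also have "\<dots> = (\<Sum>u<n. \<Sum>k<q. \<Sum>v<n. cnj (Y $$ (u, i)) * U $$ (u, k) * (cnj (U $$ (v, k)) * Y $$ (v, j)))"
          by (rule sum.cong[OF refl], rule sum.swap)
        also have "\<dots> = (\<Sum>k<q. \<Sum>u<n. \<Sum>v<n. cnj (Y $$ (u, i)) * U $$ (u, k) * (cnj (U $$ (v, k)) * Y $$ (v, j)))"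
          by (rule sum.swap)
        also have "\<dots> = (\<Sum>k<q. cnj (?B $$ (k, i)) * ?B $$ (k, j))"
          using i that by (intro sum.cong refl) (simp add: Be sum_product mult_ac)
        finally show ?thesis .
      qed
      then have "(\<Sum>j<?r. (\<Sum>u<n. \<Sum>v<n. cnj (Y $$ (u, i)) * eig_proj q u v * Y $$ (v, j)) * x j)
        = (\<Sum>j<?r. (\<Sum>k<q. cnj (?B $$ (k, i)) * ?B $$ (k, j)) * x j)" by simp
      also have "\<dots> = (\<Sum>k<q. cnj (?B $$ (k, i)) * (\<Sum>j<?r. ?B $$ (k, j) * x j))"
        unfolding sum_distrib_left sum_distrib_right by (subst sum.swap) (simp add: mult.assoc)
      also have "\<dots> = 0" using x by simp
      finally show ?thesis .
    qed
    then show "x j = 0" using nz j unfolding compress_det_def det_mat_eq_0_iff by auto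
  qed
qed

lemma num_used_eq:
  "num_used \<sigma> p H = card {i. i < length (map ev [0..<m]) \<and>
     0 < wf_power \<sigma> (water_level \<sigma> p (map ev [0..<m])) (map ev [0..<m] ! i)}"
  by (simp add: num_used_def eigenvalues_desc_H Let_def)

text \<open>Positive power at one eigenvalue implies positive power at every larger one, so the
  active modes form an initial segment, strictly separated from the rest; a rational fits in the
  gap. Zero eigenvalues receive no power, whence the bound \<open>min n m\<close>.\<close>

lemma num_used_threshold:
  assumes \<sigma>: "0 < \<sigma>"
  shows "num_used \<sigma> p H \<le> min n m \<and>
    (\<exists>t\<in>\<rat>. (\<forall>i<num_used \<sigma> p H. t < ev i) \<and> (\<forall>i\<ge>num_used \<sigma> p H. ev i < t))"
proof -
  define \<beta> where "\<beta> = water_level \<sigma> p (map ev [0..<m])"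
  define A where "A = {i. i < m \<and> 0 < wf_power \<sigma> \<beta> (ev i)}"
  have mono: "0 < wf_power \<sigma> \<beta> y" if "0 < wf_power \<sigma> \<beta> x" "0 \<le> x" "x \<le> y" for x y
  proof -
    have "0 < x" "0 < \<beta> - \<sigma> / x" using that by (auto simp: wf_power_def split: if_splits)
    moreover have "\<sigma> / y \<le> \<sigma> / x" using that \<open>0 < x\<close> \<sigma> by (intro divide_left_mono) auto
    ultimately show ?thesis using that by (auto simp: wf_power_def)
  qed
  define q where "q = card A"
  have q: "num_used \<sigma> p H = q"
    unfolding num_used_eq q_def A_def \<beta>_def by (intro arg_cong[of _ _ card]) auto
  have fin: "finite A" by (simp add: A_def)
  have Aq: "A = {..<q}"
    unfolding q_def
  proof (rule downward_closed_eq_lessThan_card[OF fin])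
    fix i j assume "j \<in> A" "i \<le> j"
    then show "i \<in> A" using mono[of "ev j" "ev i"] ev_desc[of i j] ev_nonneg by (auto simp: A_def)
  qed
  have qd: "i < min n m" if "i < q" for i
  proof -
    have "i \<in> A" using that Aq by auto
    then show ?thesis by (auto simp: A_def ev_def wf_power_def split: if_splits)
  qed
  have "q \<le> min n m"
    using qd[of "q - 1"] by (cases q) auto
  moreover have "\<exists>t\<in>\<rat>. (\<forall>i<q. t < ev i) \<and> (\<forall>i\<ge>q. ev i < t)"
  proof (cases "q = 0")
    case True
    obtain t where "t \<in> \<rat>" "ev 0 < t" using Rats_dense_in_real[of "ev 0" "ev 0 + 1"] by auto
    moreover have "ev i < t" for i using \<open>ev 0 < t\<close> ev_desc[of 0 i] by linarith
    ultimately show ?thesis using True by auto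
  next
    case False
    then have "q - 1 \<in> A" "q \<notin> A" using Aq by auto
    have pos: "0 < wf_power \<sigma> \<beta> (ev (q - 1))" using \<open>q - 1 \<in> A\<close> by (simp add: A_def)
    have "\<not> 0 < wf_power \<sigma> \<beta> (ev q)"
    proof (cases "q < m")
      case True
      then show ?thesis using \<open>q \<notin> A\<close> by (simp add: A_def)
    next
      case False
      then show ?thesis by (simp add: ev_def wf_power_def)
    qed
    then have "ev q < ev (q - 1)"
      using mono[OF pos ev_nonneg, of "ev q"] by linarith
    from Rats_dense_in_real[OF this] obtain t where t: "t \<in> \<rat>" "ev q < t" "t < ev (q - 1)" by auto
    have "t < ev i" if "i < q" for i using t(3) ev_desc[of i "q - 1"] that by linarith
    moreover have "ev i < t" if "q \<le> i" for i using t(2) ev_desc[OF that] by linarith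
    ultimately show ?thesis using t(1) by blast
  qed
  ultimately show ?thesis unfolding q by blast
qed

lemma transmit_opportunities_eq:
  assumes \<sigma>: "0 < \<sigma>" and Y: "Y \<in> carrier_mat n l"
    and generic: "\<And>t r. t \<in> \<rat> \<Longrightarrow> r \<le> l \<Longrightarrow> is_proj n r (plim (step_poly t) n m (\<lambda>i. H $$ i)) \<Longrightarrow>
      compress_det n r (plim (step_poly t) n m (\<lambda>i. H $$ i)) (\<lambda>i. Y $$ i) \<noteq> 0"
  shows "transmit_opportunities \<sigma> p H U Y = l - num_used \<sigma> p H"
proof -
  define q where "q = num_used \<sigma> p H"
  obtain t where q: "q \<le> n" and t: "t \<in> \<rat>" "\<And>i. i < q \<Longrightarrow> t < ev i" "\<And>i. q \<le> i \<Longrightarrow> ev i < t"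
    using num_used_threshold[OF \<sigma>, of p] unfolding q_def by auto
  have pl: "plim (step_poly t) n m (\<lambda>i. H $$ i) u v = eig_proj q u v" if "u < n" "v < n" for u v
    by (rule plim_step_poly[OF t(2,3) q that])
  have "is_proj n (min q l) (eig_proj q)" using q by (intro is_proj_eig_proj) auto
  then have "is_proj n (min q l) (plim (step_poly t) n m (\<lambda>i. H $$ i))"
    using is_proj_cong[OF pl] by simp
  then have "compress_det n (min q l) (plim (step_poly t) n m (\<lambda>i. H $$ i)) (\<lambda>i. Y $$ i) \<noteq> 0"
    using t(1) by (intro generic) auto
  then have "compress_det n (min q l) (eig_proj q) (\<lambda>i. Y $$ i) \<noteq> 0"
    using compress_det_cong[OF pl, where r = "min q l" and y = "\<lambda>i. Y $$ i" and y' = "\<lambda>i. Y $$ i"]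
    by simp
  from kernel_dim_first_rows[OF Y q this] show ?thesis
    unfolding transmit_opportunities_def q_def[symmetric] by simp
qed

end

text \<open>The exceptional set is a countable union over sizes, rational thresholds and
  \<open>r \<le> l\<close>, fixed before the decomposition is chosen. Hence \<open>U\<close>,
  \<open>S\<close>, \<open>V\<close> can be quantified inside the almost sure statement.\<close>

lemma AE_transmit_opportunities_eq:
  fixes H11 H12 :: "nat \<Rightarrow> nat \<Rightarrow> nat \<Rightarrow> 'w \<Rightarrow> complex mat"
  assumes P: "prob_space P"
    and H: "\<And>n m l. 0 < n \<Longrightarrow> 0 < m \<Longrightarrow> 0 < l \<Longrightarrow>
           iid_gaussian_matrix P n m (1 / real m) (H11 n m l) \<and>
           iid_gaussian_matrix P n l (1 / real l) (H12 n m l) \<and>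
           indep_matrices P n m (H11 n m l) n l (H12 n m l)"
    and \<sigma>: "0 < \<sigma>"
  shows "AE w in P. \<forall>n m l U S V. 0 < n \<longrightarrow> 0 < m \<longrightarrow> 0 < l \<longrightarrow> is_svd (H11 n m l w) U S V \<longrightarrow>
    transmit_opportunities \<sigma> p (H11 n m l w) U (H12 n m l w) = l - num_used \<sigma> p (H11 n m l w)"
proof -
  define G where "G n m l t r w \<longleftrightarrow>
    (is_proj n r (plim (step_poly t) n m (\<lambda>i. H11 n m l w $$ i)) \<longrightarrow>
     compress_det n r (plim (step_poly t) n m (\<lambda>i. H11 n m l w $$ i)) (\<lambda>i. H12 n m l w $$ i) \<noteq> 0)"
    for n m l t r w
  have "AE w in P. 0 < n \<longrightarrow> 0 < m \<longrightarrow> 0 < l \<longrightarrow> (\<forall>t\<in>\<rat>. \<forall>r\<in>{..l}. G n m l t r w)" for n m l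
  proof (cases "0 < n \<and> 0 < m \<and> 0 < l")
    case True
    have "AE w in P. G n m l t r w" if "r \<le> l" for t r
      unfolding G_def
      by (rule AE_generic_position[OF P, of n m l]) (use True H[of n m l] that in auto)
    then have "AE w in P. \<forall>t\<in>\<rat>. \<forall>r\<in>{..l}. G n m l t r w"
      by (intro AE_ball_countable[THEN iffD2] ballI countable_rat) auto
    then show ?thesis by (rule eventually_mono) auto
  qed auto
  then have "AE w in P. \<forall>n m l. 0 < n \<longrightarrow> 0 < m \<longrightarrow> 0 < l \<longrightarrow> (\<forall>t\<in>\<rat>. \<forall>r\<in>{..l}. G n m l t r w)"
    unfolding AE_all_countable by blast
  moreover have "AE w in P. w \<in> space P" by simp
  ultimately show ?thesis
  proof eventually_elim
    case (elim w)
    show ?case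
    proof (intro allI impI)
      fix n m l U S V
      assume pos: "0 < n" "0 < m" "0 < l" and svd: "is_svd (H11 n m l w) U S V"
      have c: "H11 n m l w \<in> carrier_mat n m" "H12 n m l w \<in> carrier_mat n l"
        using H[OF pos] elim(2) by (auto simp: iid_gaussian_matrix_def)
      obtain s where "svd_entries n m (H11 n m l w) U V s"
        using is_svd_entries[OF c(1) svd] by blast
      then interpret svd_entries n m "H11 n m l w" U V s .
      show "transmit_opportunities \<sigma> p (H11 n m l w) U (H12 n m l w) = l - num_used \<sigma> p (H11 n m l w)"
        by (rule transmit_opportunities_eq[OF \<sigma> c(2)]) (use elim(1) pos in \<open>auto simp: G_def\<close>)
    qed
  qed
qed

section \<open>Assembly along the given sequences of sizes\<close>

theorem mainTheorem4:
  fixes P :: "'w measure"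
    and H11 H12 :: "nat \<Rightarrow> nat \<Rightarrow> nat \<Rightarrow> 'w \<Rightarrow> complex mat"
    and N1 M1 M2 :: "nat \<Rightarrow> nat"
    and U S V :: "nat \<Rightarrow> 'w \<Rightarrow> complex mat"
    and \<alpha>11 \<alpha>12 sigma_sq p_max a b :: real
  assumes "prob_space P"
    and "\<And>n m l. 0 < n \<Longrightarrow> 0 < m \<Longrightarrow> 0 < l \<Longrightarrow>
           iid_gaussian_matrix P n m (1 / real m) (H11 n m l) \<and>
           iid_gaussian_matrix P n l (1 / real l) (H12 n m l) \<and>
           indep_matrices P n m (H11 n m l) n l (H12 n m l)"
    and "filterlim N1 at_top sequentially"
    and "filterlim M1 at_top sequentially"
    and "filterlim M2 at_top sequentially"
    and "0 < \<alpha>11" and "(\<lambda>k. real (M1 k) / real (N1 k)) \<longlonglongrightarrow> \<alpha>11"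
    and "0 < \<alpha>12" and "(\<lambda>k. real (M2 k) / real (N1 k)) \<longlonglongrightarrow> \<alpha>12"
    and "0 < sigma_sq" and "0 < p_max"
    and "\<And>k w. w \<in> space P \<Longrightarrow> is_svd (H11 (N1 k) (M1 k) (M2 k) w) (U k w) (S k w) (V k w)"
    and "a = (1 - 1 / sqrt \<alpha>11)\<^sup>2" and "b = (1 + 1 / sqrt \<alpha>11)\<^sup>2"
  shows "(\<exists>!\<beta>. is_limit_water_level sigma_sq p_max a b \<beta>) \<and>
    (\<forall>\<beta>inf. is_limit_water_level sigma_sq p_max a b \<beta>inf \<longrightarrow>
      (AE w in P.
        (\<lambda>k. real (transmit_opportunities sigma_sq p_max
                (H11 (N1 k) (M1 k) (M2 k) w) (U k w) (H12 (N1 k) (M1 k) (M2 k) w)) / real (M2 k))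
        \<longlonglongrightarrow> max 0 (1 - \<alpha>11 / \<alpha>12 * integral {max a (sigma_sq / \<beta>inf)..b} (mp_density a b))))"
proof -
  note P = assms(1) and H = assms(2) and lims = assms(3-5) and \<alpha>11 = assms(6,7) and \<alpha>12 = assms(8,9)
    and \<sigma> = assms(10) and p = assms(11) and svd = assms(12)
  \<comment> \<open>\<open>s^2\<close> is the limit of \<open>N1 / M1\<close>, the argument of
    \<open>mp_moment\<close>.\<close>
  define s where "s = 1 / sqrt \<alpha>11"
  have s: "0 < s" "s\<^sup>2 = 1 / \<alpha>11" using \<alpha>11(1) by (simp_all add: s_def power_divide)
  have ab: "a = (1 - s)\<^sup>2" "b = (1 + s)\<^sup>2" using assms(13,14) by (simp_all add: s_def)
  have "a < b" using s(1) by (simp add: ab power2_eq_square algebra_simps)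
  then have fill: "mp_water_filling a b sigma_sq p_max"
    using \<sigma> p by unfold_locales (simp_all add: ab(1))
  define Hk where "Hk k w = H11 (N1 k) (M1 k) (M2 k) w" for k w
  have "AE w in P. (\<lambda>k. real (transmit_opportunities sigma_sq p_max (Hk k w) (U k w)
        (H12 (N1 k) (M1 k) (M2 k) w)) / real (M2 k))
        \<longlonglongrightarrow> max 0 (1 - \<alpha>11 / \<alpha>12 * integral {max a (sigma_sq / \<beta>)..b} (mp_density a b))"
    if \<beta>: "is_limit_water_level sigma_sq p_max a b \<beta>" for \<beta>
  proof -
    have "AE w in P. \<forall>j. (\<lambda>k. gtr (N1 k) (M1 k) (\<lambda>i. Hk k w $$ i) j / of_nat (N1 k))
        \<longlonglongrightarrow> of_real (mp_moment (1 / \<alpha>11) j)"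
      unfolding Hk_def
      by (rule AE_wishart_moments_tendsto[where H = H11 and \<gamma> = \<alpha>12]) (use P H lims \<alpha>11 \<alpha>12 in auto)
    moreover have "AE w in P. w \<in> space P" by simp
    moreover have "AE w in P. \<forall>n m l U S V. 0 < n \<longrightarrow> 0 < m \<longrightarrow> 0 < l \<longrightarrow> is_svd (H11 n m l w) U S V \<longrightarrow>
        transmit_opportunities sigma_sq p_max (H11 n m l w) U (H12 n m l w) = l - num_used sigma_sq p_max (H11 n m l w)"
      by (rule AE_transmit_opportunities_eq[where ?H11.0 = H11 and ?H12.0 = H12]) (use P H \<sigma> in auto)
    ultimately show ?thesis
    proof eventually_elim
      case (elim w)
      note mom = elim(1) and w = elim(2) and trans = elim(3)
      have pos: "\<forall>\<^sub>F k in sequentially. 0 < N1 k \<and> 0 < M1 k \<and> 0 < M2 k"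
      proof -
        have "\<forall>\<^sub>F k in sequentially. 1 \<le> N1 k" "\<forall>\<^sub>F k in sequentially. 1 \<le> M1 k" "\<forall>\<^sub>F k in sequentially. 1 \<le> M2 k"
          using lims by (simp_all add: filterlim_at_top)
        then show ?thesis by eventually_elim auto
      qed
      \<comment> \<open>The shape of \<open>Hk k w\<close> is known only when all sizes are
        positive, yet the list \<open>ls k\<close> must be nonnegative for every \<open>k\<close>.
        The actual dimensions serve throughout and agree with \<open>N1 k\<close> and
        \<open>M1 k\<close> eventually.\<close>
      have "\<exists>sv. svd_entries (dim_row (Hk k w)) (dim_col (Hk k w)) (Hk k w) (U k w) (V k w) sv" for k
        using is_svd_entries[of "Hk k w" "dim_row (Hk k w)" "dim_col (Hk k w)"] svd[OF w, of k]
        unfolding Hk_def by auto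
      then obtain sv where sv: "\<And>k. svd_entries (dim_row (Hk k w)) (dim_col (Hk k w)) (Hk k w) (U k w) (V k w) (sv k)"
        by metis
      have dims: "dim_row (Hk k w) = N1 k" "dim_col (Hk k w) = M1 k" if "0 < N1 k \<and> 0 < M1 k \<and> 0 < M2 k" for k
        using H[of "N1 k" "M1 k" "M2 k"] that w by (auto simp: iid_gaussian_matrix_def Hk_def)
      define lam where "lam k = svd_entries.ev (dim_row (Hk k w)) (dim_col (Hk k w)) (sv k)" for k
      define ls where "ls k = map (lam k) [0..<dim_col (Hk k w)]" for k
      \<comment> \<open>Traces are normalised by \<open>N1\<close> and eigenvalue averages by
        \<open>M1\<close>; this ratio is the factor \<open>s^2\<close> of
        \<open>integral_power_mp_weight\<close>.\<close>
      have cMN: "(\<lambda>k. real (N1 k) / real (M1 k)) \<longlonglongrightarrow> s\<^sup>2"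
        using tendsto_inverse[OF \<alpha>11(2)] \<alpha>11(1) by (simp add: inverse_eq_divide s(2))
      have moments: "(\<lambda>k. list_avg (ls k) (\<lambda>x. x * x ^ j)) \<longlonglongrightarrow> integral {a..b} (\<lambda>l. l ^ j * mp_weight a b l)" for j
      proof -
        have "(\<lambda>k. real (N1 k) / real (M1 k) * Re (gtr (N1 k) (M1 k) (\<lambda>i. Hk k w $$ i) (Suc j) / of_nat (N1 k)))
            \<longlonglongrightarrow> s\<^sup>2 * Re (of_real (mp_moment (1 / \<alpha>11) (Suc j)))"
          using mom by (intro tendsto_intros cMN tendsto_Re) auto
        also have "s\<^sup>2 * Re (of_real (mp_moment (1 / \<alpha>11) (Suc j))) = integral {a..b} (\<lambda>l. l ^ j * mp_weight a b l)"
          using integral_unique[OF integral_power_mp_weight[OF s(1), of j]] by (simp add: ab s(2))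
        finally show ?thesis
        proof (rule Lim_transform_eventually)
          show "\<forall>\<^sub>F k in sequentially. real (N1 k) / real (M1 k) * Re (gtr (N1 k) (M1 k) (\<lambda>i. Hk k w $$ i) (Suc j) / of_nat (N1 k))
              = list_avg (ls k) (\<lambda>x. x * x ^ j)"
            using pos
          proof eventually_elim
            case (elim k)
            interpret svd_entries "N1 k" "M1 k" "Hk k w" "U k w" "V k w" "sv k"
              using sv[of k] by (simp add: dims[OF elim])
            have "list_avg (ls k) (\<lambda>x. x * x ^ j) = (\<Sum>i<M1 k. lam k i ^ Suc j) / real (M1 k)"
              by (simp add: list_avg_def ls_def dims[OF elim])
            also have "(\<Sum>i<M1 k. lam k i ^ Suc j) = Re (gtr (N1 k) (M1 k) (\<lambda>i. Hk k w $$ i) (Suc j))"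
              unfolding gtr_H Re_complex_of_real lam_def dims[OF elim] by (rule sum_ev_power_Suc)
            finally show ?case using elim by simp
          qed
        qed
      qed
      interpret mp_water_limit a b sigma_sq p_max ls
      proof -
        interpret mp_water_filling a b sigma_sq p_max by (rule fill)
        show "mp_water_limit a b sigma_sq p_max ls"
        proof
          fix k x assume "x \<in> set (ls k)"
          then show "0 \<le> x" using svd_entries.ev_nonneg[OF sv, of k] by (auto simp: ls_def lam_def)
        qed (rule moments)
      qed
      define q where "q k = num_used sigma_sq p_max (Hk k w)" for k
      have F: "F \<beta> = integral {max a (sigma_sq / \<beta>)..b} (mp_density a b)"
        by (simp add: F_eq low_def max.commute)
      have "(\<lambda>k. max 0 (1 - cnt k (water_level sigma_sq p_max (ls k)) * ((real (M1 k) / real (N1 k)) / (real (M2 k) / real (N1 k)))))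
          \<longlonglongrightarrow> max 0 (1 - F \<beta> * (\<alpha>11 / \<alpha>12))"
        using \<alpha>12(1) by (intro tendsto_intros cnt_water_level_tendsto[OF \<beta>] \<alpha>11 \<alpha>12) auto
      also have "max 0 (1 - F \<beta> * (\<alpha>11 / \<alpha>12)) = max 0 (1 - \<alpha>11 / \<alpha>12 * integral {max a (sigma_sq / \<beta>)..b} (mp_density a b))"
        by (simp add: F mult.commute)
      finally show ?case
      proof (rule Lim_transform_eventually)
        show "\<forall>\<^sub>F k in sequentially. max 0 (1 - cnt k (water_level sigma_sq p_max (ls k)) * ((real (M1 k) / real (N1 k)) / (real (M2 k) / real (N1 k))))
           = real (transmit_opportunities sigma_sq p_max (Hk k w) (U k w) (H12 (N1 k) (M1 k) (M2 k) w)) / real (M2 k)"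
          using pos
        proof eventually_elim
          case (elim k)
          interpret svd: svd_entries "N1 k" "M1 k" "Hk k w" "U k w" "V k w" "sv k"
            using sv[of k] by (simp add: dims[OF elim])
          have "ls k = map svd.ev [0..<M1 k]" by (simp add: ls_def lam_def dims[OF elim])
          then have "cnt k (water_level sigma_sq p_max (ls k)) = real (q k) / real (M1 k)"
            unfolding q_def svd.num_used_eq cnt_def by simp
          moreover have "transmit_opportunities sigma_sq p_max (Hk k w) (U k w) (H12 (N1 k) (M1 k) (M2 k) w) = M2 k - q k"
            unfolding q_def Hk_def using trans elim svd[OF w, of k] by blast
          \<comment> \<open>Truncated subtraction on the naturals is the positive part of the limit
            formula.\<close>
          moreover have "max 0 (1 - real (q k) / real (M2 k)) = real (M2 k - q k) / real (M2 k)"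
            using elim by (cases "q k \<le> M2 k") (auto simp: of_nat_diff diff_divide_distrib max_def)
          ultimately show ?case using elim by simp
        qed
      qed
    qed
  qed
  then show ?thesis
    using mp_water_filling.ex1_limit_level[OF fill] unfolding Hk_def by blast
qed

end
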